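(* Let $H_1$ and $H_2$ be bialgebras over $\Bbbk$ and let $\mathcal{F}\in H_1\otimes H_2\otimes H_1\otimes H_2$ be a twist on the tensor product bialgebra $H_1\otimes H_2$. Put $$\mathcal{F}_1:=(\mathrm{Id}\otimes\varepsilon\otimes\mathrm{Id}\otimes\varepsilon)(\mathcal{F})\in H_1\otimes H_1,\qquad \mathcal{F}_2:=(\varepsilon\otimes\mathrm{Id}\otimes\varepsilon\otimes\mathrm{Id})(\mathcal{F})\in H_2\otimes H_2,$$ $$\mathcal{G}:=(\mathrm{Id}\otimes\varepsilon\otimes\varepsilon\otimes\mathrm{Id})(\mathcal{F})\in H_1\otimes H_2,\qquad \mathcal{H}:=(\varepsilon\otimes\mathrm{Id}\otimes\mathrm{Id}\otimes\varepsilon)(\mathcal{F})\in H_2\otimes H_1.$$ Then $\mathcal{F}_1$ and $\mathcal{F}_2$ are twists on $H_1$ and $H_2$, respectively, and $\mathcal{R}:=\mathcal{G}^{\mathrm{op}}\mathcal{H}^{-1}\in H_2\otimes H_1$ is a weak $\mathcal{R}$-matrix of $((H_2)_{\mathcal{F}_2},(H_1)_{\mathcal{F}_1})$. Moreover, $$\mathcal{F}^{\mathcal{G}}=(\mathcal{G}\otimes\mathcal{G})\,\mathcal{F}\,\Delta_{H_1\otimes H_2}(\mathcal{G}^{-1})=(1_{H_1}\otimes\mathcal{R}^{-1}\otimes1_{H_2})\big((\mathrm{Id}_{H_1}\otimes\tau\otimes\mathrm{Id}_{H_2})(\mathcal{F}_1\otimes\mathcal{F}_2)\big),$$ and consequently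 $\mathcal{F}$ is cohomologous to the right-hand side.
   Context: $\Bbbk$ is an arbitrary field; bialgebras, tensor products and linear maps are over $\Bbbk$. $\tau$ denotes the canonical flip of vector spaces, $\varepsilon$ the counit, and $H^\times$ the set of multiplicatively invertible elements of $H$. For $T=\sum_i T^i\otimes T_i\in A\otimes B$ (summation usually suppressed), $T^{\mathrm{op}}:=\tau(T)=T_i\otimes T^i\in B\otimes A$. The tensor product bialgebra $H_1\otimes H_2$ has componentwise multiplication, unit $1\otimes 1$, comultiplication $\Delta_{H_1\otimes H_2}=(\mathrm{Id}\otimes\tau\otimes\mathrm{Id})(\Delta_{H_1}\otimes\Delta_{H_2})$ and counit $\varepsilon\otimes\varepsilon$. A twist on a bialgebra $H$ is an invertible element $\mathcal{F}\in H\otimes H$ with $(\mathcal{F}\otimes1)(\Delta\otimes\mathrm{Id})(\mathcal{F})=(1\otimes\mathcal{F})(\mathrm{Id}\otimes\Delta)(\mathcal{F})$ and $(\varepsilon\otimes\mathrm{Id})(\mathcal{F})=1=(\mathrm{Id}\otimes\varepsilon)(\mathcal{F})$. Then $H_{\mathcal{F}}$ denotes the bialgebra with the same algebra structure and counit as $H$ and comultiplication $\Delta_{\mathcal{F}}(\cdot)=\mathcal{F}\Delta(\cdot)\mathcal{F}^{-1}$. For a twist $\mathcal{F}$ on $H$ and $h\in H^\times$ put $\mathcal{F}^h:=(h\otimes h)\mathcal{F}\Delta(h^{-1})$. Two twists $\mathcal{F}',\mathcal{F}$ on $H$ are cohomologous if $(\mathcal{F}')^h=\mathcal{F}$ for some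 $h\in H^\times$. For bialgebras $A,B$, an invertible element $\mathcal{R}\in A\otimes B$ is a weak $\mathcal{R}$-matrix of $(A,B)$ if $(\mathrm{Id}_A\otimes\Delta_B)(\mathcal{R})=\mathcal{R}_{13}\mathcal{R}_{12}$ in $A\otimes B\otimes B$ and $(\Delta_A\otimes\mathrm{Id}_B)(\mathcal{R})=\mathcal{R}_{13}\mathcal{R}_{23}$ in $A\otimes A\otimes B$, with the usual leg notation. *)

theory Defs
  imports "HOL-Algebra.Module"
begin

section \<open>Tensor products over a field\<close>

text \<open>A list \<open>[(a1, b1), \<dots>, (an, bn)]\<close> is read as the formal sum \<open>a1 \<otimes> b1 + \<dots> + an \<otimes> bn\<close>.
  The tensor product of \<open>A\<close> and \<open>B\<close> over \<open>K\<close> is the free commutative monoid on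
  \<open>carrier A \<times> carrier B\<close> modulo the congruence generated by biadditivity, by
  \<open>(r a) \<otimes> b = a \<otimes> (r b)\<close> and by \<open>0 \<otimes> b = 0\<close>.  The last relation makes the quotient a
  group (\<open>(- a) \<otimes> b\<close> is an additive inverse of \<open>a \<otimes> b\<close>), so there is no need to start from the
  free abelian group.  Scalars need not occur as coefficients of formal sums, because they can be
  absorbed into the first factor.\<close>

type_synonym ('a, 'b) tensor = "('a \<times> 'b) list set"

inductive_set tensor_rel ::
  "('k, 'm) ring_scheme \<Rightarrow> ('k, 'a, 'p) module_scheme \<Rightarrow> ('k, 'b, 'q) module_scheme
    \<Rightarrow> (('a \<times> 'b) list \<times> ('a \<times> 'b) list) set"
  for K A B
where
  refl: "set xs \<subseteq> carrier A \<times> carrier B \<Longrightarrow> (xs, xs) \<in> tensor_rel K A B"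
| sym: "(xs, ys) \<in> tensor_rel K A B \<Longrightarrow> (ys, xs) \<in> tensor_rel K A B"
| trans: "(xs, ys) \<in> tensor_rel K A B \<Longrightarrow> (ys, zs) \<in> tensor_rel K A B \<Longrightarrow>
    (xs, zs) \<in> tensor_rel K A B"
| append: "(xs, xs') \<in> tensor_rel K A B \<Longrightarrow> (ys, ys') \<in> tensor_rel K A B \<Longrightarrow>
    (xs @ ys, xs' @ ys') \<in> tensor_rel K A B"
| commute: "set xs \<subseteq> carrier A \<times> carrier B \<Longrightarrow> set ys \<subseteq> carrier A \<times> carrier B \<Longrightarrow>
    (xs @ ys, ys @ xs) \<in> tensor_rel K A B"
| zero: "b \<in> carrier B \<Longrightarrow> ([(\<zero>\<^bsub>A\<^esub>, b)], []) \<in> tensor_rel K A B"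
| add_left: "a \<in> carrier A \<Longrightarrow> a' \<in> carrier A \<Longrightarrow> b \<in> carrier B \<Longrightarrow>
    ([(a \<oplus>\<^bsub>A\<^esub> a', b)], [(a, b), (a', b)]) \<in> tensor_rel K A B"
| add_right: "a \<in> carrier A \<Longrightarrow> b \<in> carrier B \<Longrightarrow> b' \<in> carrier B \<Longrightarrow>
    ([(a, b \<oplus>\<^bsub>B\<^esub> b')], [(a, b), (a, b')]) \<in> tensor_rel K A B"
| smult: "r \<in> carrier K \<Longrightarrow> a \<in> carrier A \<Longrightarrow> b \<in> carrier B \<Longrightarrow>
    ([(r \<odot>\<^bsub>A\<^esub> a, b)], [(a, r \<odot>\<^bsub>B\<^esub> b)]) \<in> tensor_rel K A B"

definition tensor_class ::
  "('k, 'm) ring_scheme \<Rightarrow> ('k, 'a, 'p) module_scheme \<Rightarrow> ('k, 'b, 'q) module_scheme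
    \<Rightarrow> ('a \<times> 'b) list \<Rightarrow> ('a, 'b) tensor"
  where "tensor_class K A B xs = tensor_rel K A B `` {xs}"

definition pure_tensor ::
  "('k, 'm) ring_scheme \<Rightarrow> ('k, 'a, 'p) module_scheme \<Rightarrow> ('k, 'b, 'q) module_scheme
    \<Rightarrow> 'a \<Rightarrow> 'b \<Rightarrow> ('a, 'b) tensor"
  where "pure_tensor K A B a b = tensor_class K A B [(a, b)]"

definition tensor_alg ::
  "('k, 'm) ring_scheme \<Rightarrow> ('k, 'a, 'p) module_scheme \<Rightarrow> ('k, 'b, 'q) module_scheme
    \<Rightarrow> ('k, ('a, 'b) tensor) module"
  where "tensor_alg K A B =
    \<lparr> carrier = {xs. set xs \<subseteq> carrier A \<times> carrier B} // tensor_rel K A B,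
      mult = (\<lambda>X Y. \<Union>xs\<in>X. \<Union>ys\<in>Y.
        tensor_class K A B [(a \<otimes>\<^bsub>A\<^esub> c, b \<otimes>\<^bsub>B\<^esub> d). (a, b) \<leftarrow> xs, (c, d) \<leftarrow> ys]),
      one = pure_tensor K A B \<one>\<^bsub>A\<^esub> \<one>\<^bsub>B\<^esub>,
      zero = tensor_class K A B [],
      add = (\<lambda>X Y. \<Union>xs\<in>X. \<Union>ys\<in>Y. tensor_class K A B (xs @ ys)),
      smult = (\<lambda>r X. \<Union>xs\<in>X. tensor_class K A B [(r \<odot>\<^bsub>A\<^esub> a, b). (a, b) \<leftarrow> xs]) \<rparr>"

text \<open>\<open>tensor_lift M f\<close> is the linear map into \<open>M\<close> that sends \<open>a \<otimes> b\<close> to \<open>f a b\<close>; it is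
  only meaningful for bilinear \<open>f\<close>, for which the sum does not depend on the representative.\<close>

definition tensor_lift ::
  "('c, 'r) ring_scheme \<Rightarrow> ('a \<Rightarrow> 'b \<Rightarrow> 'c) \<Rightarrow> ('a, 'b) tensor \<Rightarrow> 'c"
  where "tensor_lift M f X =
    the_elem ((\<lambda>xs. foldr (\<lambda>(a, b) s. f a b \<oplus>\<^bsub>M\<^esub> s) xs \<zero>\<^bsub>M\<^esub>) ` X)"

text \<open>In \<open>tensor_map K C D f g\<close>, which is \<open>f \<otimes> g\<close>, the explicit arguments \<open>C\<close> and \<open>D\<close> are the
  codomains of \<open>f\<close> and \<open>g\<close>; the domains are not needed.\<close>

definition tensor_map ::
  "('k, 'm) ring_scheme \<Rightarrow> ('k, 'c, 'p) module_scheme \<Rightarrow> ('k, 'd, 'q) module_scheme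
    \<Rightarrow> ('a \<Rightarrow> 'c) \<Rightarrow> ('b \<Rightarrow> 'd) \<Rightarrow> ('a, 'b) tensor \<Rightarrow> ('c, 'd) tensor"
  where "tensor_map K C D f g =
    tensor_lift (tensor_alg K C D) (\<lambda>a b. pure_tensor K C D (f a) (g b))"

definition tensor_flip ::
  "('k, 'm) ring_scheme \<Rightarrow> ('k, 'a, 'p) module_scheme \<Rightarrow> ('k, 'b, 'q) module_scheme
    \<Rightarrow> ('a, 'b) tensor \<Rightarrow> ('b, 'a) tensor"
  where "tensor_flip K A B = tensor_lift (tensor_alg K B A) (\<lambda>a b. pure_tensor K B A b a)"

text \<open>Iterated tensor products are bracketed explicitly.  The canonical identification
  \<open>(A \<otimes> B) \<otimes> C \<rightarrow> A \<otimes> (B \<otimes> C)\<close>:\<close>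

definition tensor_assoc ::
  "('k, 'm) ring_scheme \<Rightarrow> ('k, 'a, 'p) module_scheme \<Rightarrow> ('k, 'b, 'q) module_scheme
    \<Rightarrow> ('k, 'c, 'r) module_scheme \<Rightarrow> (('a, 'b) tensor, 'c) tensor \<Rightarrow> ('a, ('b, 'c) tensor) tensor"
  where "tensor_assoc K A B C =
    tensor_lift (tensor_alg K A (tensor_alg K B C))
      (\<lambda>X c. tensor_lift (tensor_alg K A (tensor_alg K B C))
        (\<lambda>a b. pure_tensor K A (tensor_alg K B C) a (pure_tensor K B C b c)) X)"

text \<open>\<open>Id \<otimes> \<tau> \<otimes> Id\<close>, as a map \<open>(A \<otimes> B) \<otimes> (C \<otimes> D) \<rightarrow> (A \<otimes> C) \<otimes> (B \<otimes> D)\<close>:\<close>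

definition tensor_middle_flip ::
  "('k, 'm) ring_scheme \<Rightarrow> ('k, 'a, 'p) module_scheme \<Rightarrow> ('k, 'b, 'q) module_scheme
    \<Rightarrow> ('k, 'c, 'r) module_scheme \<Rightarrow> ('k, 'd, 's) module_scheme
    \<Rightarrow> (('a, 'b) tensor, ('c, 'd) tensor) tensor \<Rightarrow> (('a, 'c) tensor, ('b, 'd) tensor) tensor"
  where "tensor_middle_flip K A B C D =
    (let T = tensor_alg K (tensor_alg K A C) (tensor_alg K B D) in
     tensor_lift T (\<lambda>X Y.
       tensor_lift T (\<lambda>a b.
         tensor_lift T (\<lambda>c d.
           pure_tensor K (tensor_alg K A C) (tensor_alg K B D)
             (pure_tensor K A C a c) (pure_tensor K B D b d)) Y) X))"


section \<open>Bialgebras\<close>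

locale k_algebra = field K + module K A + ring A
  for K (structure) and A (structure) +
  assumes smult_mult_left:
      "r \<in> carrier K \<Longrightarrow> x \<in> carrier A \<Longrightarrow> y \<in> carrier A \<Longrightarrow>
        (r \<odot>\<^bsub>A\<^esub> x) \<otimes>\<^bsub>A\<^esub> y = r \<odot>\<^bsub>A\<^esub> (x \<otimes>\<^bsub>A\<^esub> y)"
    and smult_mult_right:
      "r \<in> carrier K \<Longrightarrow> x \<in> carrier A \<Longrightarrow> y \<in> carrier A \<Longrightarrow>
        x \<otimes>\<^bsub>A\<^esub> (r \<odot>\<^bsub>A\<^esub> y) = r \<odot>\<^bsub>A\<^esub> (x \<otimes>\<^bsub>A\<^esub> y)"

record ('k, 'a) bialgebra = "('k, 'a) module" +
  comult :: "'a \<Rightarrow> ('a, 'a) tensor"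
  counit :: "'a \<Rightarrow> 'k"

text \<open>\<open>\<epsilon> \<otimes> Id : H \<otimes> B \<rightarrow> B\<close> and \<open>Id \<otimes> \<epsilon> : A \<otimes> H \<rightarrow> A\<close>, with
  \<open>K \<otimes> B\<close> and \<open>A \<otimes> K\<close> identified with \<open>B\<close> and \<open>A\<close>:\<close>

definition counit_left ::
  "('k, 'h, 'p) bialgebra_scheme \<Rightarrow> ('k, 'b, 'q) module_scheme \<Rightarrow> ('h, 'b) tensor \<Rightarrow> 'b"
  where "counit_left H B = tensor_lift B (\<lambda>h b. counit H h \<odot>\<^bsub>B\<^esub> b)"

definition counit_right ::
  "('k, 'a, 'p) module_scheme \<Rightarrow> ('k, 'h, 'q) bialgebra_scheme \<Rightarrow> ('a, 'h) tensor \<Rightarrow> 'a"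
  where "counit_right A H = tensor_lift A (\<lambda>a h. counit H h \<odot>\<^bsub>A\<^esub> a)"

locale bialgebra = k_algebra K H
  for K (structure) and H (structure) +
  assumes comult_ring_hom: "comult H \<in> ring_hom H (tensor_alg K H H)"
    and comult_smult: "r \<in> carrier K \<Longrightarrow> h \<in> carrier H \<Longrightarrow>
      comult H (r \<odot>\<^bsub>H\<^esub> h) = r \<odot>\<^bsub>tensor_alg K H H\<^esub> comult H h"
    and counit_ring_hom: "counit H \<in> ring_hom H K"
    and counit_smult: "r \<in> carrier K \<Longrightarrow> h \<in> carrier H \<Longrightarrow>
      counit H (r \<odot>\<^bsub>H\<^esub> h) = r \<otimes>\<^bsub>K\<^esub> counit H h"
    and coassoc: "h \<in> carrier H \<Longrightarrow>
      tensor_assoc K H H H (tensor_map K (tensor_alg K H H) H (comult H) id (comult H h)) =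
      tensor_map K H (tensor_alg K H H) id (comult H) (comult H h)"
    and counit_left_comult: "h \<in> carrier H \<Longrightarrow> counit_left H H (comult H h) = h"
    and counit_right_comult: "h \<in> carrier H \<Longrightarrow> counit_right H H (comult H h) = h"

definition tensor_bialg ::
  "('k, 'm) ring_scheme \<Rightarrow> ('k, 'a, 'p) bialgebra_scheme \<Rightarrow> ('k, 'b, 'q) bialgebra_scheme
    \<Rightarrow> ('k, ('a, 'b) tensor) bialgebra"
  where "tensor_bialg K A B =
    module.extend (tensor_alg K A B)
      (bialgebra.fields
        (\<lambda>X. tensor_middle_flip K A A B B
          (tensor_map K (tensor_alg K A A) (tensor_alg K B B) (comult A) (comult B) X))
        (tensor_lift K (\<lambda>a b. counit A a \<otimes>\<^bsub>K\<^esub> counit B b)))"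


section \<open>Twists and weak R-matrices\<close>

definition twist ::
  "('k, 'm) ring_scheme \<Rightarrow> ('k, 'h, 'p) bialgebra_scheme \<Rightarrow> ('h, 'h) tensor \<Rightarrow> bool"
  where "twist K H F \<longleftrightarrow>
    (let HH = tensor_alg K H H in
      F \<in> Units HH \<and>
      tensor_assoc K H H H
        (pure_tensor K HH H F \<one>\<^bsub>H\<^esub> \<otimes>\<^bsub>tensor_alg K HH H\<^esub> tensor_map K HH H (comult H) id F) =
      pure_tensor K H HH \<one>\<^bsub>H\<^esub> F \<otimes>\<^bsub>tensor_alg K H HH\<^esub> tensor_map K H HH id (comult H) F \<and>
      counit_left H H F = \<one>\<^bsub>H\<^esub> \<and>
      counit_right H H F = \<one>\<^bsub>H\<^esub>)"

definition twisted_bialg ::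
  "('k, 'm) ring_scheme \<Rightarrow> ('k, 'h, 'p) bialgebra_scheme \<Rightarrow> ('h, 'h) tensor
    \<Rightarrow> ('k, 'h, 'p) bialgebra_scheme"
  where "twisted_bialg K H F = H \<lparr> comult := (\<lambda>h.
    F \<otimes>\<^bsub>tensor_alg K H H\<^esub> comult H h \<otimes>\<^bsub>tensor_alg K H H\<^esub> inv\<^bsub>tensor_alg K H H\<^esub> F) \<rparr>"

definition gauge ::
  "('k, 'm) ring_scheme \<Rightarrow> ('k, 'h, 'p) bialgebra_scheme \<Rightarrow> 'h \<Rightarrow> ('h, 'h) tensor
    \<Rightarrow> ('h, 'h) tensor"
  where "gauge K H h F =
    pure_tensor K H H h h \<otimes>\<^bsub>tensor_alg K H H\<^esub> F \<otimes>\<^bsub>tensor_alg K H H\<^esub> comult H (inv\<^bsub>H\<^esub> h)"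

definition cohomologous ::
  "('k, 'm) ring_scheme \<Rightarrow> ('k, 'h, 'p) bialgebra_scheme \<Rightarrow> ('h, 'h) tensor
    \<Rightarrow> ('h, 'h) tensor \<Rightarrow> bool"
  where "cohomologous K H F' F \<longleftrightarrow>
    twist K H F' \<and> twist K H F \<and> (\<exists>h\<in>Units H. gauge K H h F' = F)"

text \<open>The legs \<open>T\<^sub>1\<^sub>2\<close>, \<open>T\<^sub>1\<^sub>3\<close> of \<open>T \<in> A \<otimes> B\<close> in \<open>A \<otimes> (B \<otimes> B)\<close>, and the legs
  \<open>T\<^sub>1\<^sub>3\<close>, \<open>T\<^sub>2\<^sub>3\<close> of \<open>T\<close> in \<open>(A \<otimes> A) \<otimes> B\<close>:\<close>

definition leg12_right ::
  "('k, 'm) ring_scheme \<Rightarrow> ('k, 'a, 'p) module_scheme \<Rightarrow> ('k, 'b, 'q) module_scheme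
    \<Rightarrow> ('a, 'b) tensor \<Rightarrow> ('a, ('b, 'b) tensor) tensor"
  where "leg12_right K A B = tensor_map K A (tensor_alg K B B) id (\<lambda>b. pure_tensor K B B b \<one>\<^bsub>B\<^esub>)"

definition leg13_right ::
  "('k, 'm) ring_scheme \<Rightarrow> ('k, 'a, 'p) module_scheme \<Rightarrow> ('k, 'b, 'q) module_scheme
    \<Rightarrow> ('a, 'b) tensor \<Rightarrow> ('a, ('b, 'b) tensor) tensor"
  where "leg13_right K A B = tensor_map K A (tensor_alg K B B) id (\<lambda>b. pure_tensor K B B \<one>\<^bsub>B\<^esub> b)"

definition leg13_left ::
  "('k, 'm) ring_scheme \<Rightarrow> ('k, 'a, 'p) module_scheme \<Rightarrow> ('k, 'b, 'q) module_scheme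
    \<Rightarrow> ('a, 'b) tensor \<Rightarrow> (('a, 'a) tensor, 'b) tensor"
  where "leg13_left K A B = tensor_map K (tensor_alg K A A) B (\<lambda>a. pure_tensor K A A a \<one>\<^bsub>A\<^esub>) id"

definition leg23_left ::
  "('k, 'm) ring_scheme \<Rightarrow> ('k, 'a, 'p) module_scheme \<Rightarrow> ('k, 'b, 'q) module_scheme
    \<Rightarrow> ('a, 'b) tensor \<Rightarrow> (('a, 'a) tensor, 'b) tensor"
  where "leg23_left K A B = tensor_map K (tensor_alg K A A) B (\<lambda>a. pure_tensor K A A \<one>\<^bsub>A\<^esub> a) id"

definition weak_R_matrix ::
  "('k, 'm) ring_scheme \<Rightarrow> ('k, 'a, 'p) bialgebra_scheme \<Rightarrow> ('k, 'b, 'q) bialgebra_scheme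
    \<Rightarrow> ('a, 'b) tensor \<Rightarrow> bool"
  where "weak_R_matrix K A B R \<longleftrightarrow>
    R \<in> Units (tensor_alg K A B) \<and>
    tensor_map K A (tensor_alg K B B) id (comult B) R =
      leg13_right K A B R \<otimes>\<^bsub>tensor_alg K A (tensor_alg K B B)\<^esub> leg12_right K A B R \<and>
    tensor_map K (tensor_alg K A A) B (comult A) id R =
      leg13_left K A B R \<otimes>\<^bsub>tensor_alg K (tensor_alg K A A) B\<^esub> leg23_left K A B R"

text \<open>\<open>1 \<otimes> T \<otimes> 1 \<in> (A \<otimes> B) \<otimes> (A \<otimes> B)\<close> for \<open>T \<in> B \<otimes> A\<close>:\<close>

definition embed_middle ::
  "('k, 'm) ring_scheme \<Rightarrow> ('k, 'a, 'p) module_scheme \<Rightarrow> ('k, 'b, 'q) module_scheme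
    \<Rightarrow> ('b, 'a) tensor \<Rightarrow> (('a, 'b) tensor, ('a, 'b) tensor) tensor"
  where "embed_middle K A B =
    tensor_map K (tensor_alg K A B) (tensor_alg K A B)
      (\<lambda>b. pure_tensor K A B \<one>\<^bsub>A\<^esub> b) (\<lambda>a. pure_tensor K A B a \<one>\<^bsub>B\<^esub>)"

end

theory Submission
  imports Defs
begin

text \<open>The twist \<open>F\<close> lives on \<open>H1 \<otimes> H2\<close>, and every assertion is an identity in some iterated tensor
  product of copies of \<open>H1\<close> and \<open>H2\<close>.  Such identities are tested, as in leg notation, by mapping
  into one algebra.  If \<open>f : A \<rightarrow> M\<close> and \<open>g : B \<rightarrow> M\<close> are algebra homomorphisms with commuting images,
  then \<open>a \<otimes> b \<mapsto> f a \<cdot> g b\<close> is an algebra homomorphism \<open>A \<otimes> B \<rightarrow> M\<close> (\<open>tlift\<close>).  An element of an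
  iterated tensor product is determined by its images under such maps (\<open>tensor3_eqI\<close>,
  \<open>tensor3_left_eqI\<close>, \<open>tensor4_eqI\<close>), and flips, rebracketings and legs only permute or drop the
  homomorphisms \<open>f\<close>, \<open>g\<close>.  With the convolution \<open>u * v = tlift u v \<circ> \<Delta>\<close> and
  \<open>\<Phi>(u, v) = tlift u v F\<close>, the cocycle condition becomes
  \<open>\<Phi>(u, v) \<cdot> \<Phi>(u * v, w) = \<Phi>(v, w) \<cdot> \<Phi>(u, v * w)\<close> for pairwise commuting \<open>u\<close>, \<open>v\<close>, \<open>w\<close>.

  A homomorphism on \<open>H1 \<otimes> H2\<close> is a commuting pair \<open>[a, c]\<close>, and
  \<open>[a, c] * [b, d] = [a * b, c * d]\<close> (\<open>convolution_HH\<close>).  Let \<open>e\<close> be the counit followed by the unit;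
  it is neutral for convolution.  Then \<open>F1\<close>, \<open>F2\<close>, \<open>G\<close>, \<open>H\<close> evaluate to \<open>\<Phi>([a, e], [b, e])\<close>,
  \<open>\<Phi>([e, c], [e, d])\<close>, \<open>\<Phi>([a, e], [e, c])\<close> and \<open>\<Phi>([e, c], [a, e])\<close>, and all claims follow by choosing
  entries of \<open>u\<close>, \<open>v\<close>, \<open>w\<close> to be \<open>e\<close> in the cocycle identity: the twist property of \<open>F1\<close> and \<open>F2\<close>
  at once, the two \<open>R\<close>-matrix axioms from three instances each (\<open>R_right_identity\<close>,
  \<open>R_left_identity\<close>), and the formula for the gauge transform from five (\<open>gauge_identity\<close>).
  The gauge transform of a twist by an element of counit \<open>1\<close> is a twist (\<open>twist_gauge\<close>), and
  \<open>\<epsilon>(G) = 1\<close>; this yields the last claim.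

  Two general constructions are needed: the tensor product of algebras is an algebra
  (\<open>k_algebra_T\<close>), and that of bialgebras is a bialgebra (\<open>bialgebra_HH\<close>).\<close>

section \<open>The tensor product of two algebras\<close>

text \<open>The value of a formal tensor under \<open>a \<otimes> b \<mapsto> f a b\<close>.\<close>

definition list_sum :: "('c, 'r) ring_scheme \<Rightarrow> ('a \<Rightarrow> 'b \<Rightarrow> 'c) \<Rightarrow> ('a \<times> 'b) list \<Rightarrow> 'c"
  where "list_sum M f xs = foldr (\<lambda>(a, b) s. f a b \<oplus>\<^bsub>M\<^esub> s) xs \<zero>\<^bsub>M\<^esub>"

text \<open>The maps for which \<open>list_sum\<close> respects the tensor relation.  The clause \<open>f 0 b = 0\<close> is part of the
  definition because the notion is applied with the tensor product as target while this is only
  known to be an additive monoid; for groups it is redundant (\<open>balanced_group\<close>).\<close>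

definition balanced ::
  "('k, 'm) ring_scheme \<Rightarrow> ('k, 'a, 'p) module_scheme \<Rightarrow> ('k, 'b, 'q) module_scheme
    \<Rightarrow> ('c, 'r) ring_scheme \<Rightarrow> ('a \<Rightarrow> 'b \<Rightarrow> 'c) \<Rightarrow> bool"
  where "balanced K A B M f \<longleftrightarrow>
    (\<forall>a\<in>carrier A. \<forall>b\<in>carrier B. f a b \<in> carrier M) \<and>
    (\<forall>b\<in>carrier B. f \<zero>\<^bsub>A\<^esub> b = \<zero>\<^bsub>M\<^esub>) \<and>
    (\<forall>a\<in>carrier A. \<forall>a'\<in>carrier A. \<forall>b\<in>carrier B. f (a \<oplus>\<^bsub>A\<^esub> a') b = f a b \<oplus>\<^bsub>M\<^esub> f a' b) \<and>
    (\<forall>a\<in>carrier A. \<forall>b\<in>carrier B. \<forall>b'\<in>carrier B. f a (b \<oplus>\<^bsub>B\<^esub> b') = f a b \<oplus>\<^bsub>M\<^esub> f a b') \<and>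
    (\<forall>r\<in>carrier K. \<forall>a\<in>carrier A. \<forall>b\<in>carrier B. f (r \<odot>\<^bsub>A\<^esub> a) b = f a (r \<odot>\<^bsub>B\<^esub> b))"

lemma balancedI:
  assumes "\<And>a b. a \<in> carrier A \<Longrightarrow> b \<in> carrier B \<Longrightarrow> f a b \<in> carrier M"
    and "\<And>b. b \<in> carrier B \<Longrightarrow> f \<zero>\<^bsub>A\<^esub> b = \<zero>\<^bsub>M\<^esub>"
    and "\<And>a a' b. a \<in> carrier A \<Longrightarrow> a' \<in> carrier A \<Longrightarrow> b \<in> carrier B \<Longrightarrow>
      f (a \<oplus>\<^bsub>A\<^esub> a') b = f a b \<oplus>\<^bsub>M\<^esub> f a' b"
    and "\<And>a b b'. a \<in> carrier A \<Longrightarrow> b \<in> carrier B \<Longrightarrow> b' \<in> carrier B \<Longrightarrow>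
      f a (b \<oplus>\<^bsub>B\<^esub> b') = f a b \<oplus>\<^bsub>M\<^esub> f a b'"
    and "\<And>r a b. r \<in> carrier K \<Longrightarrow> a \<in> carrier A \<Longrightarrow> b \<in> carrier B \<Longrightarrow>
      f (r \<odot>\<^bsub>A\<^esub> a) b = f a (r \<odot>\<^bsub>B\<^esub> b)"
  shows "balanced K A B M f"
  using assms unfolding balanced_def by blast

lemma list_sum_Nil [simp]: "list_sum M f [] = \<zero>\<^bsub>M\<^esub>"
  and list_sum_Cons [simp]: "list_sum M f ((a, b) # xs) = f a b \<oplus>\<^bsub>M\<^esub> list_sum M f xs"
  by (simp_all add: list_sum_def)

lemma list_sum_cong:
  "set xs \<subseteq> S \<Longrightarrow> (\<And>a b. (a, b) \<in> S \<Longrightarrow> f a b = g a b) \<Longrightarrow> list_sum M f xs = list_sum M g xs"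
  by (induction xs) auto

lemma list_sum_closed:
  assumes "abelian_monoid M" "set xs \<subseteq> S" "\<And>a b. (a, b) \<in> S \<Longrightarrow> f a b \<in> carrier M"
  shows "list_sum M f xs \<in> carrier M"
proof -
  interpret abelian_monoid M by fact
  show ?thesis using assms(2,3) by (induction xs) auto
qed

lemma list_sum_append:
  assumes "abelian_monoid M" "set xs \<subseteq> S" "set ys \<subseteq> S" "\<And>a b. (a, b) \<in> S \<Longrightarrow> f a b \<in> carrier M"
  shows "list_sum M f (xs @ ys) = list_sum M f xs \<oplus>\<^bsub>M\<^esub> list_sum M f ys"
proof -
  interpret abelian_monoid M by fact
  note cl = list_sum_closed[OF assms(1) _ assms(4)]
  show ?thesis using assms(2,3,4) by (induction xs) (auto simp: a_assoc cl)
qed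

lemma list_sum_add:
  assumes "abelian_monoid M" "set xs \<subseteq> S"
    "\<And>a b. (a, b) \<in> S \<Longrightarrow> f a b \<in> carrier M" "\<And>a b. (a, b) \<in> S \<Longrightarrow> g a b \<in> carrier M"
  shows "list_sum M (\<lambda>a b. f a b \<oplus>\<^bsub>M\<^esub> g a b) xs = list_sum M f xs \<oplus>\<^bsub>M\<^esub> list_sum M g xs"
proof -
  interpret abelian_monoid M by fact
  note cl = list_sum_closed[OF assms(1) _ assms(3)] list_sum_closed[OF assms(1) _ assms(4)]
  show ?thesis using assms(2,3,4) by (induction xs) (auto simp: a_ac cl)
qed

lemma list_sum_zero:
  assumes "abelian_monoid M" "set xs \<subseteq> S" "\<And>a b. (a, b) \<in> S \<Longrightarrow> f a b = \<zero>\<^bsub>M\<^esub>"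
  shows "list_sum M f xs = \<zero>\<^bsub>M\<^esub>"
proof -
  interpret abelian_monoid M by fact
  show ?thesis using assms(2,3) by (induction xs) auto
qed

text \<open>Sums, products and scalar multiples of tensors are computed on representing lists through
  \<open>list_sum\<close>; compatibility with the tensor relation then reduces to balancedness.\<close>

locale algebra_pair = A: k_algebra K A + B: k_algebra K B
  for K :: "('k, 'm) ring_scheme" and A :: "('k, 'a, 'p) module_scheme"
    and B :: "('k, 'b, 'q) module_scheme"
begin

abbreviation "T \<equiv> tensor_alg K A B"
abbreviation "cls \<equiv> tensor_class K A B"
abbreviation "pt \<equiv> pure_tensor K A B"
abbreviation "\<L> \<equiv> {xs. set xs \<subseteq> carrier A \<times> carrier B}"

lemma cring_K: "cring K" by (rule module.axioms(1)[OF A.module_axioms])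

lemma ring_K: "ring K" by (rule cring.axioms(1)[OF cring_K])

lemma rel_carrier:
  "(xs, ys) \<in> tensor_rel K A B \<Longrightarrow> xs \<in> \<L> \<and> ys \<in> \<L>"
  by (induction rule: tensor_rel.induct) auto

lemma equiv_rel: "equiv \<L> (tensor_rel K A B)"
proof (rule equivI)
  show "tensor_rel K A B \<subseteq> \<L> \<times> \<L>" using rel_carrier by auto
  show "refl_on \<L> (tensor_rel K A B)" by (auto intro!: refl_onI tensor_rel.refl)
  show "sym (tensor_rel K A B)" by (auto intro!: symI intro: tensor_rel.sym)
  show "trans (tensor_rel K A B)" by (auto intro!: transI intro: tensor_rel.trans)
qed

lemma cls_eq_iff: "xs \<in> \<L> \<Longrightarrow> ys \<in> \<L> \<Longrightarrow> cls xs = cls ys \<longleftrightarrow> (xs, ys) \<in> tensor_rel K A B"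
  unfolding tensor_class_def using eq_equiv_class_iff[OF equiv_rel] by blast

lemma cls_eqI: "(xs, ys) \<in> tensor_rel K A B \<Longrightarrow> cls xs = cls ys"
  using cls_eq_iff rel_carrier by blast

lemma carrier_T: "carrier T = cls ` \<L>"
  by (auto simp: tensor_alg_def quotient_def tensor_class_def)

lemma cls_closed: "xs \<in> \<L> \<Longrightarrow> cls xs \<in> carrier T"
  by (auto simp: carrier_T)

lemma add_cls:
  assumes "xs \<in> \<L>" "ys \<in> \<L>"
  shows "cls xs \<oplus>\<^bsub>T\<^esub> cls ys = cls (xs @ ys)"
proof -
  have "congruent2 (tensor_rel K A B) (tensor_rel K A B) (\<lambda>xs ys. cls (xs @ ys))"
    by (rule congruent2I') (metis cls_eqI tensor_rel.append)
  from UN_equiv_class2[OF equiv_rel equiv_rel this assms]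
  show ?thesis by (simp add: tensor_alg_def tensor_class_def)
qed

lemma zero_T: "\<zero>\<^bsub>T\<^esub> = cls []"
  by (simp add: tensor_alg_def)

lemma one_T: "\<one>\<^bsub>T\<^esub> = pt \<one>\<^bsub>A\<^esub> \<one>\<^bsub>B\<^esub>"
  by (simp add: tensor_alg_def)

lemma abelian_monoid_T: "abelian_monoid T"
proof (rule abelian_monoidI)
  fix X Y Z assume "X \<in> carrier T" "Y \<in> carrier T" "Z \<in> carrier T"
  then obtain xs ys zs where xyz: "xs \<in> \<L>" "X = cls xs" "ys \<in> \<L>" "Y = cls ys" "zs \<in> \<L>" "Z = cls zs"
    unfolding carrier_T by blast
  have ap: "\<And>us vs. us \<in> \<L> \<Longrightarrow> vs \<in> \<L> \<Longrightarrow> us @ vs \<in> \<L>" by simp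
  show "X \<oplus>\<^bsub>T\<^esub> Y \<in> carrier T" using xyz ap by (simp only: add_cls cls_closed)
  show "X \<oplus>\<^bsub>T\<^esub> Y \<oplus>\<^bsub>T\<^esub> Z = X \<oplus>\<^bsub>T\<^esub> (Y \<oplus>\<^bsub>T\<^esub> Z)" using xyz ap by (simp only: add_cls append_assoc)
  show "X \<oplus>\<^bsub>T\<^esub> Y = Y \<oplus>\<^bsub>T\<^esub> X"
    using xyz cls_eqI[OF tensor_rel.commute[of xs A B ys K]] by (simp only: add_cls mem_Collect_eq)
  have "[] \<in> \<L>" by simp
  then show "\<zero>\<^bsub>T\<^esub> \<oplus>\<^bsub>T\<^esub> X = X" using xyz(1,2) by (simp only: zero_T add_cls append_Nil)
qed (auto simp: zero_T cls_closed)

sublocale T: abelian_monoid T by (rule abelian_monoid_T)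

lemma pure_closed [simp, intro]: "a \<in> carrier A \<Longrightarrow> b \<in> carrier B \<Longrightarrow> pt a b \<in> carrier T"
  by (simp add: pure_tensor_def cls_closed)

lemma balanced_pure: "balanced K A B T pt"
proof (rule balancedI)
  fix a a' b assume "a \<in> carrier A" "a' \<in> carrier A" "b \<in> carrier B"
  then show "pt (a \<oplus>\<^bsub>A\<^esub> a') b = pt a b \<oplus>\<^bsub>T\<^esub> pt a' b"
    unfolding pure_tensor_def by (subst add_cls) (auto intro!: cls_eqI intro: tensor_rel.add_left)
next
  fix a b b' assume "a \<in> carrier A" "b \<in> carrier B" "b' \<in> carrier B"
  then show "pt a (b \<oplus>\<^bsub>B\<^esub> b') = pt a b \<oplus>\<^bsub>T\<^esub> pt a b'"
    unfolding pure_tensor_def by (subst add_cls) (auto intro!: cls_eqI intro: tensor_rel.add_right)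
qed (auto simp: pure_tensor_def zero_T intro!: cls_eqI cls_closed intro: tensor_rel.zero tensor_rel.smult)

lemmas pure_zero_left = balanced_pure[unfolded balanced_def, THEN conjunct2, THEN conjunct1, rule_format]
  and pure_add_left = balanced_pure[unfolded balanced_def, THEN conjunct2, THEN conjunct2, THEN conjunct1, rule_format]
  and pure_add_right = balanced_pure[unfolded balanced_def, THEN conjunct2, THEN conjunct2, THEN conjunct2, THEN conjunct1, rule_format]
  and pure_smult_swap = balanced_pure[unfolded balanced_def, THEN conjunct2, THEN conjunct2, THEN conjunct2, THEN conjunct2, rule_format]

lemma cls_eq_list_sum: "xs \<in> \<L> \<Longrightarrow> cls xs = list_sum T pt xs"
proof (induction xs)
  case (Cons p xs)
  obtain a b where p: "p = (a, b)" by (cases p)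
  have "cls (p # xs) = cls ([p] @ xs)" by simp
  also have "\<dots> = cls [p] \<oplus>\<^bsub>T\<^esub> cls xs" using Cons.prems by (subst add_cls) auto
  finally show ?case using Cons p by (simp add: pure_tensor_def)
qed (simp add: zero_T)

lemma list_sum_rel:
  assumes "abelian_monoid M" "balanced K A B M f" "(xs, ys) \<in> tensor_rel K A B"
  shows "list_sum M f xs = list_sum M f ys"
proof -
  interpret abelian_monoid M by fact
  have cl: "\<And>a b. (a, b) \<in> carrier A \<times> carrier B \<Longrightarrow> f a b \<in> carrier M"
    using assms(2) by (auto simp: balanced_def)
  have app: "list_sum M f (xs @ ys) = list_sum M f xs \<oplus>\<^bsub>M\<^esub> list_sum M f ys"
    if "set xs \<subseteq> carrier A \<times> carrier B" "set ys \<subseteq> carrier A \<times> carrier B" for xs ys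
    by (rule list_sum_append[OF assms(1) that cl])
  have lcl: "list_sum M f xs \<in> carrier M" if "set xs \<subseteq> carrier A \<times> carrier B" for xs
    by (rule list_sum_closed[OF assms(1) that cl])
  from assms(3) show ?thesis
  proof (induction rule: tensor_rel.induct)
    case (append xs xs' ys ys')
    then show ?case using rel_carrier[OF append.hyps(1)] rel_carrier[OF append.hyps(2)]
      by (simp add: app)
  next
    case (commute xs ys)
    then show ?case by (simp add: app lcl a_comm)
  qed (use assms(2) cl in \<open>auto simp: balanced_def\<close>)
qed

lemma tensor_lift_cls:
  assumes "abelian_monoid M" "balanced K A B M f" "xs \<in> \<L>"
  shows "tensor_lift M f (cls xs) = list_sum M f xs"
proof -
  have "xs \<in> cls xs" using assms(3) by (simp add: tensor_class_def tensor_rel.refl)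
  moreover have "list_sum M f ys = list_sum M f xs" if "ys \<in> cls xs" for ys
    using that list_sum_rel[OF assms(1,2)] by (simp add: tensor_class_def)
  ultimately have "list_sum M f ` cls xs = {list_sum M f xs}" by blast
  then show ?thesis by (simp add: tensor_lift_def list_sum_def)
qed

lemma list_sum_congruent:
  assumes "abelian_monoid M" "balanced K A B M f"
  shows "congruent (tensor_rel K A B) (list_sum M f)"
  by (rule congruentI) (rule list_sum_rel[OF assms])

lemma cls_map:
  assumes "xs \<in> \<L>" "\<And>a b. a \<in> carrier A \<Longrightarrow> b \<in> carrier B \<Longrightarrow> h a b \<in> carrier A \<times> carrier B"
  shows "cls (map (\<lambda>(a, b). h a b) xs) = list_sum T (\<lambda>a b. pt (fst (h a b)) (snd (h a b))) xs"
proof -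
  have "map (\<lambda>(a, b). h a b) xs \<in> \<L>" using assms by (induction xs) auto
  then have "cls (map (\<lambda>(a, b). h a b) xs) = list_sum T pt (map (\<lambda>(a, b). h a b) xs)"
    by (rule cls_eq_list_sum)
  also have "\<dots> = list_sum T (\<lambda>a b. pt (fst (h a b)) (snd (h a b))) xs"
    by (simp add: list_sum_def foldr_map comp_def case_prod_unfold)
  finally show ?thesis .
qed

lemma balanced_smult:
  assumes "r \<in> carrier K" shows "balanced K A B T (\<lambda>a b. pt (r \<odot>\<^bsub>A\<^esub> a) b)"
proof (rule balancedI)
  fix s a b assume *: "s \<in> carrier K" "a \<in> carrier A" "b \<in> carrier B"
  then have "r \<odot>\<^bsub>A\<^esub> (s \<odot>\<^bsub>A\<^esub> a) = s \<odot>\<^bsub>A\<^esub> (r \<odot>\<^bsub>A\<^esub> a)"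
    using assms by (metis A.m_comm A.smult_assoc1)
  then show "pt (r \<odot>\<^bsub>A\<^esub> (s \<odot>\<^bsub>A\<^esub> a)) b = pt (r \<odot>\<^bsub>A\<^esub> a) (s \<odot>\<^bsub>B\<^esub> b)"
    using * assms by (simp add: pure_smult_swap)
qed (use assms in \<open>auto simp: A.smult_r_distr pure_add_left pure_add_right pure_zero_left\<close>)

lemma smult_cls:
  assumes "r \<in> carrier K" "xs \<in> \<L>"
  shows "r \<odot>\<^bsub>T\<^esub> cls xs = list_sum T (\<lambda>a b. pt (r \<odot>\<^bsub>A\<^esub> a) b) xs"
proof -
  have eq: "cls (map (\<lambda>(a, b). (r \<odot>\<^bsub>A\<^esub> a, b)) ys) = list_sum T (\<lambda>a b. pt (r \<odot>\<^bsub>A\<^esub> a) b) ys"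
    if "ys \<in> \<L>" for ys
    using cls_map[OF that, of "\<lambda>a b. (r \<odot>\<^bsub>A\<^esub> a, b)"] assms(1) by simp
  have "congruent (tensor_rel K A B) (\<lambda>xs. cls (map (\<lambda>(a, b). (r \<odot>\<^bsub>A\<^esub> a, b)) xs))"
    using list_sum_congruent[OF abelian_monoid_T balanced_smult[OF assms(1)]] rel_carrier
    by (auto simp: congruent_def eq)
  from UN_equiv_class[OF equiv_rel this assms(2)]
  have "r \<odot>\<^bsub>T\<^esub> cls xs = cls (map (\<lambda>(a, b). (r \<odot>\<^bsub>A\<^esub> a, b)) xs)"
    by (simp add: tensor_alg_def tensor_class_def)
  then show ?thesis using eq[OF assms(2)] by simp
qed

lemma balanced_mult:
  assumes "a \<in> carrier A" "b \<in> carrier B"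
  shows "balanced K A B T (\<lambda>c d. pt (a \<otimes>\<^bsub>A\<^esub> c) (b \<otimes>\<^bsub>B\<^esub> d))"
  by (rule balancedI)
    (use assms in \<open>auto simp: A.r_distr B.r_distr pure_add_left pure_add_right pure_zero_left
      A.smult_mult_right B.smult_mult_right pure_smult_swap\<close>)

text \<open>The product of the pure tensor \<open>a \<otimes> b\<close> with the class of the formal tensor \<open>ys\<close>.\<close>

abbreviation "row ys \<equiv> \<lambda>a b. list_sum T (\<lambda>c d. pt (a \<otimes>\<^bsub>A\<^esub> c) (b \<otimes>\<^bsub>B\<^esub> d)) ys"

lemma balanced_mult_list:
  assumes "ys \<in> \<L>"
  shows "balanced K A B T (row ys)"
proof (rule balancedI)
  have ys: "set ys \<subseteq> carrier A \<times> carrier B" using assms by simp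
  note add = list_sum_add[OF abelian_monoid_T ys, symmetric]
  show "row ys a b \<in> carrier T"
    if "a \<in> carrier A" "b \<in> carrier B" for a b
    by (rule list_sum_closed[OF abelian_monoid_T ys]) (use that in auto)
  show "list_sum T (\<lambda>c d. pt (\<zero>\<^bsub>A\<^esub> \<otimes>\<^bsub>A\<^esub> c) (b \<otimes>\<^bsub>B\<^esub> d)) ys = \<zero>\<^bsub>T\<^esub>" if "b \<in> carrier B" for b
    by (rule list_sum_zero[OF abelian_monoid_T ys]) (use that in \<open>auto simp: pure_zero_left\<close>)
  show "list_sum T (\<lambda>c d. pt ((a \<oplus>\<^bsub>A\<^esub> a') \<otimes>\<^bsub>A\<^esub> c) (b \<otimes>\<^bsub>B\<^esub> d)) ys =
      row ys a b \<oplus>\<^bsub>T\<^esub>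
      list_sum T (\<lambda>c d. pt (a' \<otimes>\<^bsub>A\<^esub> c) (b \<otimes>\<^bsub>B\<^esub> d)) ys"
    if "a \<in> carrier A" "a' \<in> carrier A" "b \<in> carrier B" for a a' b
    using that by (subst add) (auto intro!: list_sum_cong[OF ys] simp: A.l_distr pure_add_left)
  show "list_sum T (\<lambda>c d. pt (a \<otimes>\<^bsub>A\<^esub> c) ((b \<oplus>\<^bsub>B\<^esub> b') \<otimes>\<^bsub>B\<^esub> d)) ys =
      row ys a b \<oplus>\<^bsub>T\<^esub>
      list_sum T (\<lambda>c d. pt (a \<otimes>\<^bsub>A\<^esub> c) (b' \<otimes>\<^bsub>B\<^esub> d)) ys"
    if "a \<in> carrier A" "b \<in> carrier B" "b' \<in> carrier B" for a b b'
    using that by (subst add) (auto intro!: list_sum_cong[OF ys] simp: B.l_distr pure_add_right)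
  show "list_sum T (\<lambda>c d. pt ((r \<odot>\<^bsub>A\<^esub> a) \<otimes>\<^bsub>A\<^esub> c) (b \<otimes>\<^bsub>B\<^esub> d)) ys =
      list_sum T (\<lambda>c d. pt (a \<otimes>\<^bsub>A\<^esub> c) ((r \<odot>\<^bsub>B\<^esub> b) \<otimes>\<^bsub>B\<^esub> d)) ys"
    if "r \<in> carrier K" "a \<in> carrier A" "b \<in> carrier B" for r a b
    using that by (auto intro!: list_sum_cong[OF ys]
      simp: A.smult_mult_left B.smult_mult_left pure_smult_swap)
qed

lemma mult_cls:
  assumes "xs \<in> \<L>" "ys \<in> \<L>"
  shows "cls xs \<otimes>\<^bsub>T\<^esub> cls ys =
    list_sum T (row ys) xs"
proof -
  let ?pr = "\<lambda>xs ys. [(a \<otimes>\<^bsub>A\<^esub> c, b \<otimes>\<^bsub>B\<^esub> d). (a, b) \<leftarrow> xs, (c, d) \<leftarrow> ys]"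
  let ?s = "\<lambda>xs ys. list_sum T (row ys) xs"
  have eq: "cls (?pr xs ys) = ?s xs ys" if "xs \<in> \<L>" "ys \<in> \<L>" for xs ys
    using that(1)
  proof (induction xs)
    case (Cons p xs)
    obtain a b where p: "p = (a, b)" by (cases p)
    have pL: "?pr us ys \<in> \<L>" if "us \<in> \<L>" for us
      using that \<open>ys \<in> \<L>\<close> by (induction us) auto
    have ab: "a \<in> carrier A" "b \<in> carrier B" using Cons.prems p by auto
    have "map (\<lambda>(c, d). (a \<otimes>\<^bsub>A\<^esub> c, b \<otimes>\<^bsub>B\<^esub> d)) ys \<in> \<L>" using pL[of "[(a, b)]"] ab by simp
    then have "cls (?pr (p # xs) ys) =
        cls (map (\<lambda>(c, d). (a \<otimes>\<^bsub>A\<^esub> c, b \<otimes>\<^bsub>B\<^esub> d)) ys) \<oplus>\<^bsub>T\<^esub> cls (?pr xs ys)"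
      using pL[of xs] Cons.prems p by (subst add_cls) auto
    also have "cls (map (\<lambda>(c, d). (a \<otimes>\<^bsub>A\<^esub> c, b \<otimes>\<^bsub>B\<^esub> d)) ys) =
       row ys a b"
      using cls_map[OF \<open>ys \<in> \<L>\<close>, of "\<lambda>c d. (a \<otimes>\<^bsub>A\<^esub> c, b \<otimes>\<^bsub>B\<^esub> d)"] ab by simp
    finally show ?case using Cons p by simp
  qed (simp add: zero_T)
  have "congruent2 (tensor_rel K A B) (tensor_rel K A B) (\<lambda>xs ys. cls (?pr xs ys))"
  proof (rule congruent2I')
    fix xs xs' ys ys'
    assume *: "(xs, xs') \<in> tensor_rel K A B" "(ys, ys') \<in> tensor_rel K A B"
    note c = rel_carrier[OF *(1)] rel_carrier[OF *(2)]
    have "?s xs ys = ?s xs' ys"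
      by (rule list_sum_rel[OF abelian_monoid_T balanced_mult_list *(1)]) (use c in simp)
    also have "\<dots> = ?s xs' ys'"
    proof (rule list_sum_cong)
      show "set xs' \<subseteq> carrier A \<times> carrier B" using c by simp
      show "row ys a b =
        row ys' a b" if "(a, b) \<in> carrier A \<times> carrier B" for a b
        by (rule list_sum_rel[OF abelian_monoid_T balanced_mult *(2)]) (use that in auto)
    qed
    finally show "cls (?pr xs ys) = cls (?pr xs' ys')"
      using eq c by simp
  qed
  from UN_equiv_class2[OF equiv_rel equiv_rel this assms]
  have "cls xs \<otimes>\<^bsub>T\<^esub> cls ys = cls (?pr xs ys)"
    by (simp add: tensor_alg_def tensor_class_def)
  then show ?thesis using eq[OF assms] by simp
qed

text \<open>Pure tensors generate the tensor product additively; negatives are not needed, because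
  \<open>- (a \<otimes> b)\<close> is the pure tensor \<open>(- a) \<otimes> b\<close>.\<close>

lemma tensor_induct [consumes 1, case_names zero pure add]:
  assumes "X \<in> carrier T"
    and "P \<zero>\<^bsub>T\<^esub>"
    and "\<And>a b. a \<in> carrier A \<Longrightarrow> b \<in> carrier B \<Longrightarrow> P (pt a b)"
    and "\<And>X Y. X \<in> carrier T \<Longrightarrow> Y \<in> carrier T \<Longrightarrow> P X \<Longrightarrow> P Y \<Longrightarrow> P (X \<oplus>\<^bsub>T\<^esub> Y)"
  shows "P X"
proof -
  obtain xs where xs: "xs \<in> \<L>" "X = cls xs" using assms(1) unfolding carrier_T by blast
  have "P (list_sum T pt xs)" using xs(1)
  proof (induction xs)
    case (Cons p xs)
    then have "list_sum T pt xs \<in> carrier T"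
      by (intro list_sum_closed[OF abelian_monoid_T]) auto
    then show ?case using Cons assms(3,4) by (cases p) auto
  qed (simp add: assms(2))
  then show ?thesis using xs cls_eq_list_sum by simp
qed

lemma pure_mult:
  assumes "a \<in> carrier A" "b \<in> carrier B" "c \<in> carrier A" "d \<in> carrier B"
  shows "pt a b \<otimes>\<^bsub>T\<^esub> pt c d = pt (a \<otimes>\<^bsub>A\<^esub> c) (b \<otimes>\<^bsub>B\<^esub> d)"
  using mult_cls[of "[(a, b)]" "[(c, d)]"] assms by (simp add: pure_tensor_def[symmetric])

lemma pure_smult:
  assumes "r \<in> carrier K" "a \<in> carrier A" "b \<in> carrier B"
  shows "r \<odot>\<^bsub>T\<^esub> pt a b = pt (r \<odot>\<^bsub>A\<^esub> a) b"
  using smult_cls[of r "[(a, b)]"] assms by (simp add: pure_tensor_def[symmetric])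

lemma T_cases:
  assumes "X \<in> carrier T" obtains xs where "xs \<in> \<L>" "X = cls xs"
  using assms unfolding carrier_T by blast

lemma list_sum_mult_closed:
  assumes "a \<in> carrier A" "b \<in> carrier B" "ys \<in> \<L>"
  shows "row ys a b \<in> carrier T"
  by (rule list_sum_closed[OF abelian_monoid_T, of _ "carrier A \<times> carrier B"]) (use assms in simp_all)

lemma T_mult_closed:
  assumes "X \<in> carrier T" "Y \<in> carrier T" shows "X \<otimes>\<^bsub>T\<^esub> Y \<in> carrier T"
proof -
  from assms obtain xs ys where "xs \<in> \<L>" "X = cls xs" "ys \<in> \<L>" "Y = cls ys"
    by (elim T_cases)
  then show ?thesis
    by (simp only: mult_cls)
      (rule list_sum_closed[OF abelian_monoid_T, of _ "carrier A \<times> carrier B"],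
        simp_all add: list_sum_mult_closed)
qed

lemma T_smult_closed:
  assumes "r \<in> carrier K" "X \<in> carrier T" shows "r \<odot>\<^bsub>T\<^esub> X \<in> carrier T"
proof -
  from assms(2) obtain xs where "xs \<in> \<L>" "X = cls xs" by (elim T_cases)
  then show ?thesis using assms(1)
    by (simp only: smult_cls)
      (rule list_sum_closed[OF abelian_monoid_T, of _ "carrier A \<times> carrier B"], simp_all)
qed

lemma T_l_distr:
  assumes "X \<in> carrier T" "Y \<in> carrier T" "Z \<in> carrier T"
  shows "(X \<oplus>\<^bsub>T\<^esub> Y) \<otimes>\<^bsub>T\<^esub> Z = X \<otimes>\<^bsub>T\<^esub> Z \<oplus>\<^bsub>T\<^esub> Y \<otimes>\<^bsub>T\<^esub> Z"
proof -
  obtain xs ys zs where xyz: "xs \<in> \<L>" "X = cls xs" "ys \<in> \<L>" "Y = cls ys" "zs \<in> \<L>" "Z = cls zs"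
    using assms unfolding carrier_T by blast
  have app: "xs @ ys \<in> \<L>" using xyz by simp
  let ?l = "\<lambda>a b. row zs a b"
  have "?l a b \<in> carrier T" if "(a, b) \<in> carrier A \<times> carrier B" for a b
    by (rule list_sum_closed[OF abelian_monoid_T, of _ "carrier A \<times> carrier B"]) (use xyz that in auto)
  then have "list_sum T ?l (xs @ ys) = list_sum T ?l xs \<oplus>\<^bsub>T\<^esub> list_sum T ?l ys"
    by (intro list_sum_append[OF abelian_monoid_T, of _ "carrier A \<times> carrier B"]) (use xyz in auto)
  then show ?thesis using xyz app
    by (simp only: add_cls mult_cls)
qed

lemma T_r_distr:
  assumes "X \<in> carrier T" "Y \<in> carrier T" "Z \<in> carrier T"
  shows "Z \<otimes>\<^bsub>T\<^esub> (X \<oplus>\<^bsub>T\<^esub> Y) = Z \<otimes>\<^bsub>T\<^esub> X \<oplus>\<^bsub>T\<^esub> Z \<otimes>\<^bsub>T\<^esub> Y"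
proof -
  obtain xs ys zs where xyz: "xs \<in> \<L>" "X = cls xs" "ys \<in> \<L>" "Y = cls ys" "zs \<in> \<L>" "Z = cls zs"
    using assms unfolding carrier_T by blast
  have zs: "set zs \<subseteq> carrier A \<times> carrier B" using xyz by simp
  let ?l = row
  have cl: "?l us a b \<in> carrier T" if "us \<in> \<L>" "(a, b) \<in> carrier A \<times> carrier B" for us a b
    by (rule list_sum_closed[OF abelian_monoid_T, of _ "carrier A \<times> carrier B"]) (use that in auto)
  have "Z \<otimes>\<^bsub>T\<^esub> (X \<oplus>\<^bsub>T\<^esub> Y) = list_sum T (?l (xs @ ys)) zs"
    using xyz by (simp only: add_cls) (subst mult_cls, auto)
  also have "\<dots> = list_sum T (\<lambda>a b. ?l xs a b \<oplus>\<^bsub>T\<^esub> ?l ys a b) zs"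
    by (rule list_sum_cong[OF zs], rule list_sum_append[OF abelian_monoid_T]) (use xyz in auto)
  also have "\<dots> = list_sum T (?l xs) zs \<oplus>\<^bsub>T\<^esub> list_sum T (?l ys) zs"
    by (rule list_sum_add[OF abelian_monoid_T zs cl cl]) (use xyz in auto)
  finally show ?thesis using xyz by (simp only: mult_cls)
qed

lemma T_smult_add:
  assumes "r \<in> carrier K" "X \<in> carrier T" "Y \<in> carrier T"
  shows "r \<odot>\<^bsub>T\<^esub> (X \<oplus>\<^bsub>T\<^esub> Y) = r \<odot>\<^bsub>T\<^esub> X \<oplus>\<^bsub>T\<^esub> r \<odot>\<^bsub>T\<^esub> Y"
proof -
  obtain xs ys where xyz: "xs \<in> \<L>" "X = cls xs" "ys \<in> \<L>" "Y = cls ys"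
    using assms unfolding carrier_T by blast
  have "xs @ ys \<in> \<L>" using xyz by simp
  then show ?thesis using xyz assms(1)
    by (simp only: add_cls smult_cls)
      (rule list_sum_append[OF abelian_monoid_T, of _ "carrier A \<times> carrier B"], auto)
qed

lemma T_zero_mult [simp]: "X \<in> carrier T \<Longrightarrow> \<zero>\<^bsub>T\<^esub> \<otimes>\<^bsub>T\<^esub> X = \<zero>\<^bsub>T\<^esub>"
  using mult_cls[of "[]"] by (elim T_cases) (simp add: zero_T[symmetric])

lemma T_mult_zero [simp]: "X \<in> carrier T \<Longrightarrow> X \<otimes>\<^bsub>T\<^esub> \<zero>\<^bsub>T\<^esub> = \<zero>\<^bsub>T\<^esub>"
proof -
  assume "X \<in> carrier T"
  then obtain xs where xs: "xs \<in> \<L>" "X = cls xs" unfolding carrier_T by blast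
  then have "X \<otimes>\<^bsub>T\<^esub> \<zero>\<^bsub>T\<^esub> = list_sum T (\<lambda>a b. \<zero>\<^bsub>T\<^esub>) xs"
    using mult_cls[of xs "[]"] by (simp add: zero_T[symmetric])
  also have "\<dots> = \<zero>\<^bsub>T\<^esub>" by (rule list_sum_zero[OF abelian_monoid_T subset_UNIV HOL.refl])
  finally show ?thesis .
qed

lemma T_smult_zero [simp]: "r \<in> carrier K \<Longrightarrow> r \<odot>\<^bsub>T\<^esub> \<zero>\<^bsub>T\<^esub> = \<zero>\<^bsub>T\<^esub>"
  using smult_cls[of r "[]"] by (simp add: zero_T[symmetric])

lemma T_smult_mult_left:
  assumes "r \<in> carrier K" "X \<in> carrier T" "Y \<in> carrier T"
  shows "(r \<odot>\<^bsub>T\<^esub> X) \<otimes>\<^bsub>T\<^esub> Y = r \<odot>\<^bsub>T\<^esub> (X \<otimes>\<^bsub>T\<^esub> Y)"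
  using assms(2)
proof (induction rule: tensor_induct)
  case (pure a b)
  show ?case using assms(3)
  proof (induction rule: tensor_induct)
    case (add X Y)
    then show ?case using assms(1) pure
      by (simp add: T_r_distr T_smult_add T_smult_closed T_mult_closed)
  qed (use assms pure in \<open>auto simp: pure_smult pure_mult A.smult_mult_left T_smult_closed\<close>)
next
  case (add X Z)
  then show ?case using assms by (simp add: T_l_distr T_smult_add T_smult_closed T_mult_closed)
qed (use assms in simp)

lemma T_smult_mult_right:
  assumes "r \<in> carrier K" "X \<in> carrier T" "Y \<in> carrier T"
  shows "X \<otimes>\<^bsub>T\<^esub> (r \<odot>\<^bsub>T\<^esub> Y) = r \<odot>\<^bsub>T\<^esub> (X \<otimes>\<^bsub>T\<^esub> Y)"
  using assms(2)
proof (induction rule: tensor_induct)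
  case (pure a b)
  show ?case using assms(3)
  proof (induction rule: tensor_induct)
    case (add X Y)
    then show ?case using assms(1) pure
      by (simp add: T_r_distr T_smult_add T_smult_closed T_mult_closed)
  qed (use assms pure in \<open>auto simp: pure_smult pure_mult A.smult_mult_right T_smult_closed\<close>)
next
  case (add X Z)
  then show ?case using assms by (simp add: T_l_distr T_smult_add T_smult_closed T_mult_closed)
qed (use assms in \<open>simp add: T_smult_closed\<close>)

lemma T_mult_assoc:
  assumes "X \<in> carrier T" "Y \<in> carrier T" "Z \<in> carrier T"
  shows "X \<otimes>\<^bsub>T\<^esub> Y \<otimes>\<^bsub>T\<^esub> Z = X \<otimes>\<^bsub>T\<^esub> (Y \<otimes>\<^bsub>T\<^esub> Z)"
  using assms(1)
proof (induction rule: tensor_induct)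
  case (pure a b)
  show ?case using assms(2)
  proof (induction rule: tensor_induct)
    case (pure c d)
    show ?case using assms(3)
    proof (induction rule: tensor_induct)
      case (add X Y)
      then show ?case using pure \<open>a \<in> carrier A\<close> \<open>b \<in> carrier B\<close> by (simp add: T_r_distr T_mult_closed)
    qed (use pure \<open>a \<in> carrier A\<close> \<open>b \<in> carrier B\<close> in \<open>auto simp: T_mult_closed pure_mult A.m_assoc B.m_assoc\<close>)
  next
    case (add X Y)
    then show ?case using assms pure by (simp add: T_l_distr T_r_distr T_mult_closed)
  qed (use assms pure in auto)
next
  case (add X Z)
  then show ?case using assms by (simp add: T_l_distr T_mult_closed)
qed (use assms in \<open>simp add: T_mult_closed\<close>)

lemma T_one_closed: "\<one>\<^bsub>T\<^esub> \<in> carrier T" by (simp add: one_T)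

lemma T_l_one: "X \<in> carrier T \<Longrightarrow> \<one>\<^bsub>T\<^esub> \<otimes>\<^bsub>T\<^esub> X = X"
  by (induction rule: tensor_induct) (auto simp: T_r_distr T_one_closed, auto simp: one_T pure_mult)

lemma T_r_one: "X \<in> carrier T \<Longrightarrow> X \<otimes>\<^bsub>T\<^esub> \<one>\<^bsub>T\<^esub> = X"
  by (induction rule: tensor_induct) (auto simp: T_l_distr T_one_closed, auto simp: one_T pure_mult)

lemma T_smult_one: "X \<in> carrier T \<Longrightarrow> \<one>\<^bsub>K\<^esub> \<odot>\<^bsub>T\<^esub> X = X"
  by (induction rule: tensor_induct) (auto simp: T_smult_add pure_smult)

lemma T_smult_l_distr:
  assumes "r \<in> carrier K" "s \<in> carrier K" "X \<in> carrier T"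
  shows "(r \<oplus>\<^bsub>K\<^esub> s) \<odot>\<^bsub>T\<^esub> X = r \<odot>\<^bsub>T\<^esub> X \<oplus>\<^bsub>T\<^esub> s \<odot>\<^bsub>T\<^esub> X"
  using assms(3,1,2)
  by (induction rule: tensor_induct)
    (auto simp: T_smult_add pure_smult A.smult_l_distr pure_add_left T.a_ac T_smult_closed)

lemma T_smult_assoc:
  assumes "r \<in> carrier K" "s \<in> carrier K" "X \<in> carrier T"
  shows "(r \<otimes>\<^bsub>K\<^esub> s) \<odot>\<^bsub>T\<^esub> X = r \<odot>\<^bsub>T\<^esub> (s \<odot>\<^bsub>T\<^esub> X)"
  using assms(3,1,2)
  by (induction rule: tensor_induct)
    (auto simp: T_smult_add pure_smult A.smult_assoc1 T_smult_closed)

lemma T_smult_null: "X \<in> carrier T \<Longrightarrow> \<zero>\<^bsub>K\<^esub> \<odot>\<^bsub>T\<^esub> X = \<zero>\<^bsub>T\<^esub>"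
  by (induction rule: tensor_induct) (auto simp: T_smult_add pure_smult pure_zero_left)

lemma abelian_group_T: "abelian_group T"
proof (rule abelian_groupI)
  fix X assume X: "X \<in> carrier T"
  have "(\<ominus>\<^bsub>K\<^esub> \<one>\<^bsub>K\<^esub>) \<odot>\<^bsub>T\<^esub> X \<oplus>\<^bsub>T\<^esub> X = ((\<ominus>\<^bsub>K\<^esub> \<one>\<^bsub>K\<^esub>) \<oplus>\<^bsub>K\<^esub> \<one>\<^bsub>K\<^esub>) \<odot>\<^bsub>T\<^esub> X"
    using X by (simp add: T_smult_l_distr T_smult_one)
  also have "\<dots> = \<zero>\<^bsub>T\<^esub>" using X by (simp add: ring.ring_simprules(9)[OF ring_K] T_smult_null)
  finally show "\<exists>Y\<in>carrier T. Y \<oplus>\<^bsub>T\<^esub> X = \<zero>\<^bsub>T\<^esub>" using X by (meson T_smult_closed ring.ring_simprules(3,6)[OF ring_K])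
qed (auto simp: T.a_ac)

theorem k_algebra_T: "k_algebra K T"
proof -
  have "module K T"
    by (intro moduleI cring_K abelian_group_T)
      (auto simp: T_smult_closed T_smult_l_distr T_smult_add T_smult_assoc T_smult_one)
  moreover have "ring T"
    by (intro ringI abelian_group_T monoidI)
      (auto simp: T_mult_closed T_one_closed T_mult_assoc T_l_one T_r_one T_l_distr T_r_distr)
  ultimately show ?thesis
    using A.field_axioms T_smult_mult_left T_smult_mult_right
    by (auto simp: k_algebra_def k_algebra_axioms_def)
qed

end

section \<open>Homomorphisms out of a tensor product\<close>

context algebra_pair
begin

lemma balanced_group:
  assumes "abelian_group M"
    and "\<And>a b. a \<in> carrier A \<Longrightarrow> b \<in> carrier B \<Longrightarrow> f a b \<in> carrier M"
    and "\<And>a a' b. a \<in> carrier A \<Longrightarrow> a' \<in> carrier A \<Longrightarrow> b \<in> carrier B \<Longrightarrow>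
      f (a \<oplus>\<^bsub>A\<^esub> a') b = f a b \<oplus>\<^bsub>M\<^esub> f a' b"
    and "\<And>a b b'. a \<in> carrier A \<Longrightarrow> b \<in> carrier B \<Longrightarrow> b' \<in> carrier B \<Longrightarrow>
      f a (b \<oplus>\<^bsub>B\<^esub> b') = f a b \<oplus>\<^bsub>M\<^esub> f a b'"
    and "\<And>r a b. r \<in> carrier K \<Longrightarrow> a \<in> carrier A \<Longrightarrow> b \<in> carrier B \<Longrightarrow>
      f (r \<odot>\<^bsub>A\<^esub> a) b = f a (r \<odot>\<^bsub>B\<^esub> b)"
  shows "balanced K A B M f"
proof (rule balancedI)
  interpret M: abelian_group M by fact
  fix b assume b: "b \<in> carrier B"
  have "f \<zero>\<^bsub>A\<^esub> b \<oplus>\<^bsub>M\<^esub> f \<zero>\<^bsub>A\<^esub> b = f \<zero>\<^bsub>A\<^esub> b"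
    using assms(3)[of "\<zero>\<^bsub>A\<^esub>" "\<zero>\<^bsub>A\<^esub>" b] b by simp
  then show "f \<zero>\<^bsub>A\<^esub> b = \<zero>\<^bsub>M\<^esub>"
    using assms(2) b by (simp add: M.add.r_cancel_one)
qed (use assms in auto)

lemma tensor_lift_pure:
  assumes "abelian_monoid M" "balanced K A B M f" "a \<in> carrier A" "b \<in> carrier B"
  shows "tensor_lift M f (pt a b) = f a b"
proof -
  interpret M: abelian_monoid M by fact
  show ?thesis unfolding pure_tensor_def
    using assms by (subst tensor_lift_cls[OF assms(1,2)]) (auto simp: balanced_def)
qed

lemma tensor_lift_zero:
  assumes "abelian_monoid M" "balanced K A B M f"
  shows "tensor_lift M f \<zero>\<^bsub>T\<^esub> = \<zero>\<^bsub>M\<^esub>"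
  unfolding zero_T by (subst tensor_lift_cls[OF assms]) simp_all

lemma tensor_lift_closed:
  assumes "abelian_monoid M" "balanced K A B M f" "X \<in> carrier T"
  shows "tensor_lift M f X \<in> carrier M"
proof -
  from assms(3) obtain xs where "xs \<in> \<L>" "X = cls xs" by (elim T_cases)
  then show ?thesis using assms(2)
    by (simp only: tensor_lift_cls[OF assms(1,2)])
      (rule list_sum_closed[OF assms(1), of _ "carrier A \<times> carrier B"], simp_all add: balanced_def)
qed

lemma tensor_lift_add:
  assumes "abelian_monoid M" "balanced K A B M f" "X \<in> carrier T" "Y \<in> carrier T"
  shows "tensor_lift M f (X \<oplus>\<^bsub>T\<^esub> Y) = tensor_lift M f X \<oplus>\<^bsub>M\<^esub> tensor_lift M f Y"
proof -
  from assms(3,4) obtain xs ys where *: "xs \<in> \<L>" "X = cls xs" "ys \<in> \<L>" "Y = cls ys"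
    by (elim T_cases)
  then have "xs @ ys \<in> \<L>" by simp
  with * assms(2) show ?thesis
    by (simp only: tensor_lift_cls[OF assms(1,2)] add_cls)
      (rule list_sum_append[OF assms(1), of _ "carrier A \<times> carrier B"], simp_all add: balanced_def)
qed

lemma tensor_lift_cong:
  assumes "X \<in> carrier T" "\<And>a b. a \<in> carrier A \<Longrightarrow> b \<in> carrier B \<Longrightarrow> f a b = g a b"
  shows "tensor_lift M f X = tensor_lift M g X"
proof -
  from assms(1) obtain xs where xs: "xs \<in> \<L>" "X = cls xs" by (elim T_cases)
  have "list_sum M f ys = list_sum M g ys" if "ys \<in> X" for ys
    using that xs rel_carrier[of xs ys] assms(2)
    by (intro list_sum_cong[of _ "carrier A \<times> carrier B"]) (auto simp: tensor_class_def)
  then show ?thesis unfolding tensor_lift_def list_sum_def[symmetric]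
    by (simp cong: image_cong_simp)
qed

text \<open>Additive maps on a tensor product are determined by pure tensors.\<close>

lemma additive_eqI:
  assumes "X \<in> carrier T" "u \<zero>\<^bsub>T\<^esub> = v \<zero>\<^bsub>T\<^esub>"
    and "\<And>X Y. X \<in> carrier T \<Longrightarrow> Y \<in> carrier T \<Longrightarrow> u (X \<oplus>\<^bsub>T\<^esub> Y) = u X \<oplus>\<^bsub>M\<^esub> u Y"
    and "\<And>X Y. X \<in> carrier T \<Longrightarrow> Y \<in> carrier T \<Longrightarrow> v (X \<oplus>\<^bsub>T\<^esub> Y) = v X \<oplus>\<^bsub>M\<^esub> v Y"
    and "\<And>a b. a \<in> carrier A \<Longrightarrow> b \<in> carrier B \<Longrightarrow> u (pt a b) = v (pt a b)"
  shows "u X = v X"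
  using assms(1) by (induction rule: tensor_induct) (use assms in auto)

end

text \<open>Algebra homomorphisms are taken to be undefined outside the carrier, so that homomorphisms which
  agree on the carrier are equal and can be rewritten.\<close>

definition alg_hom ::
  "('k, 'm) ring_scheme \<Rightarrow> ('k, 'a, 'p) module_scheme \<Rightarrow> ('k, 'b, 'q) module_scheme
    \<Rightarrow> ('a \<Rightarrow> 'b) set"
  where "alg_hom K A B = {f \<in> ring_hom A B \<inter> extensional (carrier A).
    \<forall>r\<in>carrier K. \<forall>x\<in>carrier A. f (r \<odot>\<^bsub>A\<^esub> x) = r \<odot>\<^bsub>B\<^esub> f x}"

text \<open>The images of \<open>f : A \<rightarrow> M\<close> and \<open>g : B \<rightarrow> M\<close> commute elementwise.\<close>

definition commuting ::
  "('k, 'a, 'p) module_scheme \<Rightarrow> ('k, 'b, 'q) module_scheme \<Rightarrow> ('k, 'c, 'r) module_scheme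
    \<Rightarrow> ('a \<Rightarrow> 'c) \<Rightarrow> ('b \<Rightarrow> 'c) \<Rightarrow> bool"
  where "commuting A B M f g \<longleftrightarrow>
    (\<forall>a\<in>carrier A. \<forall>b\<in>carrier B. f a \<otimes>\<^bsub>M\<^esub> g b = g b \<otimes>\<^bsub>M\<^esub> f a)"

text \<open>The map \<open>A \<otimes> B \<rightarrow> M\<close>, \<open>a \<otimes> b \<mapsto> f a \<cdot> g b\<close>; a homomorphism if \<open>f\<close> and \<open>g\<close> are commuting
  homomorphisms.\<close>

definition tlift ::
  "('k, 'm) ring_scheme \<Rightarrow> ('k, 'c, 'r) module_scheme \<Rightarrow> ('k, 'a, 'p) module_scheme
    \<Rightarrow> ('k, 'b, 'q) module_scheme \<Rightarrow> ('a \<Rightarrow> 'c) \<Rightarrow> ('b \<Rightarrow> 'c) \<Rightarrow> ('a, 'b) tensor \<Rightarrow> 'c"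
  where "tlift K M A B f g =
    restrict (tensor_lift M (\<lambda>a b. f a \<otimes>\<^bsub>M\<^esub> g b)) (carrier (tensor_alg K A B))"

lemma alg_homI:
  assumes "\<And>x. x \<in> carrier A \<Longrightarrow> f x \<in> carrier B"
    "\<And>x y. x \<in> carrier A \<Longrightarrow> y \<in> carrier A \<Longrightarrow> f (x \<otimes>\<^bsub>A\<^esub> y) = f x \<otimes>\<^bsub>B\<^esub> f y"
    "\<And>x y. x \<in> carrier A \<Longrightarrow> y \<in> carrier A \<Longrightarrow> f (x \<oplus>\<^bsub>A\<^esub> y) = f x \<oplus>\<^bsub>B\<^esub> f y"
    "f \<one>\<^bsub>A\<^esub> = \<one>\<^bsub>B\<^esub>"
    "\<And>r x. r \<in> carrier K \<Longrightarrow> x \<in> carrier A \<Longrightarrow> f (r \<odot>\<^bsub>A\<^esub> x) = r \<odot>\<^bsub>B\<^esub> f x"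
    "f \<in> extensional (carrier A)"
  shows "f \<in> alg_hom K A B"
  using assms by (auto simp: alg_hom_def intro!: ring_hom_memI)

lemma
  assumes "f \<in> alg_hom K A B"
  shows alg_hom_closed: "x \<in> carrier A \<Longrightarrow> f x \<in> carrier B"
    and alg_hom_mult: "x \<in> carrier A \<Longrightarrow> y \<in> carrier A \<Longrightarrow> f (x \<otimes>\<^bsub>A\<^esub> y) = f x \<otimes>\<^bsub>B\<^esub> f y"
    and alg_hom_add: "x \<in> carrier A \<Longrightarrow> y \<in> carrier A \<Longrightarrow> f (x \<oplus>\<^bsub>A\<^esub> y) = f x \<oplus>\<^bsub>B\<^esub> f y"
    and alg_hom_one: "f \<one>\<^bsub>A\<^esub> = \<one>\<^bsub>B\<^esub>"
    and alg_hom_smult: "r \<in> carrier K \<Longrightarrow> x \<in> carrier A \<Longrightarrow> f (r \<odot>\<^bsub>A\<^esub> x) = r \<odot>\<^bsub>B\<^esub> f x"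
    and alg_hom_extensional: "f \<in> extensional (carrier A)"
  using assms by (auto simp: alg_hom_def ring_hom_closed ring_hom_mult ring_hom_add ring_hom_one)

lemma k_algebra_monoid: "k_algebra K A \<Longrightarrow> monoid A"
  and k_algebra_abelian_group: "k_algebra K A \<Longrightarrow> abelian_group A"
  and k_algebra_abelian_monoid: "k_algebra K A \<Longrightarrow> abelian_monoid A"
  by (auto simp: k_algebra_def ring.axioms abelian_group.axioms dest: ring.axioms abelian_group.axioms)

lemma alg_hom_zero:
  assumes "f \<in> alg_hom K A B" "k_algebra K A" "k_algebra K B"
  shows "f \<zero>\<^bsub>A\<^esub> = \<zero>\<^bsub>B\<^esub>"
proof -
  interpret A: k_algebra K A by fact
  interpret B: k_algebra K B by fact
  have "f \<zero>\<^bsub>A\<^esub> \<oplus>\<^bsub>B\<^esub> f \<zero>\<^bsub>A\<^esub> = f \<zero>\<^bsub>A\<^esub>"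
    using alg_hom_add[OF assms(1), of "\<zero>\<^bsub>A\<^esub>" "\<zero>\<^bsub>A\<^esub>"] by simp
  then show ?thesis using alg_hom_closed[OF assms(1), of "\<zero>\<^bsub>A\<^esub>"] by (simp add: B.add.r_cancel_one)
qed

lemma alg_hom_ext:
  assumes "f \<in> alg_hom K A B" "g \<in> alg_hom K A B" "\<And>x. x \<in> carrier A \<Longrightarrow> f x = g x"
  shows "f = g"
  using assms by (auto intro: extensionalityI dest: alg_hom_extensional)

lemma alg_hom_compose:
  assumes "f \<in> alg_hom K A B" "g \<in> alg_hom K B C" "k_algebra K A"
  shows "compose (carrier A) g f \<in> alg_hom K A C"
proof -
  interpret A: k_algebra K A by fact
  show ?thesis
    by (rule alg_homI)
      (auto simp: compose_def alg_hom_closed[OF assms(1)] alg_hom_closed[OF assms(2)]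
        alg_hom_mult[OF assms(1)] alg_hom_mult[OF assms(2)] alg_hom_add[OF assms(1)]
        alg_hom_add[OF assms(2)] alg_hom_one[OF assms(1)] alg_hom_one[OF assms(2)]
        alg_hom_smult[OF assms(1)] alg_hom_smult[OF assms(2)])
qed

lemma alg_hom_id: "k_algebra K A \<Longrightarrow> restrict id (carrier A) \<in> alg_hom K A A"
proof -
  assume "k_algebra K A"
  then interpret A: k_algebra K A .
  show ?thesis by (rule alg_homI) auto
qed

lemma alg_hom_Units:
  assumes "f \<in> alg_hom K A B" "k_algebra K A" "k_algebra K B" "x \<in> Units A"
  shows "f x \<in> Units B" "inv\<^bsub>B\<^esub> (f x) = f (inv\<^bsub>A\<^esub> x)"
proof -
  interpret A: k_algebra K A by fact
  interpret B: k_algebra K B by fact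
  note A_monoid = k_algebra_monoid[OF assms(2)]
  have *: "f x \<otimes>\<^bsub>B\<^esub> f (inv\<^bsub>A\<^esub> x) = \<one>\<^bsub>B\<^esub>" "f (inv\<^bsub>A\<^esub> x) \<otimes>\<^bsub>B\<^esub> f x = \<one>\<^bsub>B\<^esub>"
    using assms(4) by (simp_all add: alg_hom_mult[OF assms(1), symmetric] alg_hom_one[OF assms(1)]
      monoid.Units_r_inv[OF A_monoid] monoid.Units_l_inv[OF A_monoid]
      monoid.Units_closed[OF A_monoid] monoid.Units_inv_closed[OF A_monoid])
  have cl: "f x \<in> carrier B" "f (inv\<^bsub>A\<^esub> x) \<in> carrier B"
    using assms(4) monoid.Units_closed[OF A_monoid] monoid.Units_inv_closed[OF A_monoid]
    by (auto intro: alg_hom_closed[OF assms(1)])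
  show "f x \<in> Units B" using * cl by (auto simp: Units_def)
  show "inv\<^bsub>B\<^esub> (f x) = f (inv\<^bsub>A\<^esub> x)"
    using monoid.inv_char[OF k_algebra_monoid[OF assms(3)]] * cl by blast
qed

lemma commuting_sym: "commuting A B M f g \<Longrightarrow> commuting B A M g f"
  by (auto simp: commuting_def)

lemma commuting_D:
  "commuting A B M f g \<Longrightarrow> a \<in> carrier A \<Longrightarrow> b \<in> carrier B \<Longrightarrow>
    f a \<otimes>\<^bsub>M\<^esub> g b = g b \<otimes>\<^bsub>M\<^esub> f a"
  by (auto simp: commuting_def)

lemma tlift_extensional: "tlift K M A B f g \<in> extensional (carrier (tensor_alg K A B))"
  by (simp add: tlift_def)

locale commuting_homs = algebra_pair K A B + M: k_algebra K M
  for K :: "('k, 'm) ring_scheme" and A :: "('k, 'a, 'p) module_scheme"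
    and B :: "('k, 'b, 'q) module_scheme" and M :: "('k, 'c, 'r) module_scheme" +
  fixes f g
  assumes f: "f \<in> alg_hom K A M" and g: "g \<in> alg_hom K B M" and fg: "commuting A B M f g"
begin

lemma hom_simps [simp]:
  "a \<in> carrier A \<Longrightarrow> f a \<in> carrier M" "b \<in> carrier B \<Longrightarrow> g b \<in> carrier M"
  "a \<in> carrier A \<Longrightarrow> a' \<in> carrier A \<Longrightarrow> f (a \<oplus>\<^bsub>A\<^esub> a') = f a \<oplus>\<^bsub>M\<^esub> f a'"
  "b \<in> carrier B \<Longrightarrow> b' \<in> carrier B \<Longrightarrow> g (b \<oplus>\<^bsub>B\<^esub> b') = g b \<oplus>\<^bsub>M\<^esub> g b'"
  "a \<in> carrier A \<Longrightarrow> a' \<in> carrier A \<Longrightarrow> f (a \<otimes>\<^bsub>A\<^esub> a') = f a \<otimes>\<^bsub>M\<^esub> f a'"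
  "b \<in> carrier B \<Longrightarrow> b' \<in> carrier B \<Longrightarrow> g (b \<otimes>\<^bsub>B\<^esub> b') = g b \<otimes>\<^bsub>M\<^esub> g b'"
  "r \<in> carrier K \<Longrightarrow> a \<in> carrier A \<Longrightarrow> f (r \<odot>\<^bsub>A\<^esub> a) = r \<odot>\<^bsub>M\<^esub> f a"
  "r \<in> carrier K \<Longrightarrow> b \<in> carrier B \<Longrightarrow> g (r \<odot>\<^bsub>B\<^esub> b) = r \<odot>\<^bsub>M\<^esub> g b"
  "f \<one>\<^bsub>A\<^esub> = \<one>\<^bsub>M\<^esub>" "g \<one>\<^bsub>B\<^esub> = \<one>\<^bsub>M\<^esub>"
  using f g by (simp_all add: alg_hom_closed alg_hom_add alg_hom_mult alg_hom_smult alg_hom_one)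

lemma mult_interchange:
  assumes "a \<in> carrier A" "a' \<in> carrier A" "b \<in> carrier B" "b' \<in> carrier B"
  shows "f a \<otimes>\<^bsub>M\<^esub> f a' \<otimes>\<^bsub>M\<^esub> (g b \<otimes>\<^bsub>M\<^esub> g b') = f a \<otimes>\<^bsub>M\<^esub> g b \<otimes>\<^bsub>M\<^esub> (f a' \<otimes>\<^bsub>M\<^esub> g b')"
proof -
  have "f a' \<otimes>\<^bsub>M\<^esub> (g b \<otimes>\<^bsub>M\<^esub> g b') = g b \<otimes>\<^bsub>M\<^esub> (f a' \<otimes>\<^bsub>M\<^esub> g b')"
    using assms commuting_D[OF fg, of a' b] by (simp add: M.m_assoc[symmetric])
  then show ?thesis using assms by (simp add: M.m_assoc)
qed

lemma abelian_M: "abelian_group M" "abelian_monoid M" "abelian_group T" "abelian_monoid T"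
  using k_algebra_abelian_group k_algebra_abelian_monoid M.k_algebra_axioms k_algebra_T by blast+

lemma balanced_hom: "balanced K A B M (\<lambda>a b. f a \<otimes>\<^bsub>M\<^esub> g b)"
  by (rule balanced_group)
    (simp_all add: abelian_M M.l_distr M.r_distr M.smult_mult_left M.smult_mult_right)

lemma tlift_pure [simp]:
  "a \<in> carrier A \<Longrightarrow> b \<in> carrier B \<Longrightarrow> tlift K M A B f g (pt a b) = f a \<otimes>\<^bsub>M\<^esub> g b"
  by (simp add: tlift_def tensor_lift_pure balanced_hom abelian_M)

lemma tlift_closed [simp]: "X \<in> carrier T \<Longrightarrow> tlift K M A B f g X \<in> carrier M"
  by (simp add: tlift_def tensor_lift_closed balanced_hom abelian_M)

lemma tlift_zero [simp]: "tlift K M A B f g \<zero>\<^bsub>T\<^esub> = \<zero>\<^bsub>M\<^esub>"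
  by (simp add: tlift_def tensor_lift_zero balanced_hom abelian_M)

lemma tlift_add [simp]:
  "X \<in> carrier T \<Longrightarrow> Y \<in> carrier T \<Longrightarrow>
    tlift K M A B f g (X \<oplus>\<^bsub>T\<^esub> Y) = tlift K M A B f g X \<oplus>\<^bsub>M\<^esub> tlift K M A B f g Y"
  by (simp add: tlift_def tensor_lift_add balanced_hom abelian_M)

lemma tlift_smult [simp]:
  assumes "r \<in> carrier K" "X \<in> carrier T"
  shows "tlift K M A B f g (r \<odot>\<^bsub>T\<^esub> X) = r \<odot>\<^bsub>M\<^esub> tlift K M A B f g X"
  using assms(2)
  by (induction rule: tensor_induct)
    (use assms in \<open>simp_all add: pure_smult T_smult_add T_smult_closed M.smult_r_distr
      M.smult_mult_left\<close>)

lemma tlift_mult [simp]: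
  assumes "X \<in> carrier T" "Y \<in> carrier T"
  shows "tlift K M A B f g (X \<otimes>\<^bsub>T\<^esub> Y) = tlift K M A B f g X \<otimes>\<^bsub>M\<^esub> tlift K M A B f g Y"
  using assms(1)
proof (induction rule: tensor_induct)
  case (pure a b)
  show ?case using assms(2)
    by (induction rule: tensor_induct)
      (use pure in \<open>simp_all add: pure_mult T_r_distr T_mult_closed M.r_distr mult_interchange\<close>)
next
  case (add X Z)
  then show ?case using assms by (simp add: T_l_distr T_mult_closed M.l_distr)
qed (use assms in simp)

lemma tlift_one [simp]: "tlift K M A B f g \<one>\<^bsub>T\<^esub> = \<one>\<^bsub>M\<^esub>"
  by (simp add: one_T)

lemma tlift_alg_hom: "tlift K M A B f g \<in> alg_hom K T M"
  by (rule alg_homI) (simp_all add: tlift_extensional)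

lemma tlift_centralizes:
  assumes "X \<in> carrier T" "z \<in> carrier M"
    and "\<And>a. a \<in> carrier A \<Longrightarrow> f a \<otimes>\<^bsub>M\<^esub> z = z \<otimes>\<^bsub>M\<^esub> f a"
    and "\<And>b. b \<in> carrier B \<Longrightarrow> g b \<otimes>\<^bsub>M\<^esub> z = z \<otimes>\<^bsub>M\<^esub> g b"
  shows "tlift K M A B f g X \<otimes>\<^bsub>M\<^esub> z = z \<otimes>\<^bsub>M\<^esub> tlift K M A B f g X"
  using assms(1)
proof (induction rule: tensor_induct)
  case (pure a b)
  have "f a \<otimes>\<^bsub>M\<^esub> (g b \<otimes>\<^bsub>M\<^esub> z) = f a \<otimes>\<^bsub>M\<^esub> z \<otimes>\<^bsub>M\<^esub> g b"
    using pure assms(2) by (simp add: assms(4) M.m_assoc)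
  also have "\<dots> = z \<otimes>\<^bsub>M\<^esub> (f a \<otimes>\<^bsub>M\<^esub> g b)"
    using pure assms(2) by (simp add: assms(3) M.m_assoc)
  finally show ?case using pure assms(2) by (simp add: M.m_assoc)
qed (use assms in \<open>simp_all add: M.l_distr M.r_distr\<close>)

end

lemma algebra_pairI: "k_algebra K A \<Longrightarrow> k_algebra K B \<Longrightarrow> algebra_pair K A B"
  by (simp add: algebra_pair_def)

lemma k_algebra_tensor: "k_algebra K A \<Longrightarrow> k_algebra K B \<Longrightarrow> k_algebra K (tensor_alg K A B)"
  by (rule algebra_pair.k_algebra_T[OF algebra_pairI])

lemma commuting_homsI:
  "k_algebra K A \<Longrightarrow> k_algebra K B \<Longrightarrow> k_algebra K M \<Longrightarrow> f \<in> alg_hom K A M \<Longrightarrow>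
    g \<in> alg_hom K B M \<Longrightarrow> commuting A B M f g \<Longrightarrow> commuting_homs K A B M f g"
  by (simp add: commuting_homs_def commuting_homs_axioms_def algebra_pairI)

lemmas tlift_alg_hom = commuting_homs.tlift_alg_hom[OF commuting_homsI]
  and tlift_pure = commuting_homs.tlift_pure[OF commuting_homsI]

lemma alg_hom_tensor_ext:
  assumes "k_algebra K A" "k_algebra K B" "k_algebra K M"
    and "u \<in> alg_hom K (tensor_alg K A B) M" "v \<in> alg_hom K (tensor_alg K A B) M"
    and "\<And>a b. a \<in> carrier A \<Longrightarrow> b \<in> carrier B \<Longrightarrow>
      u (pure_tensor K A B a b) = v (pure_tensor K A B a b)"
  shows "u = v"
proof (rule alg_hom_ext[OF assms(4,5)])
  interpret algebra_pair K A B by (rule algebra_pairI) fact+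
  fix X assume "X \<in> carrier T"
  then show "u X = v X"
    by (rule additive_eqI)
      (simp_all add: alg_hom_add[OF assms(4)] alg_hom_add[OF assms(5)] alg_hom_zero[OF assms(4)]
        alg_hom_zero[OF assms(5)] k_algebra_T assms)
qed

lemma commuting_tlift_left:
  assumes "k_algebra K A" "k_algebra K B" "k_algebra K M" "f \<in> alg_hom K A M"
    "g \<in> alg_hom K B M" "h \<in> alg_hom K C M" "commuting A B M f g"
    "commuting A C M f h" "commuting B C M g h"
  shows "commuting (tensor_alg K A B) C M (tlift K M A B f g) h"
proof -
  interpret commuting_homs K A B M f g by (rule commuting_homsI) fact+
  show ?thesis unfolding commuting_def
    using assms(6) commuting_D[OF assms(8)] commuting_D[OF assms(9)]
    by (auto intro!: tlift_centralizes simp: alg_hom_closed)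
qed

lemma commuting_tlift_right:
  assumes "k_algebra K A" "k_algebra K B" "k_algebra K M" "f \<in> alg_hom K A M"
    "g \<in> alg_hom K B M" "h \<in> alg_hom K C M" "commuting A B M f g"
    "commuting C A M h f" "commuting C B M h g"
  shows "commuting C (tensor_alg K A B) M h (tlift K M A B f g)"
  by (rule commuting_sym, rule commuting_tlift_left) (use assms commuting_sym in blast)+

lemma commuting_compose:
  assumes "\<phi> \<in> alg_hom K M N" "f \<in> alg_hom K A M" "g \<in> alg_hom K B M" "commuting A B M f g"
  shows "commuting A B N (compose (carrier A) \<phi> f) (compose (carrier B) \<phi> g)"
  unfolding commuting_def compose_def
  using assms(2,3) commuting_D[OF assms(4)]
  by (simp add: alg_hom_mult[OF assms(1), symmetric] alg_hom_closed)

lemma commuting_compose_left: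
  assumes "p \<in> alg_hom K A B" "commuting B C M f g"
  shows "commuting A C M (compose (carrier A) f p) g"
  using assms by (auto simp: commuting_def compose_def alg_hom_closed)

lemma commuting_compose_right:
  assumes "p \<in> alg_hom K A B" "commuting C B M g f"
  shows "commuting C A M g (compose (carrier A) f p)"
  using assms by (auto simp: commuting_def compose_def alg_hom_closed)

lemma compose_tlift:
  assumes "k_algebra K A" "k_algebra K B" "k_algebra K M" "k_algebra K N"
    "\<phi> \<in> alg_hom K M N" "f \<in> alg_hom K A M" "g \<in> alg_hom K B M" "commuting A B M f g"
  shows "compose (carrier (tensor_alg K A B)) \<phi> (tlift K M A B f g) =
    tlift K N A B (compose (carrier A) \<phi> f) (compose (carrier B) \<phi> g)"
proof -
  interpret algebra_pair K A B by (rule algebra_pairI) fact+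
  note h = alg_hom_compose[OF assms(6,5,1)] alg_hom_compose[OF assms(7,5,2)]
    commuting_compose[OF assms(5,6,7,8)]
  show ?thesis
    by (rule alg_hom_tensor_ext[OF assms(1,2,4)
          alg_hom_compose[OF tlift_alg_hom[OF assms(1-3,6-8)] assms(5) k_algebra_T]
          tlift_alg_hom[OF assms(1,2,4) h]])
      (simp add: compose_def tlift_pure[OF assms(1-3,6-8)]
        tlift_pure[OF assms(1,2,4) h, unfolded compose_def]
        alg_hom_mult[OF assms(5)] alg_hom_closed[OF assms(6)] alg_hom_closed[OF assms(7)])
qed

lemma tlift_compose:
  assumes "k_algebra K A" "k_algebra K B" "k_algebra K M" "k_algebra K N"
    "\<phi> \<in> alg_hom K M N" "f \<in> alg_hom K A M" "g \<in> alg_hom K B M" "commuting A B M f g"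
    "X \<in> carrier (tensor_alg K A B)"
  shows "\<phi> (tlift K M A B f g X) =
    tlift K N A B (compose (carrier A) \<phi> f) (compose (carrier B) \<phi> g) X"
  using fun_cong[OF compose_tlift[OF assms(1-8)], of X] assms(9) by (simp add: compose_def)

lemma tlift_cong:
  assumes "k_algebra K A" "k_algebra K B"
    "\<And>a. a \<in> carrier A \<Longrightarrow> f a = f' a" "\<And>b. b \<in> carrier B \<Longrightarrow> g b = g' b"
  shows "tlift K M A B f g = tlift K M A B f' g'"
proof -
  interpret algebra_pair K A B by (rule algebra_pairI) fact+
  show ?thesis unfolding tlift_def
    by (rule restrict_ext) (rule tensor_lift_cong, simp_all add: assms)
qed

text \<open>The two canonical embeddings of the factors of a tensor product.\<close>

definition inl where "inl K A B = restrict (\<lambda>a. pure_tensor K A B a \<one>\<^bsub>B\<^esub>) (carrier A)"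
definition inr where "inr K A B = restrict (\<lambda>b. pure_tensor K A B \<one>\<^bsub>A\<^esub> b) (carrier B)"

context algebra_pair
begin

lemma inl_hom: "inl K A B \<in> alg_hom K A T"
  by (rule alg_homI) (simp_all add: inl_def pure_mult pure_add_left one_T pure_smult)

lemma inr_hom: "inr K A B \<in> alg_hom K B T"
  by (rule alg_homI) (simp_all add: inr_def pure_mult pure_add_right one_T pure_smult pure_smult_swap)

lemma inl_inr: "commuting A B T (inl K A B) (inr K A B)"
  by (simp add: commuting_def inl_def inr_def pure_mult)

lemma pure_eq: "a \<in> carrier A \<Longrightarrow> b \<in> carrier B \<Longrightarrow> pt a b = inl K A B a \<otimes>\<^bsub>T\<^esub> inr K A B b"
  by (simp add: inl_def inr_def pure_mult)

lemma tlift_inl_inr: "tlift K T A B (inl K A B) (inr K A B) = restrict id (carrier T)"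
  by (rule alg_hom_tensor_ext[of K A B T])
    (simp_all add: A.k_algebra_axioms B.k_algebra_axioms k_algebra_T tlift_alg_hom inl_hom inr_hom
      inl_inr alg_hom_id tlift_pure pure_eq[symmetric])

lemma tlift_inl_inr_apply: "X \<in> carrier T \<Longrightarrow> tlift K T A B (inl K A B) (inr K A B) X = X"
  by (simp add: tlift_inl_inr)

end

lemmas inl_hom = algebra_pair.inl_hom[OF algebra_pairI]
  and inr_hom = algebra_pair.inr_hom[OF algebra_pairI]
  and inl_inr = algebra_pair.inl_inr[OF algebra_pairI]
  and inr_inl = algebra_pair.inl_inr[OF algebra_pairI, THEN commuting_sym]
  and tlift_inl_inr = algebra_pair.tlift_inl_inr[OF algebra_pairI]
  and tlift_inl_inr_apply = algebra_pair.tlift_inl_inr_apply[OF algebra_pairI]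

lemma compose_restrict_right [simp]: "compose S f (restrict p S) = compose S f p"
  by (auto simp: compose_def)

lemma compose_compose:
  "p \<in> alg_hom K A B \<Longrightarrow>
    compose (carrier A) \<phi> (compose (carrier A) \<psi> p) = compose (carrier A) (compose (carrier B) \<phi> \<psi>) p"
  by (auto simp: compose_def alg_hom_closed)

lemma compose_id: "f \<in> alg_hom K A B \<Longrightarrow> compose (carrier A) f id = f"
  by (auto simp: compose_def intro!: extensionalityI[of _ "carrier A"] dest: alg_hom_extensional)

lemma compose_tlift_inl:
  assumes "k_algebra K A" "k_algebra K B" "k_algebra K M"
    "f \<in> alg_hom K A M" "g \<in> alg_hom K B M" "commuting A B M f g"
  shows "compose (carrier A) (tlift K M A B f g) (inl K A B) = f"
    and "compose (carrier B) (tlift K M A B f g) (inr K A B) = g"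
proof -
  interpret commuting_homs K A B M f g by (rule commuting_homsI) fact+
  show "compose (carrier A) (tlift K M A B f g) (inl K A B) = f"
    by (rule alg_hom_ext[OF alg_hom_compose[OF inl_hom] f])
      (simp_all add: assms tlift_alg_hom, simp add: compose_def inl_def)
  show "compose (carrier B) (tlift K M A B f g) (inr K A B) = g"
    by (rule alg_hom_ext[OF alg_hom_compose[OF inr_hom] g])
      (simp_all add: assms tlift_alg_hom, simp add: compose_def inr_def)
qed

text \<open>Every homomorphism out of a tensor product is of the form \<open>tlift\<close>.\<close>

lemma alg_hom_tensor_decomp:
  assumes "k_algebra K A" "k_algebra K B" "k_algebra K M" "u \<in> alg_hom K (tensor_alg K A B) M"
  shows "u = tlift K M A B (compose (carrier A) u (inl K A B)) (compose (carrier B) u (inr K A B))"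
  using compose_tlift[OF assms(1,2) k_algebra_tensor[OF assms(1,2)] assms(3,4) inl_hom[OF assms(1,2)]
    inr_hom[OF assms(1,2)] inl_inr[OF assms(1,2)]]
  by (simp add: tlift_inl_inr[OF assms(1,2)] compose_id[OF assms(4)])

section \<open>Canonical maps between tensor products\<close>

lemma alg_hom_restrict_apply: "restrict p (carrier A) \<in> alg_hom K A C \<Longrightarrow> a \<in> carrier A \<Longrightarrow> p a \<in> carrier C"
  using alg_hom_closed[of "restrict p (carrier A)"] by force

lemma tensor_map_eq_tlift:
  assumes "k_algebra K A" "k_algebra K B" "k_algebra K C" "k_algebra K D"
    "restrict p (carrier A) \<in> alg_hom K A C" "restrict q (carrier B) \<in> alg_hom K B D"
    "X \<in> carrier (tensor_alg K A B)"
  shows "tensor_map K C D p q X =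
    tlift K (tensor_alg K C D) A B (compose (carrier A) (inl K C D) p) (compose (carrier B) (inr K C D) q) X"
proof -
  interpret AB: algebra_pair K A B by (rule algebra_pairI) fact+
  interpret CD: algebra_pair K C D by (rule algebra_pairI) fact+
  note [simp] = alg_hom_restrict_apply[OF assms(5)] alg_hom_restrict_apply[OF assms(6)]
  show ?thesis unfolding tensor_map_def tlift_def using assms(7)
    by (simp add: compose_def) (rule AB.tensor_lift_cong, simp_all add: CD.pure_eq)
qed

lemma
  assumes "k_algebra K A" "k_algebra K B" "k_algebra K C" "k_algebra K D"
    "restrict p (carrier A) \<in> alg_hom K A C" "restrict q (carrier B) \<in> alg_hom K B D"
    "X \<in> carrier (tensor_alg K A B)"
  shows tensor_map_closed: "tensor_map K C D p q X \<in> carrier (tensor_alg K C D)"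
    and tlift_tensor_map: "k_algebra K M \<Longrightarrow> f \<in> alg_hom K C M \<Longrightarrow> g \<in> alg_hom K D M \<Longrightarrow>
      commuting C D M f g \<Longrightarrow> tlift K M C D f g (tensor_map K C D p q X) =
      tlift K M A B (compose (carrier A) f p) (compose (carrier B) g q) X"
proof -
  interpret AB: algebra_pair K A B by (rule algebra_pairI) fact+
  interpret CD: algebra_pair K C D by (rule algebra_pairI) fact+
  let ?l = "compose (carrier A) (inl K C D) p" and ?r = "compose (carrier B) (inr K C D) q"
  have l: "?l \<in> alg_hom K A CD.T" and r: "?r \<in> alg_hom K B CD.T"
    using alg_hom_compose[OF assms(5) CD.inl_hom] alg_hom_compose[OF assms(6) CD.inr_hom] assms(1,2)
    by simp_all
  have c: "commuting A B CD.T ?l ?r"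
    using commuting_compose_left[OF assms(5)] commuting_compose_right[OF assms(6)] CD.inl_inr
    by (metis compose_restrict_right)
  interpret h: commuting_homs K A B CD.T ?l ?r
    by (rule commuting_homsI) (use assms l r c CD.k_algebra_T in auto)
  show "tensor_map K C D p q X \<in> carrier CD.T"
    using assms(7) by (simp add: tensor_map_eq_tlift[OF assms] del: h.hom_simps)
  assume M: "k_algebra K M" and f: "f \<in> alg_hom K C M" and g: "g \<in> alg_hom K D M"
    and fg: "commuting C D M f g"
  let ?\<phi> = "tlift K M C D f g"
  have \<phi>: "?\<phi> \<in> alg_hom K CD.T M" by (rule tlift_alg_hom) fact+
  have "?\<phi> (tensor_map K C D p q X) =
      tlift K M A B (compose (carrier A) ?\<phi> ?l) (compose (carrier B) ?\<phi> ?r) X"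
    using tlift_compose[OF assms(1,2) CD.k_algebra_T M \<phi> l r c assms(7)]
    by (simp add: tensor_map_eq_tlift[OF assms])
  also have "\<dots> = tlift K M A B (compose (carrier A) f p) (compose (carrier B) g q) X"
  proof (rule fun_cong[OF tlift_cong[OF assms(1,2)]])
    show "compose (carrier A) ?\<phi> ?l a = compose (carrier A) f p a" if "a \<in> carrier A" for a
      using fun_cong[OF compose_tlift_inl(1)[OF assms(3,4) M f g fg], of "p a"] that
        alg_hom_restrict_apply[OF assms(5) that] by (simp add: compose_def)
    show "compose (carrier B) ?\<phi> ?r b = compose (carrier B) g q b" if "b \<in> carrier B" for b
      using fun_cong[OF compose_tlift_inl(2)[OF assms(3,4) M f g fg], of "q b"] that
        alg_hom_restrict_apply[OF assms(6) that] by (simp add: compose_def)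
  qed
  finally show "?\<phi> (tensor_map K C D p q X) =
    tlift K M A B (compose (carrier A) f p) (compose (carrier B) g q) X" .
qed

lemma
  assumes "k_algebra K A" "k_algebra K B" "X \<in> carrier (tensor_alg K A B)"
  shows tensor_flip_closed: "tensor_flip K A B X \<in> carrier (tensor_alg K B A)"
    and tlift_tensor_flip: "k_algebra K M \<Longrightarrow> f \<in> alg_hom K B M \<Longrightarrow> g \<in> alg_hom K A M \<Longrightarrow>
      commuting B A M f g \<Longrightarrow> tlift K M B A f g (tensor_flip K A B X) = tlift K M A B g f X"
proof -
  interpret AB: algebra_pair K A B by (rule algebra_pairI) fact+
  interpret BA: algebra_pair K B A by (rule algebra_pairI) fact+
  interpret h: commuting_homs K A B BA.T "inr K B A" "inl K B A"
    by (rule commuting_homsI) (use assms BA.inl_hom BA.inr_hom BA.k_algebra_T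
      BA.inl_inr[THEN commuting_sym] in auto)
  have eq: "tensor_flip K A B X = tlift K BA.T A B (inr K B A) (inl K B A) X"
    unfolding tensor_flip_def tlift_def using assms(3)
    by simp (rule AB.tensor_lift_cong, simp_all add: BA.pure_eq commuting_D[OF h.fg])
  show "tensor_flip K A B X \<in> carrier BA.T" using assms(3) by (simp add: eq)
  assume M: "k_algebra K M" and f: "f \<in> alg_hom K B M" and g: "g \<in> alg_hom K A M"
    and fg: "commuting B A M f g"
  show "tlift K M B A f g (tensor_flip K A B X) = tlift K M A B g f X"
    using tlift_compose[OF assms(1,2) BA.k_algebra_T M tlift_alg_hom[OF assms(2,1) M f g fg] h.f h.g
        h.fg assms(3)]
    by (simp add: eq compose_tlift_inl[OF assms(2,1) M f g fg])
qed

context commuting_homs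
begin

lemma tensor_lift_mult_right:
  assumes "z \<in> carrier M" "X \<in> carrier T"
  shows "tensor_lift M (\<lambda>a b. f a \<otimes>\<^bsub>M\<^esub> g b \<otimes>\<^bsub>M\<^esub> z) X = tlift K M A B f g X \<otimes>\<^bsub>M\<^esub> z"
proof -
  have bal: "balanced K A B M (\<lambda>a b. f a \<otimes>\<^bsub>M\<^esub> g b \<otimes>\<^bsub>M\<^esub> z)"
    by (rule balanced_group)
      (simp_all add: assms abelian_M M.l_distr M.r_distr M.smult_mult_left M.smult_mult_right)
  show ?thesis
    by (rule additive_eqI[where M = M, OF assms(2)])
      (simp_all add: assms tensor_lift_zero[OF abelian_M(2) bal] tensor_lift_add[OF abelian_M(2) bal]
        tensor_lift_pure[OF abelian_M(2) bal] M.l_distr)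
qed

lemma tensor_lift_mult_left:
  assumes "z \<in> carrier M" "X \<in> carrier T"
  shows "tensor_lift M (\<lambda>a b. z \<otimes>\<^bsub>M\<^esub> (f a \<otimes>\<^bsub>M\<^esub> g b)) X = z \<otimes>\<^bsub>M\<^esub> tlift K M A B f g X"
proof -
  have bal: "balanced K A B M (\<lambda>a b. z \<otimes>\<^bsub>M\<^esub> (f a \<otimes>\<^bsub>M\<^esub> g b))"
    by (rule balanced_group)
      (simp_all add: assms abelian_M M.l_distr M.r_distr M.smult_mult_left M.smult_mult_right)
  show ?thesis
    by (rule additive_eqI[where M = M, OF assms(2)])
      (simp_all add: assms tensor_lift_zero[OF abelian_M(2) bal] tensor_lift_add[OF abelian_M(2) bal]
        tensor_lift_pure[OF abelian_M(2) bal] M.r_distr)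
qed

end

text \<open>The embeddings of \<open>B\<close> and \<open>C\<close> into \<open>A \<otimes> (B \<otimes> C)\<close>.\<close>

definition leg2r where
  "leg2r K A B C = compose (carrier B) (inr K A (tensor_alg K B C)) (inl K B C)"
definition leg3r where
  "leg3r K A B C = compose (carrier C) (inr K A (tensor_alg K B C)) (inr K B C)"

lemma legs_right:
  assumes "k_algebra K A" "k_algebra K B" "k_algebra K C"
  defines "BC \<equiv> tensor_alg K B C"
  defines "M \<equiv> tensor_alg K A BC"
  shows "leg2r K A B C \<in> alg_hom K B M" "leg3r K A B C \<in> alg_hom K C M"
    "commuting A B M (inl K A BC) (leg2r K A B C)" "commuting A C M (inl K A BC) (leg3r K A B C)"
    "commuting B C M (leg2r K A B C) (leg3r K A B C)"
    "tlift K M B C (leg2r K A B C) (leg3r K A B C) = inr K A BC"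
proof -
  have BC: "k_algebra K BC" unfolding BC_def by (rule k_algebra_tensor) fact+
  have M: "k_algebra K M" unfolding M_def by (rule k_algebra_tensor) fact+
  note e = inl_hom[OF assms(2,3), folded BC_def] inr_hom[OF assms(2,3), folded BC_def]
    inl_inr[OF assms(2,3), folded BC_def]
  note e' = inl_hom[OF assms(1) BC, folded M_def] inr_hom[OF assms(1) BC, folded M_def]
    inl_inr[OF assms(1) BC, folded M_def]
  show "leg2r K A B C \<in> alg_hom K B M" "leg3r K A B C \<in> alg_hom K C M"
    "commuting A B M (inl K A BC) (leg2r K A B C)" "commuting A C M (inl K A BC) (leg3r K A B C)"
    unfolding leg2r_def leg3r_def BC_def[symmetric]
    by (rule alg_hom_compose[OF e(1) e'(2) assms(2)] alg_hom_compose[OF e(2) e'(2) assms(3)]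
      commuting_compose_right[OF e(1) e'(3)] commuting_compose_right[OF e(2) e'(3)])+
  show "commuting B C M (leg2r K A B C) (leg3r K A B C)"
    unfolding leg2r_def leg3r_def BC_def[symmetric] by (rule commuting_compose[OF e'(2) e])
  show "tlift K M B C (leg2r K A B C) (leg3r K A B C) = inr K A BC"
    unfolding leg2r_def leg3r_def BC_def[symmetric]
    using compose_tlift[OF assms(2,3) BC M e'(2) e]
    by (simp add: tlift_inl_inr[OF assms(2,3), folded BC_def] BC_def[symmetric] compose_id[OF e'(2)])
qed

text \<open>Elements of an iterated tensor product are determined by their images under commuting
  homomorphisms on the factors.  It suffices to let these take values in the tensor product itself,
  because the embeddings of the factors induce the identity.\<close>

lemma tensor3_eqI:
  fixes K A B C
  defines "M \<equiv> tensor_alg K A (tensor_alg K B C)"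
  assumes "k_algebra K A" "k_algebra K B" "k_algebra K C"
    "X \<in> carrier M" "Y \<in> carrier M"
    "\<And>u v w. u \<in> alg_hom K A M \<Longrightarrow> v \<in> alg_hom K B M \<Longrightarrow> w \<in> alg_hom K C M \<Longrightarrow>
      commuting A B M u v \<Longrightarrow> commuting A C M u w \<Longrightarrow> commuting B C M v w \<Longrightarrow>
      tlift K M A (tensor_alg K B C) u (tlift K M B C v w) X =
      tlift K M A (tensor_alg K B C) u (tlift K M B C v w) Y"
  shows "X = Y"
proof -
  note l = legs_right[OF assms(2-4), folded M_def]
  have BC: "k_algebra K (tensor_alg K B C)" by (rule k_algebra_tensor) fact+
  show ?thesis
    using assms(7)[OF inl_hom[OF assms(2) BC, folded M_def] l(1-5)] assms(5,6)
    by (simp add: l(6) tlift_inl_inr[OF assms(2) BC, folded M_def])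
qed

lemma tensor3_left_eqI:
  fixes K A B C
  defines "M \<equiv> tensor_alg K (tensor_alg K A B) C"
  assumes "k_algebra K A" "k_algebra K B" "k_algebra K C"
    "X \<in> carrier M" "Y \<in> carrier M"
    "\<And>u v w. u \<in> alg_hom K A M \<Longrightarrow> v \<in> alg_hom K B M \<Longrightarrow> w \<in> alg_hom K C M \<Longrightarrow>
      commuting A B M u v \<Longrightarrow> commuting A C M u w \<Longrightarrow> commuting B C M v w \<Longrightarrow>
      tlift K M (tensor_alg K A B) C (tlift K M A B u v) w X =
      tlift K M (tensor_alg K A B) C (tlift K M A B u v) w Y"
  shows "X = Y"
proof -
  interpret AB: algebra_pair K A B by (rule algebra_pairI) fact+
  have M: "k_algebra K M" unfolding M_def by (intro k_algebra_tensor AB.k_algebra_T assms)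
  note e' = inl_hom[OF AB.k_algebra_T assms(4), folded M_def] inr_hom[OF AB.k_algebra_T assms(4), folded M_def]
    inl_inr[OF AB.k_algebra_T assms(4), folded M_def]
  show ?thesis
    using assms(7)[OF alg_hom_compose[OF AB.inl_hom e'(1) assms(2)] alg_hom_compose[OF AB.inr_hom e'(1) assms(3)]
      e'(2) commuting_compose[OF e'(1) AB.inl_hom AB.inr_hom AB.inl_inr]
      commuting_compose_left[OF AB.inl_hom e'(3)] commuting_compose_left[OF AB.inr_hom e'(3)]] assms(5,6)
    by (simp add: compose_tlift[OF assms(2,3) AB.k_algebra_T M e'(1) AB.inl_hom AB.inr_hom AB.inl_inr, symmetric]
       AB.tlift_inl_inr compose_id[OF e'(1)] tlift_inl_inr[OF AB.k_algebra_T assms(4), folded M_def])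
qed

lemma tensor4_eqI:
  fixes K A B C D
  defines "M \<equiv> tensor_alg K (tensor_alg K A B) (tensor_alg K C D)"
  assumes "k_algebra K A" "k_algebra K B" "k_algebra K C" "k_algebra K D"
    "X \<in> carrier M" "Y \<in> carrier M"
    "\<And>u v w x. u \<in> alg_hom K A M \<Longrightarrow> v \<in> alg_hom K B M \<Longrightarrow> w \<in> alg_hom K C M \<Longrightarrow>
      x \<in> alg_hom K D M \<Longrightarrow> commuting A B M u v \<Longrightarrow> commuting A C M u w \<Longrightarrow> commuting A D M u x \<Longrightarrow>
      commuting B C M v w \<Longrightarrow> commuting B D M v x \<Longrightarrow> commuting C D M w x \<Longrightarrow>
      tlift K M (tensor_alg K A B) (tensor_alg K C D) (tlift K M A B u v) (tlift K M C D w x) X =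
      tlift K M (tensor_alg K A B) (tensor_alg K C D) (tlift K M A B u v) (tlift K M C D w x) Y"
  shows "X = Y"
proof (rule tensor3_left_eqI[of K A B "tensor_alg K C D", folded M_def])
  interpret CD: algebra_pair K C D by (rule algebra_pairI) fact+
  show "k_algebra K CD.T" by (rule CD.k_algebra_T)
  have M: "k_algebra K M" unfolding M_def by (intro k_algebra_tensor assms)
  fix u v y assume *: "u \<in> alg_hom K A M" "v \<in> alg_hom K B M" "y \<in> alg_hom K CD.T M"
    "commuting A B M u v" "commuting A CD.T M u y" "commuting B CD.T M v y"
  show "tlift K M (tensor_alg K A B) CD.T (tlift K M A B u v) y X =
      tlift K M (tensor_alg K A B) CD.T (tlift K M A B u v) y Y"
    using assms(8)[OF *(1,2) alg_hom_compose[OF CD.inl_hom *(3) assms(4)] alg_hom_compose[OF CD.inr_hom *(3) assms(5)]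
      *(4) commuting_compose_right[OF CD.inl_hom *(5)] commuting_compose_right[OF CD.inr_hom *(5)]
      commuting_compose_right[OF CD.inl_hom *(6)] commuting_compose_right[OF CD.inr_hom *(6)]
      commuting_compose[OF *(3) CD.inl_hom CD.inr_hom CD.inl_inr]]
    by (simp add: alg_hom_tensor_decomp[OF assms(4,5) M *(3), symmetric])
qed (use assms in auto)

lemma
  assumes "k_algebra K A" "k_algebra K B" "k_algebra K C"
    "X \<in> carrier (tensor_alg K (tensor_alg K A B) C)"
  shows tensor_assoc_closed: "tensor_assoc K A B C X \<in> carrier (tensor_alg K A (tensor_alg K B C))"
    and tlift_tensor_assoc: "k_algebra K M \<Longrightarrow> f \<in> alg_hom K A M \<Longrightarrow> g \<in> alg_hom K B M \<Longrightarrow>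
      h \<in> alg_hom K C M \<Longrightarrow> commuting A B M f g \<Longrightarrow> commuting A C M f h \<Longrightarrow> commuting B C M g h \<Longrightarrow>
      tlift K M A (tensor_alg K B C) f (tlift K M B C g h) (tensor_assoc K A B C X) =
      tlift K M (tensor_alg K A B) C (tlift K M A B f g) h X"
proof -
  interpret AB: algebra_pair K A B by (rule algebra_pairI) fact+
  interpret BC: algebra_pair K B C by (rule algebra_pairI) fact+
  interpret A_BC: algebra_pair K A BC.T by (intro algebra_pairI assms BC.k_algebra_T)
  interpret AB_C: algebra_pair K AB.T C by (intro algebra_pairI assms AB.k_algebra_T)
  let ?T = A_BC.T
  define j1 where "j1 = inl K A BC.T"
  define j2 where "j2 = leg2r K A B C"
  define j3 where "j3 = leg3r K A B C"
  note l = legs_right[OF assms(1-3), folded j1_def j2_def j3_def]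
  have j1: "j1 \<in> alg_hom K A ?T" unfolding j1_def by (rule A_BC.inl_hom)
  interpret j12: commuting_homs K A B ?T j1 j2
    by (rule commuting_homsI) (use assms l j1 A_BC.k_algebra_T in auto)
  interpret j23: commuting_homs K B C ?T j2 j3
    by (rule commuting_homsI) (use assms l j1 A_BC.k_algebra_T in auto)
  interpret j123: commuting_homs K AB.T C ?T "tlift K ?T A B j1 j2" j3
    by (rule commuting_homsI[OF AB.k_algebra_T assms(3) A_BC.k_algebra_T j12.tlift_alg_hom l(2)
      commuting_tlift_left[OF assms(1,2) A_BC.k_algebra_T j1 l(1,2) l(3-5)]])
  have pure: "A_BC.pt a (BC.pt b c) = j1 a \<otimes>\<^bsub>?T\<^esub> j2 b \<otimes>\<^bsub>?T\<^esub> j3 c"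
    if "a \<in> carrier A" "b \<in> carrier B" "c \<in> carrier C" for a b c
  proof -
    have "inr K A BC.T (BC.pt b c) = j2 b \<otimes>\<^bsub>?T\<^esub> j3 c"
      unfolding l(6)[symmetric] using that by simp
    then show ?thesis using that by (simp add: A_BC.pure_eq j1_def[symmetric] j12.M.m_assoc)
  qed
  have eq: "tensor_assoc K A B C X = tlift K ?T AB.T C (tlift K ?T A B j1 j2) j3 X"
  proof -
    have "tensor_assoc K A B C X = tensor_lift ?T (\<lambda>X c. tlift K ?T A B j1 j2 X \<otimes>\<^bsub>?T\<^esub> j3 c) X"
      unfolding tensor_assoc_def
    proof (rule AB_C.tensor_lift_cong[OF assms(4)])
      fix X c assume *: "X \<in> carrier AB.T" "c \<in> carrier C"
      have "tensor_lift ?T (\<lambda>a b. A_BC.pt a (BC.pt b c)) X =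
          tensor_lift ?T (\<lambda>a b. j1 a \<otimes>\<^bsub>?T\<^esub> j2 b \<otimes>\<^bsub>?T\<^esub> j3 c) X"
        by (rule AB.tensor_lift_cong[OF *(1)]) (simp add: pure *)
      then show "tensor_lift ?T (\<lambda>a b. A_BC.pt a (BC.pt b c)) X = tlift K ?T A B j1 j2 X \<otimes>\<^bsub>?T\<^esub> j3 c"
        using * by (simp add: j12.tensor_lift_mult_right)
    qed
    then show ?thesis using assms(4) by (simp add: tlift_def)
  qed
  show "tensor_assoc K A B C X \<in> carrier ?T" using assms(4) by (simp add: eq)
  assume *: "k_algebra K M" "f \<in> alg_hom K A M" "g \<in> alg_hom K B M" "h \<in> alg_hom K C M"
    "commuting A B M f g" "commuting A C M f h" "commuting B C M g h"
  note gh = tlift_alg_hom[OF assms(2,3) *(1,3,4,7)]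
    commuting_tlift_right[OF assms(2,3) *(1,3,4,2,7,5,6)]
  let ?\<phi> = "tlift K M A BC.T f (tlift K M B C g h)"
  have \<phi>: "?\<phi> \<in> alg_hom K ?T M"
    by (rule tlift_alg_hom[OF assms(1) BC.k_algebra_T *(1,2) gh])
  note cl = compose_tlift_inl[OF assms(1) BC.k_algebra_T *(1,2) gh]
  note cl' = compose_tlift_inl[OF assms(2,3) *(1,3,4,7)]
  have legs: "compose (carrier A) ?\<phi> j1 = f" "compose (carrier B) ?\<phi> j2 = g"
    "compose (carrier C) ?\<phi> j3 = h"
    unfolding j1_def j2_def j3_def leg2r_def leg3r_def
    by (simp_all add: compose_compose[OF BC.inl_hom] compose_compose[OF BC.inr_hom] cl cl')
  show "?\<phi> (tensor_assoc K A B C X) = tlift K M AB.T C (tlift K M A B f g) h X"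
    using tlift_compose[OF AB.k_algebra_T assms(3) A_BC.k_algebra_T *(1) \<phi> j12.tlift_alg_hom l(2) j123.fg
        assms(4)]
      compose_tlift[OF assms(1,2) A_BC.k_algebra_T *(1) \<phi> j1 l(1) l(3)]
    by (simp add: eq legs)
qed

lemma
  assumes "k_algebra K A" "k_algebra K B" "k_algebra K C" "k_algebra K D"
    "X \<in> carrier (tensor_alg K (tensor_alg K A B) (tensor_alg K C D))"
  shows tensor_middle_flip_closed: "tensor_middle_flip K A B C D X
      \<in> carrier (tensor_alg K (tensor_alg K A C) (tensor_alg K B D))"
    and tlift_tensor_middle_flip: "k_algebra K M \<Longrightarrow> f \<in> alg_hom K A M \<Longrightarrow> g \<in> alg_hom K B M \<Longrightarrow>
      h \<in> alg_hom K C M \<Longrightarrow> k \<in> alg_hom K D M \<Longrightarrow>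
      commuting A B M f g \<Longrightarrow> commuting A C M f h \<Longrightarrow> commuting A D M f k \<Longrightarrow>
      commuting B C M g h \<Longrightarrow> commuting B D M g k \<Longrightarrow> commuting C D M h k \<Longrightarrow>
      tlift K M (tensor_alg K A C) (tensor_alg K B D) (tlift K M A C f h) (tlift K M B D g k)
        (tensor_middle_flip K A B C D X) =
      tlift K M (tensor_alg K A B) (tensor_alg K C D) (tlift K M A B f g) (tlift K M C D h k) X"
proof -
  interpret AB: algebra_pair K A B by (rule algebra_pairI) fact+
  interpret CD: algebra_pair K C D by (rule algebra_pairI) fact+
  interpret AC: algebra_pair K A C by (rule algebra_pairI) fact+
  interpret BD: algebra_pair K B D by (rule algebra_pairI) fact+
  interpret ABCD: algebra_pair K AB.T CD.T by (intro algebra_pairI AB.k_algebra_T CD.k_algebra_T)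
  interpret ACBD: algebra_pair K AC.T BD.T by (intro algebra_pairI AC.k_algebra_T BD.k_algebra_T)
  let ?T = ACBD.T
  note T = ACBD.k_algebra_T
  define a where "a = compose (carrier A) (inl K AC.T BD.T) (inl K A C)"
  define c where "c = compose (carrier C) (inl K AC.T BD.T) (inr K A C)"
  define b where "b = compose (carrier B) (inr K AC.T BD.T) (inl K B D)"
  define d where "d = compose (carrier D) (inr K AC.T BD.T) (inr K B D)"
  note homs = alg_hom_compose[OF AC.inl_hom ACBD.inl_hom assms(1), folded a_def]
    alg_hom_compose[OF BD.inl_hom ACBD.inr_hom assms(2), folded b_def]
    alg_hom_compose[OF AC.inr_hom ACBD.inl_hom assms(3), folded c_def]
    alg_hom_compose[OF BD.inr_hom ACBD.inr_hom assms(4), folded d_def]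
  have comm: "commuting A B ?T a b" "commuting A D ?T a d" "commuting C B ?T c b" "commuting C D ?T c d"
    unfolding a_def b_def c_def d_def
    by (rule commuting_compose_left[OF AC.inl_hom] commuting_compose_left[OF AC.inr_hom]
      commuting_compose_right[OF BD.inl_hom] commuting_compose_right[OF BD.inr_hom] ACBD.inl_inr)+
  have comm': "commuting A C ?T a c" "commuting B D ?T b d"
    unfolding a_def b_def c_def d_def
    by (rule commuting_compose[OF ACBD.inl_hom AC.inl_hom AC.inr_hom AC.inl_inr]
      commuting_compose[OF ACBD.inr_hom BD.inl_hom BD.inr_hom BD.inl_inr])+
  interpret ab: commuting_homs K A B ?T a b
    by (rule commuting_homsI) (use assms homs comm T in auto)
  interpret cd: commuting_homs K C D ?T c d
    by (rule commuting_homsI) (use assms homs comm T in auto)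
  interpret abcd: commuting_homs K AB.T CD.T ?T "tlift K ?T A B a b" "tlift K ?T C D c d"
    by (intro commuting_homsI AB.k_algebra_T CD.k_algebra_T T ab.tlift_alg_hom cd.tlift_alg_hom
      commuting_tlift_left[OF assms(1,2) T] commuting_tlift_right[OF assms(3,4) T] homs comm comm'
      comm[THEN commuting_sym])
  have pure: "ACBD.pt (AC.pt x y) (BD.pt z w) = a x \<otimes>\<^bsub>?T\<^esub> b z \<otimes>\<^bsub>?T\<^esub> (c y \<otimes>\<^bsub>?T\<^esub> d w)"
    if [simp]: "x \<in> carrier A" "y \<in> carrier C" "z \<in> carrier B" "w \<in> carrier D" for x y z w
  proof -
    have "ACBD.pt (AC.pt x y) (BD.pt z w) = (a x \<otimes>\<^bsub>?T\<^esub> c y) \<otimes>\<^bsub>?T\<^esub> (b z \<otimes>\<^bsub>?T\<^esub> d w)"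
      by (simp add: ACBD.pure_eq AC.pure_eq BD.pure_eq a_def b_def c_def d_def compose_def
        alg_hom_mult[OF ACBD.inl_hom] alg_hom_mult[OF ACBD.inr_hom] alg_hom_closed[OF AC.inl_hom]
        alg_hom_closed[OF AC.inr_hom] alg_hom_closed[OF BD.inl_hom] alg_hom_closed[OF BD.inr_hom])
    moreover have "c y \<otimes>\<^bsub>?T\<^esub> (b z \<otimes>\<^bsub>?T\<^esub> d w) = b z \<otimes>\<^bsub>?T\<^esub> (c y \<otimes>\<^bsub>?T\<^esub> d w)"
      using commuting_D[OF comm(3), of y z] by (simp add: ab.M.m_assoc[symmetric])
    ultimately show ?thesis by (simp add: ab.M.m_assoc)
  qed
  have eq: "tensor_middle_flip K A B C D X =
      tlift K ?T AB.T CD.T (tlift K ?T A B a b) (tlift K ?T C D c d) X"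
  proof -
    have "tensor_middle_flip K A B C D X =
      tensor_lift ?T (\<lambda>X Y. tlift K ?T A B a b X \<otimes>\<^bsub>?T\<^esub> tlift K ?T C D c d Y) X"
      unfolding tensor_middle_flip_def Let_def
    proof (rule ABCD.tensor_lift_cong[OF assms(5)])
      fix X Y assume *: "X \<in> carrier AB.T" "Y \<in> carrier CD.T"
      have "tensor_lift ?T (\<lambda>x z. tensor_lift ?T (\<lambda>y w. ACBD.pt (AC.pt x y) (BD.pt z w)) Y) X =
        tensor_lift ?T (\<lambda>x z. a x \<otimes>\<^bsub>?T\<^esub> b z \<otimes>\<^bsub>?T\<^esub> tlift K ?T C D c d Y) X"
      proof (rule AB.tensor_lift_cong[OF *(1)])
        fix x z assume xz: "x \<in> carrier A" "z \<in> carrier B"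
        have "tensor_lift ?T (\<lambda>y w. ACBD.pt (AC.pt x y) (BD.pt z w)) Y =
          tensor_lift ?T (\<lambda>y w. a x \<otimes>\<^bsub>?T\<^esub> b z \<otimes>\<^bsub>?T\<^esub> (c y \<otimes>\<^bsub>?T\<^esub> d w)) Y"
          by (rule CD.tensor_lift_cong[OF *(2)]) (simp add: pure xz)
        then show "tensor_lift ?T (\<lambda>y w. ACBD.pt (AC.pt x y) (BD.pt z w)) Y =
          a x \<otimes>\<^bsub>?T\<^esub> b z \<otimes>\<^bsub>?T\<^esub> tlift K ?T C D c d Y"
          using xz * by (simp add: cd.tensor_lift_mult_left)
      qed
      then show "tensor_lift ?T (\<lambda>x z. tensor_lift ?T (\<lambda>y w. ACBD.pt (AC.pt x y) (BD.pt z w)) Y) X =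
        tlift K ?T A B a b X \<otimes>\<^bsub>?T\<^esub> tlift K ?T C D c d Y"
        using * by (simp add: ab.tensor_lift_mult_right)
    qed
    then show ?thesis using assms(5) by (simp add: tlift_def)
  qed
  show "tensor_middle_flip K A B C D X \<in> carrier ?T" using assms(5) by (simp add: eq)
  assume *: "k_algebra K M" "f \<in> alg_hom K A M" "g \<in> alg_hom K B M" "h \<in> alg_hom K C M"
    "k \<in> alg_hom K D M" "commuting A B M f g" "commuting A C M f h" "commuting A D M f k"
    "commuting B C M g h" "commuting B D M g k" "commuting C D M h k"
  note fh = tlift_alg_hom[OF assms(1,3) *(1,2,4,7)] and gk = tlift_alg_hom[OF assms(2,4) *(1,3,5,10)]
  have fhgk: "commuting AC.T BD.T M (tlift K M A C f h) (tlift K M B D g k)"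
    by (intro commuting_tlift_left[OF assms(1,3) *(1)] commuting_tlift_right[OF assms(2,4) *(1)] gk *
      *(9)[THEN commuting_sym])
  let ?\<phi> = "tlift K M AC.T BD.T (tlift K M A C f h) (tlift K M B D g k)"
  have \<phi>: "?\<phi> \<in> alg_hom K ?T M"
    by (rule tlift_alg_hom[OF AC.k_algebra_T BD.k_algebra_T *(1) fh gk fhgk])
  note cl = compose_tlift_inl[OF AC.k_algebra_T BD.k_algebra_T *(1) fh gk fhgk]
    compose_tlift_inl[OF assms(1,3) *(1,2,4,7)] compose_tlift_inl[OF assms(2,4) *(1,3,5,10)]
  have legs: "compose (carrier A) ?\<phi> a = f" "compose (carrier C) ?\<phi> c = h"
    "compose (carrier B) ?\<phi> b = g" "compose (carrier D) ?\<phi> d = k"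
    unfolding a_def b_def c_def d_def
    by (simp_all add: compose_compose[OF AC.inl_hom] compose_compose[OF AC.inr_hom]
      compose_compose[OF BD.inl_hom] compose_compose[OF BD.inr_hom] cl)
  show "?\<phi> (tensor_middle_flip K A B C D X) =
      tlift K M AB.T CD.T (tlift K M A B f g) (tlift K M C D h k) X"
    using tlift_compose[OF AB.k_algebra_T CD.k_algebra_T T *(1) \<phi> ab.tlift_alg_hom cd.tlift_alg_hom
        abcd.fg assms(5)]
      compose_tlift[OF assms(1,2) T *(1) \<phi> homs(1,2) comm(1)]
      compose_tlift[OF assms(3,4) T *(1) \<phi> homs(3,4) comm(4)]
    by (simp add: eq legs)
qed

section \<open>Convolution of homomorphisms\<close>

text \<open>An algebra with multiplicative linear \<open>\<Delta>\<close> and \<open>\<epsilon>\<close>, without coassociativity and the counit laws.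
  These weaker axioms suffice to evaluate the remaining bialgebra axioms and the twist axioms under
  commuting homomorphisms.\<close>

locale pre_bialgebra = k_algebra K H
  for K :: "('k, 'm) ring_scheme" and H :: "('k, 'h, 'p) bialgebra_scheme" +
  assumes comult_hom: "restrict (comult H) (carrier H) \<in> alg_hom K H (tensor_alg K H H)"
    and counit_hom_mem: "counit H \<in> ring_hom H K"
    and counit_linear: "r \<in> carrier K \<Longrightarrow> h \<in> carrier H \<Longrightarrow>
      counit H (r \<odot>\<^bsub>H\<^esub> h) = r \<otimes>\<^bsub>K\<^esub> counit H h"

lemma (in bialgebra) pre_bialgebra: "pre_bialgebra K H"
proof -
  have "restrict (comult H) (carrier H) \<in> alg_hom K H (tensor_alg K H H)"
    using comult_ring_hom by (intro alg_homI)
      (auto simp: comult_smult ring_hom_closed ring_hom_mult ring_hom_add ring_hom_one)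
  then show ?thesis
    by (intro pre_bialgebra.intro pre_bialgebra_axioms.intro k_algebra_axioms counit_ring_hom counit_smult)
qed

text \<open>The counit followed by the unit of \<open>M\<close>; the neutral element for convolution.\<close>

definition counit_hom ::
  "('k, 'h, 'p) bialgebra_scheme \<Rightarrow> ('k, 'c, 'r) module_scheme \<Rightarrow> 'h \<Rightarrow> 'c"
  where "counit_hom H M = restrict (\<lambda>h. counit H h \<odot>\<^bsub>M\<^esub> \<one>\<^bsub>M\<^esub>) (carrier H)"

text \<open>The convolution \<open>u * v = tlift u v \<circ> \<Delta>\<close>.  It is again a homomorphism when \<open>u\<close> and \<open>v\<close> commute.\<close>

definition convolution ::
  "('k, 'm) ring_scheme \<Rightarrow> ('k, 'c, 'r) module_scheme \<Rightarrow> ('k, 'h, 'p) bialgebra_scheme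
    \<Rightarrow> ('h \<Rightarrow> 'c) \<Rightarrow> ('h \<Rightarrow> 'c) \<Rightarrow> 'h \<Rightarrow> 'c"
  where "convolution K M H u v = compose (carrier H) (tlift K M H H u v) (comult H)"

context pre_bialgebra
begin

lemma k_algebra_H: "k_algebra K H" by (rule k_algebra_axioms)

sublocale Sq: algebra_pair K H H by (intro algebra_pairI k_algebra_H)

lemma comult_closed [simp]: "h \<in> carrier H \<Longrightarrow> comult H h \<in> carrier Sq.T"
  using alg_hom_restrict_apply[OF comult_hom] .

lemma counit_closed [simp]: "h \<in> carrier H \<Longrightarrow> counit H h \<in> carrier K"
  using ring_hom_closed[OF counit_hom_mem] .

lemma counit_hom_alg_hom:
  assumes "k_algebra K M" shows "counit_hom H M \<in> alg_hom K H M"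
proof -
  interpret M: k_algebra K M by fact
  note c = ring_hom_mult[OF counit_hom_mem] ring_hom_add[OF counit_hom_mem] ring_hom_one[OF counit_hom_mem]
  show ?thesis
    by (rule alg_homI)
      (simp_all add: counit_hom_def c M.smult_l_distr M.smult_assoc1 M.smult_mult_left counit_linear)
qed

lemma
  assumes "k_algebra K M" "f \<in> alg_hom K A M"
  shows commuting_counit_left: "commuting H A M (counit_hom H M) f"
    and commuting_counit_right: "commuting A H M f (counit_hom H M)"
proof -
  interpret M: k_algebra K M by fact
  show "commuting H A M (counit_hom H M) f" "commuting A H M f (counit_hom H M)"
    by (simp_all add: commuting_def counit_hom_def alg_hom_closed[OF assms(2)] M.smult_mult_left
      M.smult_mult_right)
qed

lemma compose_counit_hom:
  assumes "k_algebra K M" "k_algebra K N" "\<phi> \<in> alg_hom K M N"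
  shows "compose (carrier H) \<phi> (counit_hom H M) = counit_hom H N"
proof -
  interpret M: k_algebra K M by fact
  show ?thesis
    by (auto simp: compose_def counit_hom_def alg_hom_smult[OF assms(3)] alg_hom_one[OF assms(3)])
qed

lemma convolution_apply:
  "h \<in> carrier H \<Longrightarrow> convolution K M H u v h = tlift K M H H u v (comult H h)"
  by (simp add: convolution_def compose_def)

lemma convolution_alg_hom:
  assumes "k_algebra K M" "u \<in> alg_hom K H M" "v \<in> alg_hom K H M" "commuting H H M u v"
  shows "convolution K M H u v \<in> alg_hom K H M"
  using alg_hom_compose[OF comult_hom tlift_alg_hom[OF k_algebra_H k_algebra_H assms] k_algebra_H]
  by (simp add: convolution_def)

lemma commuting_convolution_left:
  assumes "k_algebra K M" "u \<in> alg_hom K H M" "v \<in> alg_hom K H M" "w \<in> alg_hom K A M"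
    "commuting H H M u v" "commuting H A M u w" "commuting H A M v w"
  shows "commuting H A M (convolution K M H u v) w"
  using commuting_compose_left[OF comult_hom commuting_tlift_left[OF k_algebra_H k_algebra_H assms]]
  by (simp add: convolution_def)

lemma commuting_convolution_right:
  assumes "k_algebra K M" "u \<in> alg_hom K H M" "v \<in> alg_hom K H M" "w \<in> alg_hom K A M"
    "commuting H H M u v" "commuting A H M w u" "commuting A H M w v"
  shows "commuting A H M w (convolution K M H u v)"
  using commuting_compose_right[OF comult_hom commuting_tlift_right[OF k_algebra_H k_algebra_H assms]]
  by (simp add: convolution_def)

lemma hom_counit_left:
  assumes "k_algebra K B" "k_algebra K M" "f \<in> alg_hom K B M" "X \<in> carrier (tensor_alg K H B)"
  shows "f (counit_left H B X) = tlift K M H B (counit_hom H M) f X"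
    and "counit_left H B X \<in> carrier B"
proof -
  interpret B: k_algebra K B by fact
  interpret HB: algebra_pair K H B by (intro algebra_pairI k_algebra_H assms)
  have eq: "counit_left H B X = tlift K B H B (counit_hom H B) (restrict id (carrier B)) X"
    unfolding counit_left_def tlift_def using assms(4)
    by simp (rule HB.tensor_lift_cong, simp_all add: counit_hom_def B.smult_mult_left)
  note c = commuting_counit_left[OF assms(1) alg_hom_id[OF assms(1)]]
  interpret commuting_homs K H B B "counit_hom H B" "restrict id (carrier B)"
    by (intro commuting_homsI k_algebra_H assms alg_hom_id c counit_hom_alg_hom)
  show "counit_left H B X \<in> carrier B" using assms(4) by (simp add: eq)
  show "f (counit_left H B X) = tlift K M H B (counit_hom H M) f X"
    using tlift_compose[OF k_algebra_H assms(1,1,2,3) counit_hom_alg_hom[OF assms(1)] alg_hom_id[OF assms(1)]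
        c assms(4)]
    by (simp add: eq compose_counit_hom[OF assms(1,2,3)] compose_id[OF assms(3)])
qed

lemma hom_counit_right:
  assumes "k_algebra K A" "k_algebra K M" "f \<in> alg_hom K A M" "X \<in> carrier (tensor_alg K A H)"
  shows "f (counit_right A H X) = tlift K M A H f (counit_hom H M) X"
    and "counit_right A H X \<in> carrier A"
proof -
  interpret A: k_algebra K A by fact
  interpret AH: algebra_pair K A H by (intro algebra_pairI k_algebra_H assms)
  have eq: "counit_right A H X = tlift K A A H (restrict id (carrier A)) (counit_hom H A) X"
    unfolding counit_right_def tlift_def using assms(4)
    by simp (rule AH.tensor_lift_cong, simp_all add: counit_hom_def A.smult_mult_right)
  note c = commuting_counit_right[OF assms(1) alg_hom_id[OF assms(1)]]
  interpret commuting_homs K A H A "restrict id (carrier A)" "counit_hom H A"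
    by (intro commuting_homsI k_algebra_H assms alg_hom_id c counit_hom_alg_hom)
  show "counit_right A H X \<in> carrier A" using assms(4) by (simp add: eq)
  show "f (counit_right A H X) = tlift K M A H f (counit_hom H M) X"
    using tlift_compose[OF assms(1) k_algebra_H assms(1,2,3) alg_hom_id[OF assms(1)] counit_hom_alg_hom[OF assms(1)]
        c assms(4)]
    by (simp add: eq compose_counit_hom[OF assms(1,2,3)] compose_id[OF assms(3)])
qed

text \<open>Both sides of the coassociativity axiom, evaluated under commuting homomorphisms.\<close>

lemma
  assumes "k_algebra K M" "u \<in> alg_hom K H M" "v \<in> alg_hom K H M" "w \<in> alg_hom K H M"
    "commuting H H M u v" "commuting H H M u w" "commuting H H M v w" "X \<in> carrier Sq.T"
  shows tlift_comult_left: "tlift K M H Sq.T u (tlift K M H H v w)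
      (tensor_assoc K H H H (tensor_map K Sq.T H (comult H) id X)) =
      tlift K M H H (convolution K M H u v) w X"
    and tlift_comult_right: "tlift K M H Sq.T u (tlift K M H H v w)
      (tensor_map K H Sq.T id (comult H) X) =
      tlift K M H H u (convolution K M H v w) X"
proof -
  note A = k_algebra_H Sq.k_algebra_T
  note m1 = tensor_map_closed[OF A(1,1,2,1) comult_hom alg_hom_id[OF A(1)] assms(8)]
  note m2 = tensor_map_closed[OF A(1,1,1,2) alg_hom_id[OF A(1)] comult_hom assms(8)]
  show "tlift K M H Sq.T u (tlift K M H H v w)
      (tensor_assoc K H H H (tensor_map K Sq.T H (comult H) id X)) =
      tlift K M H H (convolution K M H u v) w X"
    by (simp add: tlift_tensor_assoc[OF A(1,1,1) m1 assms(1-7)]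
      tlift_tensor_map[OF A(1,1,2,1) comult_hom alg_hom_id[OF A(1)] assms(8) assms(1)
        tlift_alg_hom[OF A(1,1) assms(1,2,3,5)] assms(4)
        commuting_tlift_left[OF A(1,1) assms(1-7)]] convolution_def compose_id[OF assms(4)])
  show "tlift K M H Sq.T u (tlift K M H H v w)
      (tensor_map K H Sq.T id (comult H) X) =
      tlift K M H H u (convolution K M H v w) X"
    by (simp add: tlift_tensor_map[OF A(1,1,1,2) alg_hom_id[OF A(1)] comult_hom assms(8) assms(1)
        assms(2) tlift_alg_hom[OF A(1,1) assms(1,3,4,7)]
        commuting_tlift_right[OF A(1,1) assms(1,3,4,2,7,5,6)]] convolution_def compose_id[OF assms(2)])
qed

text \<open>The bialgebra axioms, phrased through the convolution of commuting homomorphisms.\<close>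

lemma bialgebraI:
  fixes T1
  defines "T1 \<equiv> tensor_alg K H Sq.T"
  assumes assoc: "\<And>u v w. u \<in> alg_hom K H T1 \<Longrightarrow> v \<in> alg_hom K H T1 \<Longrightarrow> w \<in> alg_hom K H T1 \<Longrightarrow>
      commuting H H T1 u v \<Longrightarrow> commuting H H T1 u w \<Longrightarrow> commuting H H T1 v w \<Longrightarrow>
      convolution K T1 H (convolution K T1 H u v) w = convolution K T1 H u (convolution K T1 H v w)"
    and unit: "\<And>u. u \<in> alg_hom K H H \<Longrightarrow> convolution K H H (counit_hom H H) u = u"
      "\<And>u. u \<in> alg_hom K H H \<Longrightarrow> convolution K H H u (counit_hom H H) = u"
  shows "bialgebra K H"
proof (intro bialgebra.intro bialgebra_axioms.intro k_algebra_H)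
  note A = k_algebra_H Sq.k_algebra_T
  have T1: "k_algebra K T1" unfolding T1_def by (intro k_algebra_tensor A)
  note cm = comult_hom[THEN alg_hom_mult] comult_hom[THEN alg_hom_add] comult_hom[THEN alg_hom_one]
    comult_hom[THEN alg_hom_smult]
  show "comult H \<in> ring_hom H Sq.T"
    using cm by (intro ring_hom_memI) simp_all
  show "counit H \<in> ring_hom H K" by (rule counit_hom_mem)
  fix h assume h: "h \<in> carrier H"
  show "comult H (r \<odot>\<^bsub>H\<^esub> h) = r \<odot>\<^bsub>Sq.T\<^esub> comult H h" if "r \<in> carrier K" for r
    using cm(4)[OF that h] that h by simp
  show "counit H (r \<odot>\<^bsub>H\<^esub> h) = r \<otimes>\<^bsub>K\<^esub> counit H h" if "r \<in> carrier K" for r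
    using counit_linear that h .
  note m = tensor_map_closed[OF A(1,1,2,1) comult_hom alg_hom_id[OF A(1)] comult_closed[OF h]]
    tensor_map_closed[OF A(1,1,1,2) alg_hom_id[OF A(1)] comult_hom comult_closed[OF h]]
  show "tensor_assoc K H H H (tensor_map K Sq.T H (comult H) id (comult H h)) =
      tensor_map K H Sq.T id (comult H) (comult H h)"
  proof (rule tensor3_eqI[OF A(1,1,1) tensor_assoc_closed[OF A(1,1,1) m(1)] m(2), folded T1_def])
    fix u v w assume *: "u \<in> alg_hom K H T1" "v \<in> alg_hom K H T1" "w \<in> alg_hom K H T1"
      "commuting H H T1 u v" "commuting H H T1 u w" "commuting H H T1 v w"
    show "tlift K T1 H Sq.T u (tlift K T1 H H v w)
        (tensor_assoc K H H H (tensor_map K Sq.T H (comult H) id (comult H h))) =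
      tlift K T1 H Sq.T u (tlift K T1 H H v w) (tensor_map K H Sq.T id (comult H) (comult H h))"
      using fun_cong[OF assoc[OF *], of h] h
      by (simp add: tlift_comult_left[OF T1 * comult_closed[OF h]]
        tlift_comult_right[OF T1 * comult_closed[OF h]] convolution_apply)
  qed
  show "counit_left H H (comult H h) = h"
    using hom_counit_left[OF A(1,1) alg_hom_id[OF A(1)] comult_closed[OF h]] h
      fun_cong[OF unit(1)[OF alg_hom_id[OF A(1)]], of h]
    by (simp add: convolution_apply)
  show "counit_right H H (comult H h) = h"
    using hom_counit_right[OF A(1,1) alg_hom_id[OF A(1)] comult_closed[OF h]] h
      fun_cong[OF unit(2)[OF alg_hom_id[OF A(1)]], of h]
    by (simp add: convolution_apply)
qed

end

sublocale bialgebra \<subseteq> pre_bialgebra K H by (rule pre_bialgebra)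

context bialgebra
begin

lemma convolution_assoc:
  assumes "k_algebra K M" "u \<in> alg_hom K H M" "v \<in> alg_hom K H M" "w \<in> alg_hom K H M"
    "commuting H H M u v" "commuting H H M u w" "commuting H H M v w"
  shows "convolution K M H (convolution K M H u v) w = convolution K M H u (convolution K M H v w)"
proof (rule extensionalityI[of _ "carrier H"])
  fix h assume h: "h \<in> carrier H"
  show "convolution K M H (convolution K M H u v) w h = convolution K M H u (convolution K M H v w) h"
    using tlift_comult_left[OF assms comult_closed[OF h]] tlift_comult_right[OF assms comult_closed[OF h]]
      coassoc[OF h] h by (simp add: convolution_apply)
qed (simp_all add: convolution_def)

lemma
  assumes "k_algebra K M" "u \<in> alg_hom K H M"
  shows convolution_counit_left: "convolution K M H (counit_hom H M) u = u"
    and convolution_counit_right: "convolution K M H u (counit_hom H M) = u"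
proof -
  have "convolution K M H (counit_hom H M) u h = u h" "convolution K M H u (counit_hom H M) h = u h"
    if "h \<in> carrier H" for h
    using that hom_counit_left[OF k_algebra_H assms comult_closed[OF that]]
      hom_counit_right[OF k_algebra_H assms comult_closed[OF that]]
    by (simp_all add: convolution_apply counit_left_comult counit_right_comult)
  then show "convolution K M H (counit_hom H M) u = u" "convolution K M H u (counit_hom H M) = u"
    using alg_hom_extensional[OF assms(2)]
    by (auto intro!: extensionalityI[of _ "carrier H"] simp: convolution_def)
qed

end

section \<open>Twists under commuting homomorphisms\<close>

context pre_bialgebra
begin

lemma
  assumes "k_algebra K M" "u \<in> alg_hom K H M" "v \<in> alg_hom K H M" "w \<in> alg_hom K H M"
    "commuting H H M u v" "commuting H H M u w" "commuting H H M v w" "F \<in> carrier Sq.T"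
  shows tlift_cocycle_left: "tlift K M H Sq.T u (tlift K M H H v w)
      (tensor_assoc K H H H (pure_tensor K Sq.T H F \<one>\<^bsub>H\<^esub>
        \<otimes>\<^bsub>tensor_alg K Sq.T H\<^esub> tensor_map K Sq.T H (comult H) id F)) =
      tlift K M H H u v F \<otimes>\<^bsub>M\<^esub> tlift K M H H (convolution K M H u v) w F"
    and tlift_cocycle_right: "tlift K M H Sq.T u (tlift K M H H v w)
      (pure_tensor K H Sq.T \<one>\<^bsub>H\<^esub> F
        \<otimes>\<^bsub>tensor_alg K H Sq.T\<^esub> tensor_map K H Sq.T id (comult H) F) =
      tlift K M H H v w F \<otimes>\<^bsub>M\<^esub> tlift K M H H u (convolution K M H v w) F"
proof -
  note A = k_algebra_H Sq.k_algebra_T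
  interpret HH_H: algebra_pair K Sq.T H by (intro algebra_pairI A)
  interpret H_HH: algebra_pair K H Sq.T by (intro algebra_pairI A)
  note m1 = tensor_map_closed[OF A(1,1,2,1) comult_hom alg_hom_id[OF A(1)] assms(8)]
  note m2 = tensor_map_closed[OF A(1,1,1,2) alg_hom_id[OF A(1)] comult_hom assms(8)]
  interpret uv: commuting_homs K H H M u v by (intro commuting_homsI A assms)
  interpret vw: commuting_homs K H H M v w by (intro commuting_homsI A assms)
  interpret uv_w: commuting_homs K Sq.T H M "tlift K M H H u v" w
    by (intro commuting_homsI A assms uv.tlift_alg_hom commuting_tlift_left[OF A(1,1) assms(1-7)])
  interpret u_vw: commuting_homs K H Sq.T M u "tlift K M H H v w"
    by (intro commuting_homsI A assms vw.tlift_alg_hom commuting_tlift_right[OF A(1,1) assms(1,3,4,2,7,5,6)])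
  have cl: "HH_H.pt F \<one>\<^bsub>H\<^esub> \<otimes>\<^bsub>HH_H.T\<^esub> tensor_map K Sq.T H (comult H) id F \<in> carrier HH_H.T"
    using assms(8) m1 by (intro HH_H.T_mult_closed) auto
  show "tlift K M H Sq.T u (tlift K M H H v w)
      (tensor_assoc K H H H (HH_H.pt F \<one>\<^bsub>H\<^esub> \<otimes>\<^bsub>HH_H.T\<^esub> tensor_map K Sq.T H (comult H) id F)) =
      tlift K M H H u v F \<otimes>\<^bsub>M\<^esub> tlift K M H H (convolution K M H u v) w F"
    using m1 assms(8)
    by (simp add: tlift_tensor_assoc[OF A(1,1,1) cl assms(1-7)]
      tlift_comult_left[OF assms, unfolded tlift_tensor_assoc[OF A(1,1,1) m1 assms(1-7)]])
  show "tlift K M H Sq.T u (tlift K M H H v w)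
      (H_HH.pt \<one>\<^bsub>H\<^esub> F \<otimes>\<^bsub>H_HH.T\<^esub> tensor_map K H Sq.T id (comult H) F) =
      tlift K M H H v w F \<otimes>\<^bsub>M\<^esub> tlift K M H H u (convolution K M H v w) F"
    using m2 assms(8)
    by (simp add: tlift_comult_right[OF assms])
qed

lemma twist_Units: "twist K H F \<Longrightarrow> F \<in> Units Sq.T"
  by (simp add: twist_def Let_def)

lemma twist_closed: "twist K H F \<Longrightarrow> F \<in> carrier Sq.T"
  by (rule monoid.Units_closed[OF k_algebra_monoid[OF Sq.k_algebra_T] twist_Units])

lemma twist_cocycle:
  assumes "twist K H F" "k_algebra K M" "u \<in> alg_hom K H M" "v \<in> alg_hom K H M" "w \<in> alg_hom K H M"
    "commuting H H M u v" "commuting H H M u w" "commuting H H M v w"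
  shows "tlift K M H H u v F \<otimes>\<^bsub>M\<^esub> tlift K M H H (convolution K M H u v) w F =
    tlift K M H H v w F \<otimes>\<^bsub>M\<^esub> tlift K M H H u (convolution K M H v w) F"
  using tlift_cocycle_left[OF assms(2-8) twist_closed[OF assms(1)]]
    tlift_cocycle_right[OF assms(2-8) twist_closed[OF assms(1)]] assms(1)
  by (simp add: twist_def Let_def)

lemma
  assumes "twist K H F" "k_algebra K M" "u \<in> alg_hom K H M"
  shows twist_counit_left: "tlift K M H H (counit_hom H M) u F = \<one>\<^bsub>M\<^esub>"
    and twist_counit_right: "tlift K M H H u (counit_hom H M) F = \<one>\<^bsub>M\<^esub>"
  using hom_counit_left[OF k_algebra_H assms(2,3) twist_closed[OF assms(1)]]
    hom_counit_right[OF k_algebra_H assms(2,3) twist_closed[OF assms(1)]] assms(1)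
  by (simp_all add: twist_def Let_def alg_hom_one[OF assms(3)])

lemma twistI:
  fixes F
  defines "T1 \<equiv> tensor_alg K H Sq.T"
  assumes F: "F \<in> Units Sq.T"
    and cocycle: "\<And>u v w. u \<in> alg_hom K H T1 \<Longrightarrow> v \<in> alg_hom K H T1 \<Longrightarrow> w \<in> alg_hom K H T1 \<Longrightarrow>
      commuting H H T1 u v \<Longrightarrow> commuting H H T1 u w \<Longrightarrow> commuting H H T1 v w \<Longrightarrow>
      tlift K T1 H H u v F \<otimes>\<^bsub>T1\<^esub> tlift K T1 H H (convolution K T1 H u v) w F =
      tlift K T1 H H v w F \<otimes>\<^bsub>T1\<^esub> tlift K T1 H H u (convolution K T1 H v w) F"
    and unit: "\<And>u. u \<in> alg_hom K H H \<Longrightarrow> tlift K H H H (counit_hom H H) u F = \<one>\<^bsub>H\<^esub>"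
      "\<And>u. u \<in> alg_hom K H H \<Longrightarrow> tlift K H H H u (counit_hom H H) F = \<one>\<^bsub>H\<^esub>"
  shows "twist K H F"
proof -
  note A = k_algebra_H Sq.k_algebra_T
  interpret HH_H: algebra_pair K Sq.T H by (intro algebra_pairI A)
  interpret H_HH: algebra_pair K H Sq.T by (intro algebra_pairI A)
  have T1: "k_algebra K T1" unfolding T1_def by (intro k_algebra_tensor A)
  have Fc: "F \<in> carrier Sq.T" by (rule monoid.Units_closed[OF k_algebra_monoid[OF A(2)] F])
  note m = tensor_map_closed[OF A(1,1,2,1) comult_hom alg_hom_id[OF A(1)] Fc]
    tensor_map_closed[OF A(1,1,1,2) alg_hom_id[OF A(1)] comult_hom Fc]
  have cl: "HH_H.pt F \<one>\<^bsub>H\<^esub> \<otimes>\<^bsub>HH_H.T\<^esub> tensor_map K Sq.T H (comult H) id F \<in> carrier HH_H.T"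
    "H_HH.pt \<one>\<^bsub>H\<^esub> F \<otimes>\<^bsub>H_HH.T\<^esub> tensor_map K H Sq.T id (comult H) F \<in> carrier H_HH.T"
    using Fc m by (intro HH_H.T_mult_closed H_HH.T_mult_closed; auto)+
  have "tensor_assoc K H H H (HH_H.pt F \<one>\<^bsub>H\<^esub> \<otimes>\<^bsub>HH_H.T\<^esub> tensor_map K Sq.T H (comult H) id F) =
    H_HH.pt \<one>\<^bsub>H\<^esub> F \<otimes>\<^bsub>T1\<^esub> tensor_map K H Sq.T id (comult H) F"
  proof (rule tensor3_eqI[OF A(1,1,1) tensor_assoc_closed[OF A(1,1,1) cl(1)] cl(2), folded T1_def])
    fix u v w assume *: "u \<in> alg_hom K H T1" "v \<in> alg_hom K H T1" "w \<in> alg_hom K H T1"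
      "commuting H H T1 u v" "commuting H H T1 u w" "commuting H H T1 v w"
    show "tlift K T1 H Sq.T u (tlift K T1 H H v w)
        (tensor_assoc K H H H (HH_H.pt F \<one>\<^bsub>H\<^esub> \<otimes>\<^bsub>HH_H.T\<^esub> tensor_map K Sq.T H (comult H) id F)) =
      tlift K T1 H Sq.T u (tlift K T1 H H v w)
        (H_HH.pt \<one>\<^bsub>H\<^esub> F \<otimes>\<^bsub>T1\<^esub> tensor_map K H Sq.T id (comult H) F)"
      by (simp add: tlift_cocycle_left[OF T1 * Fc] cocycle[OF *]
        tlift_cocycle_right[OF T1 * Fc, folded T1_def])
  qed
  moreover have "counit_left H H F = \<one>\<^bsub>H\<^esub>" "counit_right H H F = \<one>\<^bsub>H\<^esub>"
    using hom_counit_left[OF A(1,1) alg_hom_id[OF A(1)] Fc] hom_counit_right[OF A(1,1) alg_hom_id[OF A(1)] Fc]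
      unit[OF alg_hom_id[OF A(1)]] by simp_all
  ultimately show ?thesis using F by (simp add: twist_def Let_def T1_def)
qed

lemma tlift_gauge:
  assumes "k_algebra K M" "u \<in> alg_hom K H M" "v \<in> alg_hom K H M" "commuting H H M u v"
    "h \<in> Units H" "F \<in> carrier Sq.T"
  shows "tlift K M H H u v (gauge K H h F) =
      u h \<otimes>\<^bsub>M\<^esub> v h \<otimes>\<^bsub>M\<^esub> tlift K M H H u v F \<otimes>\<^bsub>M\<^esub> convolution K M H u v (inv\<^bsub>H\<^esub> h)"
proof -
  interpret uv: commuting_homs K H H M u v by (intro commuting_homsI k_algebra_H assms)
  have "h \<in> carrier H" "inv\<^bsub>H\<^esub> h \<in> carrier H" using assms(5) by auto
  then show ?thesis using assms(6)
    by (simp add: gauge_def convolution_apply Sq.T_mult_closed)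
qed

end

context bialgebra
begin

text \<open>Twisting a twist by an invertible \<open>h\<close> with \<open>\<epsilon> h = 1\<close> gives a twist again; the
  normalisation of \<open>h\<close> is needed for the counit conditions.\<close>

lemma twist_gauge:
  assumes F: "twist K H F" and h: "h \<in> Units H" and eps: "counit H h = \<one>\<^bsub>K\<^esub>"
  shows "twist K H (gauge K H h F)"
proof (rule twistI)
  note A = k_algebra_H Sq.k_algebra_T
  have hc [simp]: "h \<in> carrier H" "inv\<^bsub>H\<^esub> h \<in> carrier H" using h by auto
  note Fc = twist_closed[OF F]
  show "gauge K H h F \<in> Units Sq.T"
  proof -
    have "comult H (inv\<^bsub>H\<^esub> h) \<in> Units Sq.T"
      using alg_hom_Units[OF comult_hom A, of "inv\<^bsub>H\<^esub> h"] h by simp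
    moreover have "Sq.pt h h \<in> Units Sq.T"
    proof -
      have "Sq.pt h h \<otimes>\<^bsub>Sq.T\<^esub> Sq.pt (inv\<^bsub>H\<^esub> h) (inv\<^bsub>H\<^esub> h) = \<one>\<^bsub>Sq.T\<^esub>"
        "Sq.pt (inv\<^bsub>H\<^esub> h) (inv\<^bsub>H\<^esub> h) \<otimes>\<^bsub>Sq.T\<^esub> Sq.pt h h = \<one>\<^bsub>Sq.T\<^esub>"
        using h by (simp_all add: Sq.pure_mult Sq.one_T monoid.Units_r_inv[OF k_algebra_monoid[OF A(1)]] monoid.Units_l_inv[OF k_algebra_monoid[OF A(1)]])
      then show ?thesis unfolding Units_def by auto
    qed
    ultimately show ?thesis
      unfolding gauge_def using twist_Units[OF F]
      by (intro monoid.Units_m_closed[OF k_algebra_monoid[OF A(2)]])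
  qed
  show "tlift K H H H (counit_hom H H) u (gauge K H h F) = \<one>\<^bsub>H\<^esub>"
    "tlift K H H H u (counit_hom H H) (gauge K H h F) = \<one>\<^bsub>H\<^esub>" if u: "u \<in> alg_hom K H H" for u
  proof -
    have 1: "counit_hom H H h = \<one>\<^bsub>H\<^esub>" by (simp add: counit_hom_def eps smult_one)
    have 2: "u h \<in> carrier H" "u h \<otimes>\<^bsub>H\<^esub> u (inv\<^bsub>H\<^esub> h) = \<one>\<^bsub>H\<^esub>"
      using h u by (simp_all add: alg_hom_closed alg_hom_mult[OF u, symmetric] monoid.Units_r_inv[OF k_algebra_monoid[OF A(1)]] alg_hom_one)
    note c = counit_hom_alg_hom[OF A(1)] commuting_counit_left[OF A(1) u] commuting_counit_right[OF A(1) u]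
    show "tlift K H H H (counit_hom H H) u (gauge K H h F) = \<one>\<^bsub>H\<^esub>"
      using 2 by (simp add: tlift_gauge[OF A(1) c(1) u c(2) h Fc] 1 twist_counit_left[OF F A(1) u]
        convolution_counit_left[OF A(1) u])
    show "tlift K H H H u (counit_hom H H) (gauge K H h F) = \<one>\<^bsub>H\<^esub>"
      using 2 by (simp add: tlift_gauge[OF A(1) u c(1) c(3) h Fc] 1 twist_counit_right[OF F A(1) u]
        convolution_counit_right[OF A(1) u])
  qed
  let ?M = "tensor_alg K H Sq.T"
  have M: "k_algebra K ?M" by (intro k_algebra_tensor A)
  interpret M: k_algebra K ?M by (rule M)
  fix u v w assume *: "u \<in> alg_hom K H ?M" "v \<in> alg_hom K H ?M" "w \<in> alg_hom K H ?M"
      "commuting H H ?M u v" "commuting H H ?M u w" "commuting H H ?M v w"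
  note uv = convolution_alg_hom[OF M *(1,2,4)] and vw = convolution_alg_hom[OF M *(2,3,6)]
  note uv_w = commuting_convolution_left[OF M *(1-6)]
    and u_vw = commuting_convolution_right[OF M *(2,3,1,6,4,5)]
  have uvw: "convolution K ?M H u (convolution K ?M H v w) \<in> alg_hom K H ?M"
    by (rule convolution_alg_hom[OF M *(1) vw u_vw])
  interpret uv: commuting_homs K H H ?M u v by (intro commuting_homsI A M *)
  interpret vw: commuting_homs K H H ?M v w by (intro commuting_homsI A M *)
  interpret uv_w: commuting_homs K H H ?M "convolution K ?M H u v" w by (intro commuting_homsI A M * uv uv_w)
  interpret u_vw: commuting_homs K H H ?M u "convolution K ?M H v w" by (intro commuting_homsI A M * vw u_vw)
  let ?m = "\<lambda>x y. x \<otimes>\<^bsub>?M\<^esub> y"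
  let ?uv = "convolution K ?M H u v" and ?vw = "convolution K ?M H v w"
  define Fuv where "Fuv = tlift K ?M H H u v F"
  define Fvw where "Fvw = tlift K ?M H H v w F"
  define G1 where "G1 = tlift K ?M H H ?uv w F"
  define G2 where "G2 = tlift K ?M H H u ?vw F"
  define e where "e = convolution K ?M H u ?vw (inv\<^bsub>H\<^esub> h)"
  have cl [simp]: "Fuv \<in> carrier ?M" "Fvw \<in> carrier ?M" "G1 \<in> carrier ?M" "G2 \<in> carrier ?M" "e \<in> carrier ?M"
    using Fc alg_hom_closed[OF uvw] by (simp_all add: Fuv_def Fvw_def G1_def G2_def e_def)
  have inv: "?m (?uv (inv\<^bsub>H\<^esub> h)) (?uv h) = \<one>\<^bsub>?M\<^esub>" "?m (?vw (inv\<^bsub>H\<^esub> h)) (?vw h) = \<one>\<^bsub>?M\<^esub>"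
    using h by (simp_all add: alg_hom_mult[OF uv, symmetric] alg_hom_mult[OF vw, symmetric]
      monoid.Units_l_inv[OF k_algebra_monoid[OF A(1)]] alg_hom_one[OF uv] alg_hom_one[OF vw])
  have cw: "?m Fuv (w h) = ?m (w h) Fuv" unfolding Fuv_def
    by (rule uv.tlift_centralizes[OF Fc]) (simp_all add: commuting_D[OF *(5)] commuting_D[OF *(6)])
  have cu: "?m Fvw (u h) = ?m (u h) Fvw" unfolding Fvw_def
    by (rule vw.tlift_centralizes[OF Fc])
      (simp_all add: commuting_D[OF *(4), symmetric] commuting_D[OF *(5), symmetric])
  have cuvw: "?m (?m (v h) (w h)) (u h) = ?m (u h) (?m (v h) (w h))"
  proof -
    have "?m (v h) (?m (w h) (u h)) = ?m (v h) (?m (u h) (w h))"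
      using commuting_D[OF *(5), of h h] by simp
    also have "\<dots> = ?m (?m (u h) (v h)) (w h)"
      using commuting_D[OF *(4), of h h] by (simp add: M.m_assoc[symmetric])
    finally show ?thesis by (simp add: M.m_assoc)
  qed
  have "?m (tlift K ?M H H u v (gauge K H h F)) (tlift K ?M H H ?uv w (gauge K H h F)) =
      ?m (?m (?m (?m (u h) (v h)) Fuv) (?uv (inv\<^bsub>H\<^esub> h))) (?m (?m (?m (?uv h) (w h)) G1) e)"
    by (simp add: tlift_gauge[OF M *(1,2,4) h Fc] tlift_gauge[OF M uv *(3) uv_w h Fc]
      Fuv_def G1_def e_def convolution_assoc[OF M *])
  also have "\<dots> = ?m (?m (?m (u h) (v h)) Fuv) (?m (?m (?uv (inv\<^bsub>H\<^esub> h)) (?uv h)) (?m (w h) (?m G1 e)))"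
    by (simp add: M.m_assoc)
  also have "\<dots> = ?m (?m (u h) (v h)) (?m (?m Fuv (w h)) (?m G1 e))"
    unfolding inv by (simp add: M.m_assoc)
  also have "\<dots> = ?m (?m (u h) (?m (v h) (w h))) (?m (?m Fuv G1) e)"
    unfolding cw by (simp add: M.m_assoc)
  also have "?m Fuv G1 = ?m Fvw G2"
    unfolding Fuv_def G1_def Fvw_def G2_def by (rule twist_cocycle[OF F M *])
  also have "?m (?m (u h) (?m (v h) (w h))) (?m (?m Fvw G2) e) =
    ?m (?m (v h) (w h)) (?m (?m Fvw (u h)) (?m G2 e))"
    unfolding cuvw[symmetric] cu by (simp add: M.m_assoc)
  also have "\<dots> = ?m (?m (?m (v h) (w h)) Fvw) (?m (?m (?vw (inv\<^bsub>H\<^esub> h)) (?vw h)) (?m (u h) (?m G2 e)))"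
    unfolding inv by (simp add: M.m_assoc)
  also have "\<dots> = ?m (?m (?m (?m (v h) (w h)) Fvw) (?vw (inv\<^bsub>H\<^esub> h))) (?m (?m (?m (u h) (?vw h)) G2) e)"
    by (simp add: M.m_assoc commuting_D[OF u_vw])
  also have "\<dots> = ?m (tlift K ?M H H v w (gauge K H h F)) (tlift K ?M H H u ?vw (gauge K H h F))"
    by (simp add: tlift_gauge[OF M *(2,3,6) h Fc] tlift_gauge[OF M *(1) vw u_vw h Fc]
      Fvw_def G2_def e_def)
  finally show "?m (tlift K ?M H H u v (gauge K H h F)) (tlift K ?M H H ?uv w (gauge K H h F)) =
    ?m (tlift K ?M H H v w (gauge K H h F)) (tlift K ?M H H u ?vw (gauge K H h F))" .
qed

end

section \<open>The tensor product of two bialgebras\<close>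

lemma tensor_rel_mono_fields:
  assumes "(xs, ys) \<in> tensor_rel K A B"
    and "carrier A' = carrier A" "\<zero>\<^bsub>A'\<^esub> = \<zero>\<^bsub>A\<^esub>" "add A' = add A" "smult A' = smult A"
    and "carrier B' = carrier B" "add B' = add B" "smult B' = smult B"
  shows "(xs, ys) \<in> tensor_rel K A' B'"
  using assms(1)
proof (induction rule: tensor_rel.induct)
  case (zero b)
  then show ?case using tensor_rel.zero[of b B' A' K] assms by simp
next
  case (add_left a a' b)
  then show ?case using tensor_rel.add_left[of a A' a' b B' K] assms by simp
next
  case (add_right a b b')
  then show ?case using tensor_rel.add_right[of a A' b B' b' K] assms by simp
next
  case (smult r a b)
  then show ?case using tensor_rel.smult[of r K a A' b B'] assms by simp
next
  case (commute xs ys)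
  then show ?case using tensor_rel.commute[of xs A' B' ys K] assms by simp
qed (use assms in \<open>auto intro: tensor_rel.refl tensor_rel.sym tensor_rel.trans tensor_rel.append
    tensor_rel.commute\<close>)

lemma module_truncate_simps:
  "carrier (module.truncate A) = carrier A" "mult (module.truncate A) = mult A"
  "one (module.truncate A) = one A" "zero (module.truncate A) = zero A"
  "add (module.truncate A) = add A" "smult (module.truncate A) = smult A"
  by (simp_all add: module.defs)

text \<open>Tensor products see only the algebra fields of a record, which \<open>module.truncate\<close> extracts.\<close>

lemma
  shows pure_tensor_truncate: "pure_tensor K (module.truncate A) (module.truncate B) = pure_tensor K A B"
    and tensor_alg_truncate: "tensor_alg K (module.truncate A) (module.truncate B) = tensor_alg K A B"
proof -
  have rel: "tensor_rel K (module.truncate A) (module.truncate B) = tensor_rel K A B"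
    using tensor_rel_mono_fields[of _ _ K A B "module.truncate A" "module.truncate B"]
      tensor_rel_mono_fields[of _ _ K "module.truncate A" "module.truncate B" A B]
    by (auto simp: module_truncate_simps)
  have cls: "tensor_class K (module.truncate A) (module.truncate B) = tensor_class K A B"
    by (intro ext) (simp add: tensor_class_def rel)
  show pure: "pure_tensor K (module.truncate A) (module.truncate B) = pure_tensor K A B"
    by (intro ext) (simp add: pure_tensor_def cls)
  show "tensor_alg K (module.truncate A) (module.truncate B) = tensor_alg K A B"
    by (simp add: tensor_alg_def module_truncate_simps rel cls pure)
qed

lemma truncate_tensor_bialg: "module.truncate (tensor_bialg K A B) = module.truncate (tensor_alg K A B)"
  by (simp add: tensor_bialg_def module.defs)

lemma truncate_twisted_bialg: "module.truncate (twisted_bialg K A F) = module.truncate A"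
  by (simp add: twisted_bialg_def module.defs)

lemma
  assumes "module.truncate A = module.truncate A'" "module.truncate B = module.truncate B'"
  shows tensor_alg_cong: "tensor_alg K A B = tensor_alg K A' B'"
    and pure_tensor_cong: "pure_tensor K A B = pure_tensor K A' B'"
  using tensor_alg_truncate[of K A B] tensor_alg_truncate[of K A' B']
    pure_tensor_truncate[of K A B] pure_tensor_truncate[of K A' B'] assms by simp_all

lemma tensor_bialg_simps [simp]:
  "carrier (tensor_bialg K A B) = carrier (tensor_alg K A B)"
  "mult (tensor_bialg K A B) = mult (tensor_alg K A B)"
  "one (tensor_bialg K A B) = one (tensor_alg K A B)"
  "zero (tensor_bialg K A B) = zero (tensor_alg K A B)"
  "add (tensor_bialg K A B) = add (tensor_alg K A B)"
  "smult (tensor_bialg K A B) = smult (tensor_alg K A B)"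
  "comult (tensor_bialg K A B) X = tensor_middle_flip K A A B B
      (tensor_map K (tensor_alg K A A) (tensor_alg K B B) (comult A) (comult B) X)"
  "counit (tensor_bialg K A B) = tensor_lift K (\<lambda>a b. counit A a \<otimes>\<^bsub>K\<^esub> counit B b)"
  by (simp_all add: tensor_bialg_def module.defs bialgebra.defs)

lemma tensor_alg_tensor_bialg:
  "tensor_alg K (tensor_bialg K A B) (tensor_bialg K A B) = tensor_alg K (tensor_alg K A B) (tensor_alg K A B)"
  by (rule tensor_alg_cong) (rule truncate_tensor_bialg)+

lemma Units_tensor_bialg: "Units (tensor_bialg K A B) = Units (tensor_alg K A B)"
  and inv_tensor_bialg: "inv\<^bsub>tensor_bialg K A B\<^esub> X = inv\<^bsub>tensor_alg K A B\<^esub> X"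
  by (simp_all add: Units_def m_inv_def)

lemma alg_hom_tensor_bialg: "alg_hom K (tensor_bialg K A B) M = alg_hom K (tensor_alg K A B) M"
  by (simp_all add: alg_hom_def ring_hom_def)

lemma commuting_tensor_bialg:
  "commuting (tensor_bialg K A B) C M f g = commuting (tensor_alg K A B) C M f g"
  "commuting C (tensor_bialg K A B) M g f = commuting C (tensor_alg K A B) M g f"
  by (simp_all add: commuting_def)

lemma k_algebra_cong:
  assumes "k_algebra K A" "module.truncate A = module.truncate A'"
  shows "k_algebra K A'"
proof -
  interpret A: k_algebra K A by fact
  have [simp]: "carrier A' = carrier A" "mult A' = mult A" "one A' = one A" "zero A' = zero A"
    "add A' = add A" "smult A' = smult A"
    using module_truncate_simps[of A] module_truncate_simps[of A'] assms(2) by simp_all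
  have ag: "abelian_group A'"
    by (rule abelian_groupI) (auto simp: A.a_ac intro: A.l_neg)
  then have "module K A'"
    by (intro moduleI module.axioms(1)[OF A.module_axioms])
      (auto simp: A.smult_l_distr A.smult_r_distr A.smult_assoc1)
  moreover have "ring A'"
    by (intro ringI ag monoidI) (auto simp: A.m_assoc A.l_distr A.r_distr)
  ultimately show ?thesis
    using A.field_axioms A.smult_mult_left A.smult_mult_right
    by (auto simp: k_algebra_def k_algebra_axioms_def)
qed

text \<open>The ground field as an algebra over itself.\<close>

definition ground_alg :: "('k, 'm) ring_scheme \<Rightarrow> ('k, 'k) module"
  where "ground_alg K = \<lparr>carrier = carrier K, mult = mult K, one = one K, zero = zero K, add = add K,
    smult = mult K\<rparr>"

lemma ground_alg_simps [simp]:
  "carrier (ground_alg K) = carrier K" "mult (ground_alg K) = mult K" "one (ground_alg K) = one K"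
  "zero (ground_alg K) = zero K" "add (ground_alg K) = add K" "smult (ground_alg K) = mult K"
  by (simp_all add: ground_alg_def)

lemma (in field) k_algebra_ground_alg: "k_algebra R (ground_alg R)"
proof -
  have ag: "abelian_group (ground_alg R)"
    by (rule abelian_groupI) (auto simp: a_ac intro: l_neg)
  then have "module R (ground_alg R)"
    by (intro moduleI is_cring) (auto simp: l_distr r_distr m_assoc)
  moreover have "ring (ground_alg R)"
    by (intro ringI ag monoidI) (auto simp: m_assoc l_distr r_distr)
  ultimately show ?thesis
    by (auto simp: k_algebra_def k_algebra_axioms_def field_axioms m_ac)
qed

locale bialgebra_pair = H1: bialgebra K H1 + H2: bialgebra K H2
  for K :: "('k, 'm) ring_scheme" and H1 :: "('k, 'a, 'p) bialgebra_scheme"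
    and H2 :: "('k, 'b, 'q) bialgebra_scheme"
begin

abbreviation "HH \<equiv> tensor_bialg K H1 H2"
abbreviation "H12 \<equiv> tensor_alg K H1 H2"

lemmas alg = H1.k_algebra_H H2.k_algebra_H

sublocale H12: algebra_pair K H1 H2 by (intro algebra_pairI alg)

lemma k_algebra_HH: "k_algebra K HH"
  by (rule k_algebra_cong[OF H12.k_algebra_T truncate_tensor_bialg[symmetric]])

lemma tlift_HH: "tlift K M HH HH u v = tlift K M H12 H12 u v"
  by (simp add: tlift_def tensor_alg_tensor_bialg)

lemma
  assumes "X \<in> carrier H12"
  shows comult_HH_closed: "comult HH X \<in> carrier (tensor_alg K H12 H12)"
    and tlift_comult_HH: "k_algebra K M \<Longrightarrow> a \<in> alg_hom K H1 M \<Longrightarrow> b \<in> alg_hom K H1 M \<Longrightarrow>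
      c \<in> alg_hom K H2 M \<Longrightarrow> d \<in> alg_hom K H2 M \<Longrightarrow>
      commuting H1 H1 M a b \<Longrightarrow> commuting H2 H2 M c d \<Longrightarrow> commuting H1 H2 M a c \<Longrightarrow>
      commuting H1 H2 M a d \<Longrightarrow> commuting H1 H2 M b c \<Longrightarrow> commuting H1 H2 M b d \<Longrightarrow>
      tlift K M H12 H12 (tlift K M H1 H2 a c) (tlift K M H1 H2 b d) (comult HH X) =
      tlift K M H1 H2 (convolution K M H1 a b) (convolution K M H2 c d) X"
proof -
  note T = H1.Sq.k_algebra_T H2.Sq.k_algebra_T
  note m = tensor_map_closed[OF alg T H1.comult_hom H2.comult_hom assms]
  show "comult HH X \<in> carrier (tensor_alg K H12 H12)"
    unfolding tensor_bialg_simps by (rule tensor_middle_flip_closed[OF alg(1,1,2,2) m])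
  assume *: "k_algebra K M" "a \<in> alg_hom K H1 M" "b \<in> alg_hom K H1 M"
      "c \<in> alg_hom K H2 M" "d \<in> alg_hom K H2 M"
      "commuting H1 H1 M a b" "commuting H2 H2 M c d" "commuting H1 H2 M a c"
      "commuting H1 H2 M a d" "commuting H1 H2 M b c" "commuting H1 H2 M b d"
  have ab: "tlift K M H1 H1 a b \<in> alg_hom K (tensor_alg K H1 H1) M"
    by (rule tlift_alg_hom) (use alg * in auto)
  have cd: "tlift K M H2 H2 c d \<in> alg_hom K (tensor_alg K H2 H2) M"
    by (rule tlift_alg_hom) (use alg * in auto)
  have c: "commuting (tensor_alg K H1 H1) (tensor_alg K H2 H2) M (tlift K M H1 H1 a b) (tlift K M H2 H2 c d)"
    by (intro commuting_tlift_left[OF alg(1,1)] commuting_tlift_right[OF alg(2,2)] * cd)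
  show "tlift K M H12 H12 (tlift K M H1 H2 a c) (tlift K M H1 H2 b d) (comult HH X) =
      tlift K M H1 H2 (convolution K M H1 a b) (convolution K M H2 c d) X"
    unfolding tensor_bialg_simps convolution_def
    by (simp add: tlift_tensor_middle_flip[OF alg(1,1,2,2) m *(1,2,3,4,5,6,8,9,10,11,7)]
      tlift_tensor_map[OF alg T H1.comult_hom H2.comult_hom assms *(1) ab cd c])
qed

text \<open>In bracket notation, \<open>[a, c] * [b, d] = [a * b, c * d]\<close>.\<close>

lemma convolution_HH:
  assumes "k_algebra K M" "a \<in> alg_hom K H1 M" "b \<in> alg_hom K H1 M"
      "c \<in> alg_hom K H2 M" "d \<in> alg_hom K H2 M"
      "commuting H1 H1 M a b" "commuting H2 H2 M c d" "commuting H1 H2 M a c"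
      "commuting H1 H2 M a d" "commuting H1 H2 M b c" "commuting H1 H2 M b d"
  shows "convolution K M HH (tlift K M H1 H2 a c) (tlift K M H1 H2 b d) =
    tlift K M H1 H2 (convolution K M H1 a b) (convolution K M H2 c d)"
  by (rule extensionalityI[of _ "carrier H12"])
    (simp_all add: convolution_def[of _ _ HH] compose_def tlift_HH tlift_comult_HH[OF _ assms]
      tlift_extensional del: tensor_bialg_simps(7))

lemma counit_HH_alg_hom: "restrict (counit HH) (carrier H12) \<in> alg_hom K H12 (ground_alg K)"
proof -
  note G = H1.k_algebra_ground_alg
  have eps: "counit_hom H1 (ground_alg K) a = counit H1 a" if "a \<in> carrier H1" for a
    using that by (simp add: counit_hom_def)
  have eps': "counit_hom H2 (ground_alg K) b = counit H2 b" if "b \<in> carrier H2" for b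
    using that by (simp add: counit_hom_def)
  have "restrict (counit HH) (carrier H12) = tlift K (ground_alg K) H1 H2
    (counit_hom H1 (ground_alg K)) (counit_hom H2 (ground_alg K))"
    unfolding tlift_def
  proof (rule restrict_ext)
    fix X assume X: "X \<in> carrier H12"
    have "counit HH X = tensor_lift (ground_alg K) (\<lambda>a b. counit H1 a \<otimes>\<^bsub>K\<^esub> counit H2 b) X"
      by (simp add: tensor_lift_def)
    also have "\<dots> = tensor_lift (ground_alg K) (\<lambda>a b. counit_hom H1 (ground_alg K) a
        \<otimes>\<^bsub>ground_alg K\<^esub> counit_hom H2 (ground_alg K) b) X"
      by (rule H12.tensor_lift_cong[OF X]) (simp add: eps eps')
    finally show "counit HH X = \<dots>" .
  qed
  also have "\<dots> \<in> alg_hom K H12 (ground_alg K)"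
    by (intro tlift_alg_hom alg G H1.counit_hom_alg_hom H2.counit_hom_alg_hom H1.commuting_counit_left)
  finally show ?thesis .
qed

lemma pre_bialgebra_HH: "pre_bialgebra K HH"
proof (intro pre_bialgebra.intro pre_bialgebra_axioms.intro k_algebra_HH)
  interpret D: algebra_pair K H12 H12 by (intro algebra_pairI H12.k_algebra_T)
  interpret DD: k_algebra K D.T by (rule D.k_algebra_T)
  interpret C: k_algebra K H12 by (rule H12.k_algebra_T)
  let ?\<Delta> = "comult HH"
  have cl [simp]: "?\<Delta> X \<in> carrier D.T" if "X \<in> carrier H12" for X
    by (rule comult_HH_closed[OF that])
  \<comment> \<open>Under the homomorphisms that test equality in \<open>(H1 \<otimes> H2) \<otimes> (H1 \<otimes> H2)\<close>, \<open>\<Delta>\<close> becomes a homomorphism.\<close>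
  have eqI: "X = Y" if "X \<in> carrier D.T" "Y \<in> carrier D.T"
    and "\<And>\<phi> \<psi>. \<phi> \<in> alg_hom K D.T D.T \<Longrightarrow> \<psi> \<in> alg_hom K H12 D.T \<Longrightarrow>
      (\<And>Z. Z \<in> carrier H12 \<Longrightarrow> \<phi> (?\<Delta> Z) = \<psi> Z) \<Longrightarrow> \<phi> X = \<phi> Y" for X Y
  proof (rule tensor4_eqI[OF alg alg that(1,2)])
    fix a c b d assume *: "a \<in> alg_hom K H1 D.T" "c \<in> alg_hom K H2 D.T" "b \<in> alg_hom K H1 D.T"
      "d \<in> alg_hom K H2 D.T" "commuting H1 H2 D.T a c" "commuting H1 H1 D.T a b" "commuting H1 H2 D.T a d"
      "commuting H2 H1 D.T c b" "commuting H2 H2 D.T c d" "commuting H1 H2 D.T b d"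
    note bc = commuting_sym[OF *(8)]
    show "tlift K D.T H12 H12 (tlift K D.T H1 H2 a c) (tlift K D.T H1 H2 b d) X =
      tlift K D.T H12 H12 (tlift K D.T H1 H2 a c) (tlift K D.T H1 H2 b d) Y"
    proof (rule that(3)[of _ "tlift K D.T H1 H2 (convolution K D.T H1 a b) (convolution K D.T H2 c d)"])
      show "tlift K D.T H12 H12 (tlift K D.T H1 H2 a c) (tlift K D.T H1 H2 b d) \<in> alg_hom K D.T D.T"
        by (intro tlift_alg_hom H12.k_algebra_T D.k_algebra_T alg * commuting_tlift_left[OF alg D.k_algebra_T]
          commuting_tlift_right[OF alg D.k_algebra_T])
      show "tlift K D.T H1 H2 (convolution K D.T H1 a b) (convolution K D.T H2 c d) \<in> alg_hom K H12 D.T"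
        by (intro tlift_alg_hom D.k_algebra_T alg H1.convolution_alg_hom H2.convolution_alg_hom *
          H1.commuting_convolution_left[OF D.k_algebra_T] H2.commuting_convolution_right[OF D.k_algebra_T] bc)
      show "tlift K D.T H12 H12 (tlift K D.T H1 H2 a c) (tlift K D.T H1 H2 b d) (?\<Delta> Z) =
         tlift K D.T H1 H2 (convolution K D.T H1 a b) (convolution K D.T H2 c d) Z" if "Z \<in> carrier H12" for Z
        by (rule tlift_comult_HH[OF that D.k_algebra_T *(1,3,2,4,6,9,5,7) bc *(10)])
    qed
  qed
  show "restrict (comult HH) (carrier HH) \<in> alg_hom K HH (tensor_alg K HH HH)"
    unfolding tensor_alg_tensor_bialg alg_hom_tensor_bialg tensor_bialg_simps(1)
  proof (rule alg_homI)
    note hom [simp] = alg_hom_mult[of _ K D.T D.T] alg_hom_mult[of _ K H12 D.T]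
      alg_hom_add[of _ K D.T D.T] alg_hom_add[of _ K H12 D.T]
      alg_hom_one[of _ K D.T D.T] alg_hom_one[of _ K H12 D.T]
      alg_hom_smult[of _ K D.T D.T] alg_hom_smult[of _ K H12 D.T]
    note [simp del] = tensor_bialg_simps
    show "restrict ?\<Delta> (carrier H12) X \<in> carrier D.T" if "X \<in> carrier H12" for X
      using that by simp
    show "restrict ?\<Delta> (carrier H12) (X \<otimes>\<^bsub>H12\<^esub> Y) =
      restrict ?\<Delta> (carrier H12) X \<otimes>\<^bsub>D.T\<^esub> restrict ?\<Delta> (carrier H12) Y"
      if "X \<in> carrier H12" "Y \<in> carrier H12" for X Y
      by (rule eqI) (use that in simp_all)
    show "restrict ?\<Delta> (carrier H12) (X \<oplus>\<^bsub>H12\<^esub> Y) =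
      restrict ?\<Delta> (carrier H12) X \<oplus>\<^bsub>D.T\<^esub> restrict ?\<Delta> (carrier H12) Y"
      if "X \<in> carrier H12" "Y \<in> carrier H12" for X Y
      by (rule eqI) (use that in simp_all)
    show "restrict ?\<Delta> (carrier H12) \<one>\<^bsub>H12\<^esub> = \<one>\<^bsub>D.T\<^esub>"
      by (rule eqI) simp_all
    show "restrict ?\<Delta> (carrier H12) (r \<odot>\<^bsub>H12\<^esub> X) = r \<odot>\<^bsub>D.T\<^esub> restrict ?\<Delta> (carrier H12) X"
      if "r \<in> carrier K" "X \<in> carrier H12" for r X
      by (rule eqI) (use that in simp_all)
  qed simp
  note e = counit_HH_alg_hom[THEN alg_hom_closed] counit_HH_alg_hom[THEN alg_hom_mult]
    counit_HH_alg_hom[THEN alg_hom_add] counit_HH_alg_hom[THEN alg_hom_one]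
    counit_HH_alg_hom[THEN alg_hom_smult]
  show "counit HH \<in> ring_hom HH K"
    using e(1-4) by (intro ring_hom_memI) (simp_all del: tensor_bialg_simps(8))
  show "counit HH (r \<odot>\<^bsub>HH\<^esub> X) = r \<otimes>\<^bsub>K\<^esub> counit HH X" if "r \<in> carrier K" "X \<in> carrier HH" for r X
    using e(5)[of r X] that by (simp del: tensor_bialg_simps(8))
qed

lemma counit_hom_HH:
  assumes "k_algebra K M"
  shows "counit_hom HH M = tlift K M H1 H2 (counit_hom H1 M) (counit_hom H2 M)"
proof -
  interpret M: k_algebra K M by fact
  interpret P: pre_bialgebra K HH by (rule pre_bialgebra_HH)
  note h = H1.counit_hom_alg_hom[OF assms] H2.counit_hom_alg_hom[OF assms]
    H1.commuting_counit_left[OF assms H2.counit_hom_alg_hom[OF assms]]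
  have bal: "balanced K H1 H2 K (\<lambda>a b. counit H1 a \<otimes>\<^bsub>K\<^esub> counit H2 b)"
    using commuting_homs.balanced_hom[OF commuting_homsI[OF alg H1.k_algebra_ground_alg
      H1.counit_hom_alg_hom[OF H1.k_algebra_ground_alg] H2.counit_hom_alg_hom[OF H1.k_algebra_ground_alg]
      H1.commuting_counit_left[OF H1.k_algebra_ground_alg H2.counit_hom_alg_hom[OF H1.k_algebra_ground_alg]]]]
    by (simp add: balanced_def counit_hom_def module.smult_closed[OF H1.module_axioms] module.smult_closed[OF H2.module_axioms])
  have "abelian_monoid K"
    by (rule abelian_group.axioms(1)[OF ring.is_abelian_group[OF H1.Sq.ring_K]])
  then have pure: "counit HH (H12.pt a b) = counit H1 a \<otimes>\<^bsub>K\<^esub> counit H2 b"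
    if "a \<in> carrier H1" "b \<in> carrier H2" for a b
    using that bal by (simp add: H12.tensor_lift_pure)
  show ?thesis
  proof (rule alg_hom_tensor_ext[OF alg assms])
    show "counit_hom HH M \<in> alg_hom K H12 M"
      using P.counit_hom_alg_hom[OF assms] by (simp add: alg_hom_tensor_bialg)
    show "tlift K M H1 H2 (counit_hom H1 M) (counit_hom H2 M) \<in> alg_hom K H12 M"
      by (rule tlift_alg_hom[OF alg assms h])
    show "counit_hom HH M (H12.pt a b) = tlift K M H1 H2 (counit_hom H1 M) (counit_hom H2 M) (H12.pt a b)"
      if "a \<in> carrier H1" "b \<in> carrier H2" for a b
      using that by (simp add: tlift_pure[OF alg assms h] counit_hom_def[of HH] pure M.smult_assoc1
        del: tensor_bialg_simps(8)) (simp add: counit_hom_def M.smult_mult_left)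
  qed
qed

theorem bialgebra_HH: "bialgebra K HH"
proof -
  interpret P: pre_bialgebra K HH by (rule pre_bialgebra_HH)
  \<comment> \<open>Homomorphisms on \<open>H1 \<otimes> H2\<close> are commuting pairs, so the axioms hold componentwise.\<close>
  have decomp: "\<exists>u1\<in>alg_hom K H1 M. \<exists>u2\<in>alg_hom K H2 M. commuting H1 H2 M u1 u2 \<and>
      u = tlift K M H1 H2 u1 u2 \<and> u1 = compose (carrier H1) u (inl K H1 H2)
      \<and> u2 = compose (carrier H2) u (inr K H1 H2)"
    if "k_algebra K M" "u \<in> alg_hom K HH M" for u and M :: "('k, 'z, 'zz) module_scheme"
    using that alg_hom_tensor_decomp[OF alg, of M u] alg_hom_compose[OF H12.inl_hom _ alg(1), of u M]
      alg_hom_compose[OF H12.inr_hom _ alg(2), of u M]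
      commuting_compose[OF _ H12.inl_hom H12.inr_hom H12.inl_inr, of u M]
    by (auto simp: alg_hom_tensor_bialg)
  show ?thesis
  proof (rule P.bialgebraI)
    fix u assume u: "u \<in> alg_hom K HH HH"
    obtain u1 u2 where u12: "u1 \<in> alg_hom K H1 HH" "u2 \<in> alg_hom K H2 HH" "commuting H1 H2 HH u1 u2"
      "u = tlift K HH H1 H2 u1 u2"
      using decomp[OF k_algebra_HH u] by blast
    note M = k_algebra_HH
    note e = H1.counit_hom_alg_hom[OF M] H2.counit_hom_alg_hom[OF M] H1.commuting_counit_left[OF M]
      H1.commuting_counit_right[OF M] H2.commuting_counit_left[OF M] H2.commuting_counit_right[OF M]
    show "convolution K HH HH (counit_hom HH HH) u = u"
      using u12(1-3) unfolding u12(4) by (simp add: e counit_hom_HH[OF M] convolution_HH[OF M] H1.convolution_counit_left[OF M]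
        H2.convolution_counit_left[OF M])
    show "convolution K HH HH u (counit_hom HH HH) = u"
      using u12(1-3) unfolding u12(4) by (simp add: e counit_hom_HH[OF M] convolution_HH[OF M] H1.convolution_counit_right[OF M]
        H2.convolution_counit_right[OF M])
  next
    let ?M = "tensor_alg K HH (tensor_alg K HH HH)"
    have M: "k_algebra K ?M" by (intro k_algebra_tensor k_algebra_HH)
    fix u v w assume *: "u \<in> alg_hom K HH ?M" "v \<in> alg_hom K HH ?M" "w \<in> alg_hom K HH ?M"
      "commuting HH HH ?M u v" "commuting HH HH ?M u w" "commuting HH HH ?M v w"
    obtain u1 u2 where u: "u1 \<in> alg_hom K H1 ?M" "u2 \<in> alg_hom K H2 ?M" "commuting H1 H2 ?M u1 u2"
      "u = tlift K ?M H1 H2 u1 u2" "u1 = compose (carrier H1) u (inl K H1 H2)"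
      "u2 = compose (carrier H2) u (inr K H1 H2)"
      using decomp[OF M *(1)] by blast
    obtain v1 v2 where v: "v1 \<in> alg_hom K H1 ?M" "v2 \<in> alg_hom K H2 ?M" "commuting H1 H2 ?M v1 v2"
      "v = tlift K ?M H1 H2 v1 v2" "v1 = compose (carrier H1) v (inl K H1 H2)"
      "v2 = compose (carrier H2) v (inr K H1 H2)"
      using decomp[OF M *(2)] by blast
    obtain w1 w2 where w: "w1 \<in> alg_hom K H1 ?M" "w2 \<in> alg_hom K H2 ?M" "commuting H1 H2 ?M w1 w2"
      "w = tlift K ?M H1 H2 w1 w2" "w1 = compose (carrier H1) w (inl K H1 H2)"
      "w2 = compose (carrier H2) w (inr K H1 H2)"
      using decomp[OF M *(3)] by blast
    have comm: "commuting H1 H1 ?M (compose (carrier H1) f (inl K H1 H2)) (compose (carrier H1) g (inl K H1 H2))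
      \<and> commuting H1 H2 ?M (compose (carrier H1) f (inl K H1 H2)) (compose (carrier H2) g (inr K H1 H2))
      \<and> commuting H1 H2 ?M (compose (carrier H1) g (inl K H1 H2)) (compose (carrier H2) f (inr K H1 H2))
      \<and> commuting H2 H2 ?M (compose (carrier H2) f (inr K H1 H2)) (compose (carrier H2) g (inr K H1 H2))"
      if "commuting HH HH ?M f g" for f g
      using that commuting_compose_left[OF H12.inl_hom] commuting_compose_left[OF H12.inr_hom]
        commuting_compose_right[OF H12.inl_hom] commuting_compose_right[OF H12.inr_hom]
      unfolding commuting_tensor_bialg by (metis commuting_sym)
    note c = comm[OF *(4), folded u(5,6) v(5,6)] comm[OF *(5), folded u(5,6) w(5,6)]
      comm[OF *(6), folded v(5,6) w(5,6)]
    note rules = H1.convolution_alg_hom[OF M] H2.convolution_alg_hom[OF M]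
      H1.commuting_convolution_left[OF M] H1.commuting_convolution_right[OF M]
      H2.commuting_convolution_left[OF M] H2.commuting_convolution_right[OF M]
    have "convolution K ?M HH (convolution K ?M HH u v) w = tlift K ?M H1 H2
        (convolution K ?M H1 (convolution K ?M H1 u1 v1) w1) (convolution K ?M H2 (convolution K ?M H2 u2 v2) w2)"
      unfolding u(4) v(4) w(4)
      using c by (simp add: convolution_HH[OF M] u(1-3) v(1-3) w(1-3) rules)
    also have "\<dots> = tlift K ?M H1 H2
        (convolution K ?M H1 u1 (convolution K ?M H1 v1 w1)) (convolution K ?M H2 u2 (convolution K ?M H2 v2 w2))"
      using c by (simp add: H1.convolution_assoc[OF M] H2.convolution_assoc[OF M] u(1-3) v(1-3) w(1-3))
    also have "\<dots> = convolution K ?M HH u (convolution K ?M HH v w)"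
      unfolding u(4) v(4) w(4)
      using c by (simp add: convolution_HH[OF M] u(1-3) v(1-3) w(1-3) rules)
    finally show "convolution K ?M HH (convolution K ?M HH u v) w = convolution K ?M HH u (convolution K ?M HH v w)" .
  qed
qed

end

section \<open>Twists on a tensor product\<close>

text \<open>Conjugation \<open>y \<mapsto> x y x\<^sup>-\<^sup>1\<close>, restricted to the carrier; a homomorphism for invertible \<open>x\<close>.\<close>

definition conjugation :: "('a, 'm) monoid_scheme \<Rightarrow> 'a \<Rightarrow> 'a \<Rightarrow> 'a"
  where "conjugation A x = restrict (\<lambda>y. x \<otimes>\<^bsub>A\<^esub> y \<otimes>\<^bsub>A\<^esub> inv\<^bsub>A\<^esub> x) (carrier A)"

lemma conjugation_apply:
  "y \<in> carrier A \<Longrightarrow> conjugation A x y = x \<otimes>\<^bsub>A\<^esub> y \<otimes>\<^bsub>A\<^esub> inv\<^bsub>A\<^esub> x"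
  by (simp add: conjugation_def)

lemma conjugation_alg_hom:
  assumes "k_algebra K A" "x \<in> Units A"
  shows "conjugation A x \<in> alg_hom K A A"
proof -
  interpret A: k_algebra K A by fact
  note mon = k_algebra_monoid[OF assms(1)]
  have x [simp]: "x \<in> carrier A" "inv\<^bsub>A\<^esub> x \<in> carrier A"
    using assms(2) monoid.Units_closed[OF mon] monoid.Units_inv_closed[OF mon] by auto
  note inv = monoid.Units_l_inv[OF mon assms(2)] monoid.Units_r_inv[OF mon assms(2)]
  show ?thesis
  proof (rule alg_homI)
    fix y z assume yz: "y \<in> carrier A" "z \<in> carrier A"
    have "x \<otimes>\<^bsub>A\<^esub> y \<otimes>\<^bsub>A\<^esub> inv\<^bsub>A\<^esub> x \<otimes>\<^bsub>A\<^esub> (x \<otimes>\<^bsub>A\<^esub> z \<otimes>\<^bsub>A\<^esub> inv\<^bsub>A\<^esub> x) =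
      x \<otimes>\<^bsub>A\<^esub> y \<otimes>\<^bsub>A\<^esub> ((inv\<^bsub>A\<^esub> x \<otimes>\<^bsub>A\<^esub> x) \<otimes>\<^bsub>A\<^esub> (z \<otimes>\<^bsub>A\<^esub> inv\<^bsub>A\<^esub> x))"
      using yz by (simp add: A.m_assoc)
    also have "\<dots> = x \<otimes>\<^bsub>A\<^esub> (y \<otimes>\<^bsub>A\<^esub> z) \<otimes>\<^bsub>A\<^esub> inv\<^bsub>A\<^esub> x"
      using yz by (simp add: inv A.m_assoc)
    finally show "conjugation A x (y \<otimes>\<^bsub>A\<^esub> z) = conjugation A x y \<otimes>\<^bsub>A\<^esub> conjugation A x z"
      using yz by (simp add: conjugation_apply)
  qed (simp_all add: conjugation_def inv A.l_distr A.r_distr A.smult_mult_left A.smult_mult_right)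
qed

text \<open>The computation common to both axioms of the \<open>R\<close>-matrix: \<open>f\<close> is the value of the twist of a
  factor, \<open>g\<close> and \<open>h\<close> those of \<open>G\<close> and \<open>H\<close> with the comultiplication applied to one leg, and the
  quotients of \<open>p\<close> by \<open>t\<close> and of \<open>s\<close> by \<open>q\<close> are the legs of \<open>R\<close>.\<close>

lemma (in monoid) conjugate_quotient:
  assumes "f \<in> Units G" "g \<in> Units G" "h \<in> Units G" "p \<in> Units G" "q \<in> Units G" "s \<in> Units G"
    "t \<in> Units G" "x \<in> Units G" "y \<in> Units G"
    and eqs: "f \<otimes> g = p \<otimes> x" "f \<otimes> h = q \<otimes> y" "s \<otimes> y = t \<otimes> x"
  shows "f \<otimes> (g \<otimes> inv h) \<otimes> inv f = p \<otimes> inv t \<otimes> (s \<otimes> inv q)"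
proof -
  note [simp] = assms(1-9) assms(1-9)[THEN Units_closed]
  let ?r = "p \<otimes> inv t \<otimes> (s \<otimes> inv q)"
  have "?r \<otimes> (f \<otimes> h) = p \<otimes> inv t \<otimes> s \<otimes> (inv q \<otimes> q) \<otimes> y"
    unfolding eqs by (simp add: m_assoc del: Units_l_inv)
  also have "\<dots> = p \<otimes> inv t \<otimes> (s \<otimes> y)" by (simp add: m_assoc)
  also have "\<dots> = p \<otimes> (inv t \<otimes> t) \<otimes> x" unfolding eqs by (simp add: m_assoc del: Units_l_inv)
  also have "\<dots> = f \<otimes> g" by (simp add: eqs)
  finally have "f \<otimes> (g \<otimes> inv h) \<otimes> inv f = ?r \<otimes> (f \<otimes> h) \<otimes> inv h \<otimes> inv f"
    by (simp add: m_assoc)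
  also have "\<dots> = ?r \<otimes> (f \<otimes> (h \<otimes> inv h) \<otimes> inv f)" by (simp add: m_assoc del: Units_r_inv)
  also have "\<dots> = ?r" by simp
  finally show ?thesis .
qed

lemma (in monoid) inv_mult_inv:
  assumes "x \<in> Units G" "y \<in> Units G"
  shows "inv (x \<otimes> inv y) = y \<otimes> inv x"
proof -
  note [simp] = assms assms[THEN Units_closed]
  have "(x \<otimes> inv y) \<otimes> (y \<otimes> inv x) = x \<otimes> (inv y \<otimes> y) \<otimes> inv x"
    "(y \<otimes> inv x) \<otimes> (x \<otimes> inv y) = y \<otimes> (inv x \<otimes> x) \<otimes> inv y"
    by (simp_all add: m_assoc del: Units_l_inv)
  then show ?thesis by (intro inv_char) simp_all
qed

locale tensor_twist = bialgebra_pair K H1 H2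
  for K :: "('k, 'm) ring_scheme" and H1 :: "('k, 'a, 'p) bialgebra_scheme"
    and H2 :: "('k, 'b, 'q) bialgebra_scheme" +
  fixes F :: "(('a, 'b) tensor, ('a, 'b) tensor) tensor"
  assumes twist_F: "twist K (tensor_bialg K H1 H2) F"
begin

sublocale HH: bialgebra K HH by (rule bialgebra_HH)

text \<open>The projections \<open>Id \<otimes> \<epsilon>\<close> and \<open>\<epsilon> \<otimes> Id\<close> of \<open>H1 \<otimes> H2\<close> onto its factors, and the images of \<open>F\<close> under
  pairs of them: the twists \<open>F1\<close>, \<open>F2\<close> of the factors and the mixed parts \<open>G\<close>, \<open>H\<close>.\<close>

abbreviation "\<pi>1 \<equiv> counit_right H1 H2"
abbreviation "\<pi>2 \<equiv> counit_left H1 H2"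
definition "F1 = tensor_map K H1 H1 \<pi>1 \<pi>1 F"
definition "F2 = tensor_map K H2 H2 \<pi>2 \<pi>2 F"
definition "G = tensor_map K H1 H2 \<pi>1 \<pi>2 F"
definition "H = tensor_map K H2 H1 \<pi>2 \<pi>1 F"

lemma F_closed: "F \<in> carrier (tensor_alg K HH HH)"
  by (rule HH.twist_closed[OF twist_F])

lemma compose_\<pi>:
  assumes "k_algebra K M"
  shows "a \<in> alg_hom K H1 M \<Longrightarrow> compose (carrier HH) a \<pi>1 = tlift K M H1 H2 a (counit_hom H2 M)"
    and "c \<in> alg_hom K H2 M \<Longrightarrow> compose (carrier HH) c \<pi>2 = tlift K M H1 H2 (counit_hom H1 M) c"
  by (rule extensionalityI[of _ "carrier H12"]; simp add: compose_def tlift_extensional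
      H1.hom_counit_left(1)[OF alg(2) assms] H2.hom_counit_right(1)[OF alg(1) assms])+

lemma \<pi>_alg_hom:
  "restrict \<pi>1 (carrier HH) \<in> alg_hom K HH H1" "restrict \<pi>2 (carrier HH) \<in> alg_hom K HH H2"
proof -
  note i = alg_hom_id[OF alg(1)] alg_hom_id[OF alg(2)]
  have "restrict \<pi>1 (carrier HH) = tlift K H1 H1 H2 (restrict id (carrier H1)) (counit_hom H2 H1)"
    by (rule extensionalityI[of _ "carrier H12"])
      (simp_all add: tlift_extensional H2.hom_counit_right(1)[OF alg(1,1) i(1), symmetric]
        H2.hom_counit_right(2)[OF alg(1,1) i(1)])
  then show "restrict \<pi>1 (carrier HH) \<in> alg_hom K HH H1"
    using tlift_alg_hom[OF alg alg(1) i(1) H2.counit_hom_alg_hom[OF alg(1)] H2.commuting_counit_right[OF alg(1) i(1)]]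
    by (simp add: alg_hom_tensor_bialg)
  have "restrict \<pi>2 (carrier HH) = tlift K H2 H1 H2 (counit_hom H1 H2) (restrict id (carrier H2))"
    by (rule extensionalityI[of _ "carrier H12"])
      (simp_all add: tlift_extensional H1.hom_counit_left(1)[OF alg(2,2) i(2), symmetric]
        H1.hom_counit_left(2)[OF alg(2,2) i(2)])
  then show "restrict \<pi>2 (carrier HH) \<in> alg_hom K HH H2"
    using tlift_alg_hom[OF alg alg(2) H1.counit_hom_alg_hom[OF alg(2)] i(2) H1.commuting_counit_left[OF alg(2) i(2)]]
    by (simp add: alg_hom_tensor_bialg)
qed

lemma legs_closed:
  "F1 \<in> carrier (tensor_alg K H1 H1)" "F2 \<in> carrier (tensor_alg K H2 H2)"
  "G \<in> carrier (tensor_alg K H1 H2)" "H \<in> carrier (tensor_alg K H2 H1)"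
  unfolding F1_def F2_def G_def H_def
  by (rule tensor_map_closed[OF HH.k_algebra_H HH.k_algebra_H _ _ _ _ F_closed]; rule alg \<pi>_alg_hom)+

end

text \<open>Computation of the twist and its parts in an algebra \<open>M\<close> into which the factors \<open>H1\<close>, \<open>H2\<close> are
  mapped by commuting homomorphisms.\<close>

locale twist_target = tensor_twist K H1 H2 F + M: k_algebra K M
  for K :: "('k, 'm) ring_scheme" and H1 :: "('k, 'a, 'p) bialgebra_scheme"
    and H2 :: "('k, 'b, 'q) bialgebra_scheme" and F and M :: "('k, 'c, 'r) module_scheme"
begin

lemma alg_M: "k_algebra K M" by (rule M.k_algebra_axioms)

abbreviation "e1 \<equiv> counit_hom H1 M"
abbreviation "e2 \<equiv> counit_hom H2 M"
abbreviation "conv1 \<equiv> convolution K M H1"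
abbreviation "conv2 \<equiv> convolution K M H2"
abbreviation "hom1 \<equiv> alg_hom K H1 M"
abbreviation "hom2 \<equiv> alg_hom K H2 M"
abbreviation "comm11 \<equiv> commuting H1 H1 M"
abbreviation "comm12 \<equiv> commuting H1 H2 M"
abbreviation "comm22 \<equiv> commuting H2 H2 M"

text \<open>The value \<open>\<Phi>([a, c], [b, d])\<close> of \<open>F\<close> on the legs \<open>a\<close>, \<open>c\<close>, \<open>b\<close>, \<open>d\<close>.\<close>

definition ev :: "('a \<Rightarrow> 'c) \<Rightarrow> ('b \<Rightarrow> 'c) \<Rightarrow> ('a \<Rightarrow> 'c) \<Rightarrow> ('b \<Rightarrow> 'c) \<Rightarrow> 'c"
  where "ev a c b d = tlift K M HH HH (tlift K M H1 H2 a c) (tlift K M H1 H2 b d) F"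

lemma e_simps [simp]:
  "e1 \<in> hom1" "e2 \<in> hom2"
  "a \<in> hom1 \<Longrightarrow> comm11 e1 a" "a \<in> hom1 \<Longrightarrow> comm11 a e1"
  "c \<in> hom2 \<Longrightarrow> comm22 e2 c" "c \<in> hom2 \<Longrightarrow> comm22 c e2"
  "c \<in> hom2 \<Longrightarrow> comm12 e1 c" "a \<in> hom1 \<Longrightarrow> comm12 a e2"
  "a \<in> hom1 \<Longrightarrow> conv1 e1 a = a" "a \<in> hom1 \<Longrightarrow> conv1 a e1 = a"
  "c \<in> hom2 \<Longrightarrow> conv2 e2 c = c" "c \<in> hom2 \<Longrightarrow> conv2 c e2 = c"
  by (rule H1.counit_hom_alg_hom H2.counit_hom_alg_hom H1.commuting_counit_left H1.commuting_counit_right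
    H2.commuting_counit_left H2.commuting_counit_right H1.convolution_counit_left H1.convolution_counit_right
    H2.convolution_counit_left H2.convolution_counit_right alg_M | assumption)+

lemma conv_simps [simp]:
  "a \<in> hom1 \<Longrightarrow> b \<in> hom1 \<Longrightarrow> comm11 a b \<Longrightarrow> conv1 a b \<in> hom1"
  "c \<in> hom2 \<Longrightarrow> d \<in> hom2 \<Longrightarrow> comm22 c d \<Longrightarrow> conv2 c d \<in> hom2"
  "a \<in> hom1 \<Longrightarrow> b \<in> hom1 \<Longrightarrow> c \<in> hom2 \<Longrightarrow> comm11 a b \<Longrightarrow>
    comm12 a c \<Longrightarrow> comm12 b c \<Longrightarrow> comm12 (conv1 a b) c"
  "c \<in> hom2 \<Longrightarrow> d \<in> hom2 \<Longrightarrow> a \<in> hom1 \<Longrightarrow> comm22 c d \<Longrightarrow>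
    comm12 a c \<Longrightarrow> comm12 a d \<Longrightarrow> comm12 a (conv2 c d)"
  by (rule H1.convolution_alg_hom H2.convolution_alg_hom H1.commuting_convolution_left
    H2.commuting_convolution_right alg_M | assumption)+

lemma tlift_HH_alg_hom:
  "a \<in> hom1 \<Longrightarrow> c \<in> hom2 \<Longrightarrow> comm12 a c \<Longrightarrow> tlift K M H1 H2 a c \<in> alg_hom K HH M"
  unfolding alg_hom_tensor_bialg by (rule tlift_alg_hom[OF alg alg_M])

lemma tlift_HH_commuting:
  assumes "a \<in> hom1" "b \<in> hom1" "c \<in> hom2" "d \<in> hom2"
    "comm12 a c" "comm12 b d" "comm11 a b" "comm12 a d" "comm12 b c" "comm22 c d"
  shows "commuting HH HH M (tlift K M H1 H2 a c) (tlift K M H1 H2 b d)"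
  unfolding commuting_tensor_bialg
  by (intro commuting_tlift_left[OF alg alg_M] commuting_tlift_right[OF alg alg_M] tlift_alg_hom[OF alg alg_M]
      assms assms(9)[THEN commuting_sym])

lemma ev_Units [simp]:
  assumes "a \<in> hom1" "b \<in> hom1" "c \<in> hom2" "d \<in> hom2"
    "comm12 a c" "comm12 b d" "comm11 a b" "comm12 a d" "comm12 b c" "comm22 c d"
  shows "ev a c b d \<in> Units M"
  unfolding ev_def
  by (rule alg_hom_Units(1)[OF tlift_alg_hom[OF HH.k_algebra_H HH.k_algebra_H alg_M] HH.Sq.k_algebra_T alg_M
      HH.twist_Units[OF twist_F]])
    (intro tlift_HH_alg_hom tlift_HH_commuting assms)+

lemma ev_closed [simp]:
  assumes "a \<in> hom1" "b \<in> hom1" "c \<in> hom2" "d \<in> hom2"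
    "comm12 a c" "comm12 b d" "comm11 a b" "comm12 a d" "comm12 b c" "comm22 c d"
  shows "ev a c b d \<in> carrier M"
  using ev_Units[OF assms] by (rule M.Units_closed)

text \<open>The cocycle identity in leg notation.\<close>

lemma cocycle:
  assumes "a \<in> hom1" "b \<in> hom1" "x \<in> hom1"
    "c \<in> hom2" "d \<in> hom2" "y \<in> hom2"
    "comm11 a b" "comm11 a x" "comm11 b x" "comm22 c d" "comm22 c y" "comm22 d y"
    "comm12 a c" "comm12 a d" "comm12 a y" "comm12 b c" "comm12 b d" "comm12 b y"
    "comm12 x c" "comm12 x d" "comm12 x y"
  shows "ev a c b d \<otimes>\<^bsub>M\<^esub> ev (conv1 a b) (conv2 c d) x y =
    ev b d x y \<otimes>\<^bsub>M\<^esub> ev a c (conv1 b x) (conv2 d y)"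
proof -
  have "tlift K M HH HH (tlift K M H1 H2 a c) (tlift K M H1 H2 b d) F \<otimes>\<^bsub>M\<^esub>
      tlift K M HH HH (convolution K M HH (tlift K M H1 H2 a c) (tlift K M H1 H2 b d)) (tlift K M H1 H2 x y) F =
    tlift K M HH HH (tlift K M H1 H2 b d) (tlift K M H1 H2 x y) F \<otimes>\<^bsub>M\<^esub>
      tlift K M HH HH (tlift K M H1 H2 a c) (convolution K M HH (tlift K M H1 H2 b d) (tlift K M H1 H2 x y)) F"
    by (rule HH.twist_cocycle[OF twist_F alg_M]) (intro tlift_HH_alg_hom tlift_HH_commuting assms)+
  then show ?thesis
    unfolding ev_def by (simp add: convolution_HH[OF alg_M] assms)
qed

lemma tlift_F1:
  assumes "a \<in> hom1" "b \<in> hom1" "comm11 a b"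
  shows "tlift K M H1 H1 a b F1 = ev a e2 b e2"
  unfolding F1_def ev_def
  by (simp add: tlift_tensor_map[OF HH.k_algebra_H HH.k_algebra_H alg(1,1) \<pi>_alg_hom(1,1) F_closed alg_M assms]
    compose_\<pi>[OF alg_M] assms del: tensor_bialg_simps(1))

lemma tlift_F2:
  assumes "c \<in> hom2" "d \<in> hom2" "comm22 c d"
  shows "tlift K M H2 H2 c d F2 = ev e1 c e1 d"
  unfolding F2_def ev_def
  by (simp add: tlift_tensor_map[OF HH.k_algebra_H HH.k_algebra_H alg(2,2) \<pi>_alg_hom(2,2) F_closed alg_M assms]
    compose_\<pi>[OF alg_M] assms del: tensor_bialg_simps(1))

lemma tlift_G:
  assumes "a \<in> hom1" "c \<in> hom2" "comm12 a c"
  shows "tlift K M H1 H2 a c G = ev a e2 e1 c"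
  unfolding G_def ev_def
  by (simp add: tlift_tensor_map[OF HH.k_algebra_H HH.k_algebra_H alg(1,2) \<pi>_alg_hom(1,2) F_closed alg_M assms]
    compose_\<pi>[OF alg_M] assms del: tensor_bialg_simps(1))

lemma tlift_H:
  assumes "a \<in> hom1" "c \<in> hom2" "comm12 a c"
  shows "tlift K M H2 H1 c a H = ev e1 c a e2"
  unfolding H_def ev_def
  by (simp add: tlift_tensor_map[OF HH.k_algebra_H HH.k_algebra_H alg(2,1) \<pi>_alg_hom(2,1) F_closed alg_M
      assms(2,1) commuting_sym[OF assms(3)]] compose_\<pi>[OF alg_M] assms del: tensor_bialg_simps(1))

text \<open>The value of \<open>R\<close> on the legs \<open>c\<close> and \<open>a\<close>; see \<open>tlift_R\<close> below.\<close>

definition Rv :: "('b \<Rightarrow> 'c) \<Rightarrow> ('a \<Rightarrow> 'c) \<Rightarrow> 'c"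
  where "Rv c a = ev a e2 e1 c \<otimes>\<^bsub>M\<^esub> inv\<^bsub>M\<^esub> (ev e1 c a e2)"

text \<open>The two axioms of a weak \<open>R\<close>-matrix in leg notation.  The three equations in each proof are
  instances of the cocycle identity in which three of the six entries of \<open>u\<close>, \<open>v\<close>, \<open>w\<close> are \<open>e\<close>.\<close>

lemma R_right_identity:
  assumes [simp]: "a \<in> hom1" "b \<in> hom1" "c \<in> hom2"
    "comm11 a b" "comm12 a c" "comm12 b c"
  shows "ev a e2 b e2 \<otimes>\<^bsub>M\<^esub> Rv c (conv1 a b) \<otimes>\<^bsub>M\<^esub> inv\<^bsub>M\<^esub> (ev a e2 b e2) = Rv c b \<otimes>\<^bsub>M\<^esub> Rv c a"
proof -
  have 1: "ev a e2 b e2 \<otimes>\<^bsub>M\<^esub> ev (conv1 a b) e2 e1 c = ev b e2 e1 c \<otimes>\<^bsub>M\<^esub> ev a e2 b c"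
    using cocycle[of a b e1 e2 e2 c] by simp
  have 2: "ev a e2 b e2 \<otimes>\<^bsub>M\<^esub> ev e1 c (conv1 a b) e2 = ev e1 c a e2 \<otimes>\<^bsub>M\<^esub> ev a c b e2"
    using cocycle[of e1 a b c e2 e2] by simp
  have 3: "ev a e2 e1 c \<otimes>\<^bsub>M\<^esub> ev a c b e2 = ev e1 c b e2 \<otimes>\<^bsub>M\<^esub> ev a e2 b c"
    using cocycle[of a e1 b e2 c e2] by simp
  show ?thesis unfolding Rv_def
    by (rule M.conjugate_quotient[OF _ _ _ _ _ _ _ _ _ 1 2 3]) simp_all
qed

lemma R_left_identity:
  assumes [simp]: "a \<in> hom1" "c \<in> hom2" "d \<in> hom2"
    "comm22 c d" "comm12 a c" "comm12 a d"
  shows "ev e1 c e1 d \<otimes>\<^bsub>M\<^esub> Rv (conv2 c d) a \<otimes>\<^bsub>M\<^esub> inv\<^bsub>M\<^esub> (ev e1 c e1 d) = Rv c a \<otimes>\<^bsub>M\<^esub> Rv d a"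
proof -
  have 1: "ev e1 c e1 d \<otimes>\<^bsub>M\<^esub> ev a e2 e1 (conv2 c d) = ev a e2 e1 c \<otimes>\<^bsub>M\<^esub> ev a c e1 d"
    using cocycle[of a e1 e1 e2 c d] by simp
  have 2: "ev e1 c e1 d \<otimes>\<^bsub>M\<^esub> ev e1 (conv2 c d) a e2 = ev e1 d a e2 \<otimes>\<^bsub>M\<^esub> ev e1 c a d"
    using cocycle[of e1 e1 a c d e2] by simp
  have 3: "ev a e2 e1 d \<otimes>\<^bsub>M\<^esub> ev e1 c a d = ev e1 c a e2 \<otimes>\<^bsub>M\<^esub> ev a c e1 d"
    using cocycle[of e1 a e1 c e2 d] by simp
  show ?thesis unfolding Rv_def
    by (rule M.conjugate_quotient[OF _ _ _ _ _ _ _ _ _ 1 2 3]) simp_all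
qed

text \<open>The formula for the gauge transform of \<open>F\<close> in leg notation, with \<open>\<Delta>(G\<^sup>-\<^sup>1)\<close> moved to the other
  side as \<open>\<Delta>(G)\<close>.  Instances 1 to 3 of the cocycle identity split off the value of \<open>G\<close> on the inner
  legs \<open>b\<close>, \<open>c\<close>, which cancels against \<open>R\<^sup>-\<^sup>1\<close>; instances 4 and 5 assemble \<open>F\<close> from what remains.\<close>

lemma gauge_identity:
  assumes [simp]: "a \<in> hom1" "b \<in> hom1" "c \<in> hom2" "d \<in> hom2"
    "comm11 a b" "comm22 c d" "comm12 a c" "comm12 a d" "comm12 b c" "comm12 b d"
  shows "ev a e2 e1 c \<otimes>\<^bsub>M\<^esub> ev b e2 e1 d \<otimes>\<^bsub>M\<^esub> ev a c b d =
    inv\<^bsub>M\<^esub> (Rv c b) \<otimes>\<^bsub>M\<^esub> (ev e1 c e1 d \<otimes>\<^bsub>M\<^esub> ev a e2 b e2) \<otimes>\<^bsub>M\<^esub> ev (conv1 a b) e2 e1 (conv2 c d)"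
proof -
  let ?m = "\<lambda>x y. x \<otimes>\<^bsub>M\<^esub> y"
  have 1: "?m (ev a e2 b e2) (ev (conv1 a b) e2 e1 (conv2 c d)) = ?m (ev b e2 e1 (conv2 c d)) (ev a e2 b (conv2 c d))"
    using cocycle[of a b e1 e2 e2 "conv2 c d"] by simp
  have 2: "?m (ev e1 c e1 d) (ev b e2 e1 (conv2 c d)) = ?m (ev b e2 e1 c) (ev b c e1 d)"
    using cocycle[of b e1 e1 e2 c d] by simp
  have 3: "?m (ev b c e1 d) (ev a e2 b (conv2 c d)) = ?m (ev a e2 b c) (ev (conv1 a b) c e1 d)"
    using cocycle[of a b e1 e2 c d] by simp
  have 4: "?m (ev a e2 e1 c) (ev a c b e2) = ?m (ev e1 c b e2) (ev a e2 b c)"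
    using cocycle[of a e1 b e2 c e2] by simp
  have 5: "?m (ev a c b e2) (ev (conv1 a b) c e1 d) = ?m (ev b e2 e1 d) (ev a c b d)"
    using cocycle[of a b e1 c e2 d] by simp
  note assoc = M.m_assoc
  have "?m (?m (ev e1 c e1 d) (ev a e2 b e2)) (ev (conv1 a b) e2 e1 (conv2 c d)) =
    ?m (?m (ev e1 c e1 d) (ev b e2 e1 (conv2 c d))) (ev a e2 b (conv2 c d))"
    using 1 by (simp add: assoc)
  also have "\<dots> = ?m (ev b e2 e1 c) (?m (ev b c e1 d) (ev a e2 b (conv2 c d)))"
    unfolding 2 by (simp add: assoc)
  also have "\<dots> = ?m (ev b e2 e1 c) (?m (ev a e2 b c) (ev (conv1 a b) c e1 d))"
    unfolding 3 by simp
  finally have A: "?m (?m (ev e1 c e1 d) (ev a e2 b e2)) (ev (conv1 a b) e2 e1 (conv2 c d)) = \<dots>" .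
  have inv: "inv\<^bsub>M\<^esub> (Rv c b) = ?m (ev e1 c b e2) (inv\<^bsub>M\<^esub> (ev b e2 e1 c))"
    unfolding Rv_def by (simp add: M.inv_mult_inv)
  have "?m (?m (inv\<^bsub>M\<^esub> (Rv c b)) (?m (ev e1 c e1 d) (ev a e2 b e2))) (ev (conv1 a b) e2 e1 (conv2 c d)) =
    ?m (ev e1 c b e2) (?m (?m (inv\<^bsub>M\<^esub> (ev b e2 e1 c)) (ev b e2 e1 c)) (?m (ev a e2 b c) (ev (conv1 a b) c e1 d)))"
    using A by (simp add: inv assoc del: M.Units_l_inv)
  also have "\<dots> = ?m (?m (ev e1 c b e2) (ev a e2 b c)) (ev (conv1 a b) c e1 d)"
    by (simp add: assoc)
  also have "\<dots> = ?m (ev a e2 e1 c) (?m (ev a c b e2) (ev (conv1 a b) c e1 d))"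
    unfolding 4[symmetric] by (simp add: assoc)
  also have "\<dots> = ?m (?m (ev a e2 e1 c) (ev b e2 e1 d)) (ev a c b d)"
    unfolding 5 by (simp add: assoc)
  finally show ?thesis by simp
qed

lemma Rv_Units [simp]:
  "a \<in> hom1 \<Longrightarrow> c \<in> hom2 \<Longrightarrow> comm12 a c \<Longrightarrow> Rv c a \<in> Units M"
  unfolding Rv_def by (intro M.Units_m_closed M.Units_inv_Units ev_Units) simp_all

end

section \<open>The twists of the factors and the weak R-matrix\<close>

context twist_target
begin

lemma ev_counit [simp]:
  assumes "a \<in> hom1" "c \<in> hom2" "comm12 a c"
  shows "ev e1 e2 a c = \<one>\<^bsub>M\<^esub>" "ev a c e1 e2 = \<one>\<^bsub>M\<^esub>"
  using HH.twist_counit_left[OF twist_F alg_M tlift_HH_alg_hom[OF assms]]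
    HH.twist_counit_right[OF twist_F alg_M tlift_HH_alg_hom[OF assms]]
  by (simp_all add: ev_def counit_hom_HH[OF alg_M])

end

context tensor_twist
begin

lemma twist_target: "k_algebra K M \<Longrightarrow> twist_target K H1 H2 F M"
  by (simp add: twist_target_def tensor_twist_axioms)

lemma legs_Units:
  "F1 \<in> Units (tensor_alg K H1 H1)" "F2 \<in> Units (tensor_alg K H2 H2)"
  "G \<in> Units (tensor_alg K H1 H2)" "H \<in> Units (tensor_alg K H2 H1)"
proof -
  interpret T11: twist_target K H1 H2 F "tensor_alg K H1 H1" by (intro twist_target k_algebra_tensor alg)
  show "F1 \<in> Units (tensor_alg K H1 H1)"
    using T11.tlift_F1[OF inl_hom inr_hom inl_inr] T11.ev_Units[OF inl_hom inr_hom] inl_hom[OF alg(1,1)]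
      inr_hom[OF alg(1,1)] inl_inr[OF alg(1,1)] legs_closed(1)
    by (simp add: tlift_inl_inr_apply alg)
  interpret T22: twist_target K H1 H2 F "tensor_alg K H2 H2" by (intro twist_target k_algebra_tensor alg)
  show "F2 \<in> Units (tensor_alg K H2 H2)"
    using T22.tlift_F2[OF inl_hom[OF alg(2,2)] inr_hom[OF alg(2,2)] inl_inr[OF alg(2,2)]]
      inl_hom[OF alg(2,2)] inr_hom[OF alg(2,2)] inl_inr[OF alg(2,2)] legs_closed(2)
    by (simp add: tlift_inl_inr_apply alg)
  interpret T12: twist_target K H1 H2 F "tensor_alg K H1 H2" by (intro twist_target k_algebra_tensor alg)
  show "G \<in> Units (tensor_alg K H1 H2)"
    using T12.tlift_G[OF inl_hom[OF alg] inr_hom[OF alg] inl_inr[OF alg]]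
      inl_hom[OF alg] inr_hom[OF alg] inl_inr[OF alg] legs_closed(3)
    by (simp add: tlift_inl_inr_apply alg)
  interpret T21: twist_target K H1 H2 F "tensor_alg K H2 H1" by (intro twist_target k_algebra_tensor alg)
  show "H \<in> Units (tensor_alg K H2 H1)"
    using T21.tlift_H[OF inr_hom[OF alg(2,1)] inl_hom[OF alg(2,1)] inr_inl[OF alg(2,1)]]
      inl_hom[OF alg(2,1)] inr_hom[OF alg(2,1)] inr_inl[OF alg(2,1)] legs_closed(4)
    by (simp add: tlift_inl_inr_apply alg)
qed

theorem twist_F1: "twist K H1 F1"
proof (rule H1.twistI[OF legs_Units(1)])
  interpret T: twist_target K H1 H2 F "tensor_alg K H1 (tensor_alg K H1 H1)"
    by (intro twist_target k_algebra_tensor alg)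
  let ?M = "tensor_alg K H1 (tensor_alg K H1 H1)"
  fix u v w assume [simp]: "u \<in> alg_hom K H1 ?M" "v \<in> alg_hom K H1 ?M" "w \<in> alg_hom K H1 ?M"
    "T.comm11 u v" "T.comm11 u w" "T.comm11 v w"
  note c = H1.commuting_convolution_left[OF T.alg_M] H1.commuting_convolution_right[OF T.alg_M]
  show "tlift K ?M H1 H1 u v F1 \<otimes>\<^bsub>?M\<^esub> tlift K ?M H1 H1 (T.conv1 u v) w F1 =
    tlift K ?M H1 H1 v w F1 \<otimes>\<^bsub>?M\<^esub> tlift K ?M H1 H1 u (T.conv1 v w) F1"
    using T.cocycle[of u v w T.e2 T.e2 T.e2] by (simp add: T.tlift_F1 c)
next
  interpret T: twist_target K H1 H2 F H1 by (intro twist_target alg)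
  fix u assume [simp]: "u \<in> alg_hom K H1 H1"
  show "tlift K H1 H1 H1 T.e1 u F1 = \<one>\<^bsub>H1\<^esub>" "tlift K H1 H1 H1 u T.e1 F1 = \<one>\<^bsub>H1\<^esub>"
    by (simp_all add: T.tlift_F1)
qed

theorem twist_F2: "twist K H2 F2"
proof (rule H2.twistI[OF legs_Units(2)])
  interpret T: twist_target K H1 H2 F "tensor_alg K H2 (tensor_alg K H2 H2)"
    by (intro twist_target k_algebra_tensor alg)
  let ?M = "tensor_alg K H2 (tensor_alg K H2 H2)"
  fix u v w assume [simp]: "u \<in> alg_hom K H2 ?M" "v \<in> alg_hom K H2 ?M" "w \<in> alg_hom K H2 ?M"
    "T.comm22 u v" "T.comm22 u w" "T.comm22 v w"
  note c = H2.commuting_convolution_left[OF T.alg_M] H2.commuting_convolution_right[OF T.alg_M]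
  show "tlift K ?M H2 H2 u v F2 \<otimes>\<^bsub>?M\<^esub> tlift K ?M H2 H2 (T.conv2 u v) w F2 =
    tlift K ?M H2 H2 v w F2 \<otimes>\<^bsub>?M\<^esub> tlift K ?M H2 H2 u (T.conv2 v w) F2"
    using T.cocycle[of T.e1 T.e1 T.e1 u v w] by (simp add: T.tlift_F2 c)
next
  interpret T: twist_target K H1 H2 F H2 by (intro twist_target alg)
  fix u assume [simp]: "u \<in> alg_hom K H2 H2"
  show "tlift K H2 H2 H2 T.e2 u F2 = \<one>\<^bsub>H2\<^esub>" "tlift K H2 H2 H2 u T.e2 F2 = \<one>\<^bsub>H2\<^esub>"
    by (simp_all add: T.tlift_F2)
qed

text \<open>The weak \<open>R\<close>-matrix \<open>G\<^sup>o\<^sup>p H\<^sup>-\<^sup>1\<close>.\<close>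

definition "R = tensor_flip K H1 H2 G \<otimes>\<^bsub>tensor_alg K H2 H1\<^esub> inv\<^bsub>tensor_alg K H2 H1\<^esub> H"

lemma flip_G_Units: "tensor_flip K H1 H2 G \<in> Units (tensor_alg K H2 H1)"
proof -
  interpret T: twist_target K H1 H2 F "tensor_alg K H2 H1" by (intro twist_target k_algebra_tensor alg)
  note h = inl_hom[OF alg(2,1)] inr_hom[OF alg(2,1)] inl_inr[OF alg(2,1)] inr_inl[OF alg(2,1)]
  have "tensor_flip K H1 H2 G = T.ev (inr K H2 H1) T.e2 T.e1 (inl K H2 H1)"
    using tlift_tensor_flip[OF alg legs_closed(3) T.alg_M h(1-3)] T.tlift_G[OF h(2,1,4)]
      tensor_flip_closed[OF alg legs_closed(3)]
    by (simp add: tlift_inl_inr_apply alg)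
  then show ?thesis using h by simp
qed

lemma R_Units: "R \<in> Units (tensor_alg K H2 H1)"
proof -
  interpret monoid "tensor_alg K H2 H1" by (intro k_algebra_monoid[of K] k_algebra_tensor alg)
  show ?thesis unfolding R_def by (intro Units_m_closed Units_inv_Units flip_G_Units legs_Units)
qed

lemma R_closed: "R \<in> carrier (tensor_alg K H2 H1)"
  by (rule monoid.Units_closed[OF k_algebra_monoid[OF k_algebra_tensor[OF alg(2,1)]] R_Units])

end

lemma (in twist_target) tlift_R:
  assumes "a \<in> hom1" "c \<in> hom2" "comm12 a c"
  shows "tlift K M H2 H1 c a R = Rv c a"
    and "tlift K M H2 H1 c a (inv\<^bsub>tensor_alg K H2 H1\<^esub> R) = inv\<^bsub>M\<^esub> (Rv c a)"
proof -
  note h = tlift_alg_hom[OF alg(2,1) alg_M assms(2,1) commuting_sym[OF assms(3)]]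
  have T: "k_algebra K (tensor_alg K H2 H1)" by (intro k_algebra_tensor alg)
  interpret T: monoid "tensor_alg K H2 H1" by (rule k_algebra_monoid[OF T])
  have "tlift K M H2 H1 c a R = tlift K M H2 H1 c a (tensor_flip K H1 H2 G) \<otimes>\<^bsub>M\<^esub>
    tlift K M H2 H1 c a (inv\<^bsub>tensor_alg K H2 H1\<^esub> H)"
    unfolding R_def
    by (rule alg_hom_mult[OF h tensor_flip_closed[OF alg legs_closed(3)] T.Units_inv_closed[OF legs_Units(4)]])
  then show eq: "tlift K M H2 H1 c a R = Rv c a"
    by (simp add: Rv_def tlift_tensor_flip[OF alg legs_closed(3) alg_M assms(2,1) commuting_sym[OF assms(3)]]
      tlift_G[OF assms] alg_hom_Units(2)[OF h T alg_M legs_Units(4), symmetric] tlift_H[OF assms])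
  show "tlift K M H2 H1 c a (inv\<^bsub>tensor_alg K H2 H1\<^esub> R) = inv\<^bsub>M\<^esub> (Rv c a)"
    using alg_hom_Units(2)[OF h T alg_M R_Units] by (simp add: eq)
qed

lemma twisted_bialg_simps [simp]:
  "carrier (twisted_bialg K A F) = carrier A" "mult (twisted_bialg K A F) = mult A"
  "one (twisted_bialg K A F) = one A" "zero (twisted_bialg K A F) = zero A"
  "add (twisted_bialg K A F) = add A" "smult (twisted_bialg K A F) = smult A"
  "counit (twisted_bialg K A F) = counit A"
  "comult (twisted_bialg K A F) = (\<lambda>h. F \<otimes>\<^bsub>tensor_alg K A A\<^esub> comult A h \<otimes>\<^bsub>tensor_alg K A A\<^esub>
    inv\<^bsub>tensor_alg K A A\<^esub> F)"
  by (simp_all add: twisted_bialg_def)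

lemma tensor_map_cong:
  assumes "module.truncate A = module.truncate A'" "module.truncate B = module.truncate B'"
  shows "tensor_map K A B = tensor_map K A' B'"
  by (intro ext) (simp add: tensor_map_def tensor_alg_cong[OF assms] pure_tensor_cong[OF assms])

text \<open>Twisting changes only the comultiplication, so tensor products and legs are those of the untwisted
  bialgebras.\<close>

lemma weak_R_matrix_twisted:
  "weak_R_matrix K (twisted_bialg K A F) (twisted_bialg K B F') R \<longleftrightarrow>
    R \<in> Units (tensor_alg K A B) \<and>
    tensor_map K A (tensor_alg K B B) id (comult (twisted_bialg K B F')) R =
      leg13_right K A B R \<otimes>\<^bsub>tensor_alg K A (tensor_alg K B B)\<^esub> leg12_right K A B R \<and>
    tensor_map K (tensor_alg K A A) B (comult (twisted_bialg K A F)) id R =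
      leg13_left K A B R \<otimes>\<^bsub>tensor_alg K (tensor_alg K A A) B\<^esub> leg23_left K A B R"
  unfolding weak_R_matrix_def leg13_right_def leg12_right_def leg13_left_def leg23_left_def
    tensor_alg_cong[OF truncate_twisted_bialg HOL.refl] tensor_alg_cong[OF HOL.refl truncate_twisted_bialg]
    pure_tensor_cong[OF truncate_twisted_bialg HOL.refl] pure_tensor_cong[OF HOL.refl truncate_twisted_bialg]
    tensor_map_cong[OF truncate_twisted_bialg HOL.refl] tensor_map_cong[OF HOL.refl truncate_twisted_bialg]
    twisted_bialg_simps(3)
  by (rule HOL.refl)

text \<open>Legs and twisted comultiplications under commuting homomorphisms: a leg selects the homomorphisms of
  its two positions, and the twisted comultiplication gives a conjugate of the convolution.\<close>

lemma restrict_pure_inl: "restrict (\<lambda>a. pure_tensor K A B a \<one>\<^bsub>B\<^esub>) (carrier A) = inl K A B"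
  and restrict_pure_inr: "restrict (\<lambda>b. pure_tensor K A B \<one>\<^bsub>A\<^esub> b) (carrier B) = inr K A B"
  by (simp_all add: inl_def inr_def)

lemma compose_tlift_pure:
  assumes "k_algebra K A" "k_algebra K B" "k_algebra K M"
    "f \<in> alg_hom K A M" "g \<in> alg_hom K B M" "commuting A B M f g"
  shows "compose (carrier A) (tlift K M A B f g) (\<lambda>a. pure_tensor K A B a \<one>\<^bsub>B\<^esub>) = f"
    and "compose (carrier B) (tlift K M A B f g) (\<lambda>b. pure_tensor K A B \<one>\<^bsub>A\<^esub> b) = g"
  using compose_tlift_inl[OF assms] by (simp_all add: inl_def inr_def)

lemma
  assumes "k_algebra K A" "k_algebra K B" "X \<in> carrier (tensor_alg K A B)"
  shows legs_right_closed: "leg12_right K A B X \<in> carrier (tensor_alg K A (tensor_alg K B B))"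
      "leg13_right K A B X \<in> carrier (tensor_alg K A (tensor_alg K B B))"
    and tlift_legs_right:
      "k_algebra K M \<Longrightarrow> u \<in> alg_hom K A M \<Longrightarrow> v \<in> alg_hom K B M \<Longrightarrow> w \<in> alg_hom K B M \<Longrightarrow>
        commuting A B M u v \<Longrightarrow> commuting A B M u w \<Longrightarrow> commuting B B M v w \<Longrightarrow>
        tlift K M A (tensor_alg K B B) u (tlift K M B B v w) (leg12_right K A B X) = tlift K M A B u v X"
      "k_algebra K M \<Longrightarrow> u \<in> alg_hom K A M \<Longrightarrow> v \<in> alg_hom K B M \<Longrightarrow> w \<in> alg_hom K B M \<Longrightarrow>
        commuting A B M u v \<Longrightarrow> commuting A B M u w \<Longrightarrow> commuting B B M v w \<Longrightarrow>
        tlift K M A (tensor_alg K B B) u (tlift K M B B v w) (leg13_right K A B X) = tlift K M A B u w X"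
proof -
  note BB = k_algebra_tensor[OF assms(2,2)]
  note l = inl_hom[OF assms(2,2), folded restrict_pure_inl] inr_hom[OF assms(2,2), folded restrict_pure_inr]
  note r = assms(1,2,1) BB alg_hom_id[OF assms(1)]
  show "leg12_right K A B X \<in> carrier (tensor_alg K A (tensor_alg K B B))"
      "leg13_right K A B X \<in> carrier (tensor_alg K A (tensor_alg K B B))"
    unfolding leg12_right_def leg13_right_def by (rule tensor_map_closed[OF r _ assms(3)], rule l)+
  assume *: "k_algebra K M" "u \<in> alg_hom K A M" "v \<in> alg_hom K B M" "w \<in> alg_hom K B M"
    "commuting A B M u v" "commuting A B M u w" "commuting B B M v w"
  note h = tlift_alg_hom[OF assms(2,2) *(1,3,4,7)] commuting_tlift_right[OF assms(2,2) *(1,3,4,2,7,5,6)]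
  show "tlift K M A (tensor_alg K B B) u (tlift K M B B v w) (leg12_right K A B X) = tlift K M A B u v X"
    "tlift K M A (tensor_alg K B B) u (tlift K M B B v w) (leg13_right K A B X) = tlift K M A B u w X"
    unfolding leg12_right_def leg13_right_def
    by (simp_all add: tlift_tensor_map[OF r l(1) assms(3) *(1,2) h] tlift_tensor_map[OF r l(2) assms(3) *(1,2) h]
      compose_tlift_pure[OF assms(2,2) *(1,3,4,7)] compose_id[OF *(2)])
qed

lemma
  assumes "k_algebra K A" "k_algebra K B" "X \<in> carrier (tensor_alg K A B)"
  shows legs_left_closed: "leg13_left K A B X \<in> carrier (tensor_alg K (tensor_alg K A A) B)"
      "leg23_left K A B X \<in> carrier (tensor_alg K (tensor_alg K A A) B)"
    and tlift_legs_left: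
      "k_algebra K M \<Longrightarrow> u \<in> alg_hom K A M \<Longrightarrow> v \<in> alg_hom K A M \<Longrightarrow> w \<in> alg_hom K B M \<Longrightarrow>
        commuting A A M u v \<Longrightarrow> commuting A B M u w \<Longrightarrow> commuting A B M v w \<Longrightarrow>
        tlift K M (tensor_alg K A A) B (tlift K M A A u v) w (leg13_left K A B X) = tlift K M A B u w X"
      "k_algebra K M \<Longrightarrow> u \<in> alg_hom K A M \<Longrightarrow> v \<in> alg_hom K A M \<Longrightarrow> w \<in> alg_hom K B M \<Longrightarrow>
        commuting A A M u v \<Longrightarrow> commuting A B M u w \<Longrightarrow> commuting A B M v w \<Longrightarrow>
        tlift K M (tensor_alg K A A) B (tlift K M A A u v) w (leg23_left K A B X) = tlift K M A B v w X"
proof -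
  note AA = k_algebra_tensor[OF assms(1,1)]
  note l = inl_hom[OF assms(1,1), folded restrict_pure_inl] inr_hom[OF assms(1,1), folded restrict_pure_inr]
  note r = assms(1,2) AA assms(2)
  note i = alg_hom_id[OF assms(2)]
  show "leg13_left K A B X \<in> carrier (tensor_alg K (tensor_alg K A A) B)"
      "leg23_left K A B X \<in> carrier (tensor_alg K (tensor_alg K A A) B)"
    unfolding leg13_left_def leg23_left_def by (rule tensor_map_closed[OF r _ i assms(3)], rule l)+
  assume *: "k_algebra K M" "u \<in> alg_hom K A M" "v \<in> alg_hom K A M" "w \<in> alg_hom K B M"
    "commuting A A M u v" "commuting A B M u w" "commuting A B M v w"
  note h = tlift_alg_hom[OF assms(1,1) *(1,2,3,5)] *(4) commuting_tlift_left[OF assms(1,1) *]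
  show "tlift K M (tensor_alg K A A) B (tlift K M A A u v) w (leg13_left K A B X) = tlift K M A B u w X"
    "tlift K M (tensor_alg K A A) B (tlift K M A A u v) w (leg23_left K A B X) = tlift K M A B v w X"
    unfolding leg13_left_def leg23_left_def
    by (simp_all add: tlift_tensor_map[OF r l(1) i assms(3) *(1) h] tlift_tensor_map[OF r l(2) i assms(3) *(1) h]
      compose_tlift_pure[OF assms(1,1) *(1,2,3,5)] compose_id[OF *(4)])
qed

lemma
  assumes "k_algebra K A" "k_algebra K B" "X \<in> carrier (tensor_alg K B A)"
  shows embed_middle_closed:
      "embed_middle K A B X \<in> carrier (tensor_alg K (tensor_alg K A B) (tensor_alg K A B))"
    and tlift_embed_middle: "k_algebra K M \<Longrightarrow> a \<in> alg_hom K A M \<Longrightarrow> c \<in> alg_hom K B M \<Longrightarrow>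
        b \<in> alg_hom K A M \<Longrightarrow> d \<in> alg_hom K B M \<Longrightarrow> commuting A B M a c \<Longrightarrow> commuting A B M b d \<Longrightarrow>
        commuting (tensor_alg K A B) (tensor_alg K A B) M (tlift K M A B a c) (tlift K M A B b d) \<Longrightarrow>
        tlift K M (tensor_alg K A B) (tensor_alg K A B) (tlift K M A B a c) (tlift K M A B b d)
          (embed_middle K A B X) = tlift K M B A c b X"
proof -
  note AB = k_algebra_tensor[OF assms(1,2)]
  note l = inr_hom[OF assms(1,2), folded restrict_pure_inr] inl_hom[OF assms(1,2), folded restrict_pure_inl]
  note r = assms(2,1) AB AB l assms(3)
  show "embed_middle K A B X \<in> carrier (tensor_alg K (tensor_alg K A B) (tensor_alg K A B))"
    unfolding embed_middle_def by (rule tensor_map_closed[OF r])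
  assume *: "k_algebra K M" "a \<in> alg_hom K A M" "c \<in> alg_hom K B M" "b \<in> alg_hom K A M" "d \<in> alg_hom K B M"
     "commuting A B M a c" "commuting A B M b d"
     "commuting (tensor_alg K A B) (tensor_alg K A B) M (tlift K M A B a c) (tlift K M A B b d)"
  note h = tlift_alg_hom[OF assms(1,2) *(1,2,3,6)] tlift_alg_hom[OF assms(1,2) *(1,4,5,7)] *(8)
  show "tlift K M (tensor_alg K A B) (tensor_alg K A B) (tlift K M A B a c) (tlift K M A B b d)
          (embed_middle K A B X) = tlift K M B A c b X"
    unfolding embed_middle_def
    by (simp add: tlift_tensor_map[OF r *(1) h] compose_tlift_pure[OF assms(1,2) *(1,2,3,6)]
      compose_tlift_pure[OF assms(1,2) *(1,4,5,7)])
qed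

context pre_bialgebra
begin

lemma twisted_comult_hom:
  assumes "J \<in> Units Sq.T"
  shows "restrict (comult (twisted_bialg K H J)) (carrier H) \<in> alg_hom K H Sq.T"
proof -
  have "restrict (comult (twisted_bialg K H J)) (carrier H) = compose (carrier H)
    (conjugation Sq.T J) (restrict (comult H) (carrier H))"
    unfolding compose_def by (rule restrict_ext) (simp add: conjugation_apply)
  then show ?thesis
    using alg_hom_compose[OF comult_hom conjugation_alg_hom[OF Sq.k_algebra_T assms] k_algebra_H] by simp
qed

lemma compose_twisted_comult:
  assumes "J \<in> Units Sq.T" "k_algebra K M" "v \<in> alg_hom K H M" "w \<in> alg_hom K H M"
    "commuting H H M v w"
  defines "f \<equiv> tlift K M H H v w J"
  shows "compose (carrier H) (tlift K M H H v w) (comult (twisted_bialg K H J)) =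
    compose (carrier H) (conjugation M f) (convolution K M H v w)"
    and "f \<in> Units M"
proof -
  note h = tlift_alg_hom[OF k_algebra_H k_algebra_H assms(2-5)]
  note J = monoid.Units_closed[OF k_algebra_monoid[OF Sq.k_algebra_T] assms(1)]
    monoid.Units_inv_closed[OF k_algebra_monoid[OF Sq.k_algebra_T] assms(1)]
  show "f \<in> Units M" unfolding f_def by (rule alg_hom_Units(1)[OF h Sq.k_algebra_T assms(2,1)])
  show "compose (carrier H) (tlift K M H H v w) (comult (twisted_bialg K H J)) =
    compose (carrier H) (conjugation M f) (convolution K M H v w)"
    unfolding compose_def
  proof (rule restrict_ext)
    fix x assume x: "x \<in> carrier H"
    have "convolution K M H v w x \<in> carrier M"
      using alg_hom_closed[OF convolution_alg_hom[OF assms(2-5)] x] .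
    then show "tlift K M H H v w (comult (twisted_bialg K H J) x) =
      conjugation M f (convolution K M H v w x)"
      using x J by (simp add: conjugation_apply alg_hom_mult[OF h] Sq.T_mult_closed convolution_apply
        alg_hom_Units(2)[OF h Sq.k_algebra_T assms(2,1)] f_def)
  qed
qed

lemma compose_conjugation:
  assumes "k_algebra K M" "u \<in> alg_hom K A M" "f \<in> Units M"
    "\<And>a. a \<in> carrier A \<Longrightarrow> u a \<otimes>\<^bsub>M\<^esub> f = f \<otimes>\<^bsub>M\<^esub> u a"
  shows "compose (carrier A) (conjugation M f) u = u"
proof (rule extensionalityI[of _ "carrier A"])
  interpret M: monoid M by (rule k_algebra_monoid[OF assms(1)])
  fix a assume a: "a \<in> carrier A"
  have "f \<otimes>\<^bsub>M\<^esub> u a \<otimes>\<^bsub>M\<^esub> inv\<^bsub>M\<^esub> f = u a \<otimes>\<^bsub>M\<^esub> (f \<otimes>\<^bsub>M\<^esub> inv\<^bsub>M\<^esub> f)"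
    using assms(3) M.Units_closed[OF assms(3)] alg_hom_closed[OF assms(2) a]
    by (simp add: assms(4)[OF a, symmetric] M.m_assoc del: M.Units_r_inv)
  then show "compose (carrier A) (conjugation M f) u a = u a"
    using assms(3) a alg_hom_closed[OF assms(2) a] by (simp add: compose_def conjugation_apply)
qed (use alg_hom_extensional[OF assms(2)] in simp_all)

lemma
  assumes "k_algebra K A" "J \<in> Units Sq.T" "X \<in> carrier (tensor_alg K A H)"
  shows twisted_comult_right_closed:
      "tensor_map K A Sq.T id (comult (twisted_bialg K H J)) X
        \<in> carrier (tensor_alg K A Sq.T)"
    and tlift_twisted_comult_right: "k_algebra K M \<Longrightarrow> u \<in> alg_hom K A M \<Longrightarrow> v \<in> alg_hom K H M \<Longrightarrow>
      w \<in> alg_hom K H M \<Longrightarrow> commuting A H M u v \<Longrightarrow> commuting A H M u w \<Longrightarrow> commuting H H M v w \<Longrightarrow>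
      tlift K M A Sq.T u (tlift K M H H v w)
        (tensor_map K A Sq.T id (comult (twisted_bialg K H J)) X) =
      tlift K M H H v w J \<otimes>\<^bsub>M\<^esub> tlift K M A H u (convolution K M H v w) X \<otimes>\<^bsub>M\<^esub> inv\<^bsub>M\<^esub> (tlift K M H H v w J)"
proof -
  note r = assms(1) k_algebra_H assms(1) Sq.k_algebra_T alg_hom_id[OF assms(1)] twisted_comult_hom[OF assms(2)]
    assms(3)
  show "tensor_map K A Sq.T id (comult (twisted_bialg K H J)) X
        \<in> carrier (tensor_alg K A Sq.T)"
    by (rule tensor_map_closed[OF r])
  assume *: "k_algebra K M" "u \<in> alg_hom K A M" "v \<in> alg_hom K H M" "w \<in> alg_hom K H M"
    "commuting A H M u v" "commuting A H M u w" "commuting H H M v w"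
  let ?f = "tlift K M H H v w J"
  let ?c = "conjugation M ?f"
  note f = compose_twisted_comult[OF assms(2) *(1,3,4,7)]
  note vw = tlift_alg_hom[OF k_algebra_H k_algebra_H *(1,3,4,7)]
    commuting_tlift_right[OF k_algebra_H k_algebra_H *(1,3,4,2,7,5,6)]
  note conv = convolution_alg_hom[OF *(1,3,4,7)] commuting_convolution_right[OF *(1,3,4,2,7,5,6)]
  have J: "J \<in> carrier Sq.T" by (rule monoid.Units_closed[OF k_algebra_monoid[OF Sq.k_algebra_T] assms(2)])
  have cu: "compose (carrier A) ?c u = u"
    by (rule compose_conjugation[OF *(1,2) f(2)]) (rule commuting_D[OF vw(2) _ J])
  interpret uc: commuting_homs K A H M u "convolution K M H v w"
    by (intro commuting_homsI assms(1) k_algebra_H * conv)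
  have "tlift K M A Sq.T u (tlift K M H H v w)
      (tensor_map K A Sq.T id (comult (twisted_bialg K H J)) X) =
      tlift K M A H (compose (carrier A) ?c u) (compose (carrier H) ?c (convolution K M H v w)) X"
    by (simp add: tlift_tensor_map[OF r *(1,2) vw] compose_id[OF *(2)] f(1) cu
      del: twisted_bialg_simps)
  also have "\<dots> = ?c (tlift K M A H u (convolution K M H v w) X)"
    by (rule tlift_compose[OF assms(1) k_algebra_H *(1,1) conjugation_alg_hom[OF *(1) f(2)] *(2) conv assms(3),
        symmetric])
  finally show "tlift K M A Sq.T u (tlift K M H H v w)
      (tensor_map K A Sq.T id (comult (twisted_bialg K H J)) X) =
      ?f \<otimes>\<^bsub>M\<^esub> tlift K M A H u (convolution K M H v w) X \<otimes>\<^bsub>M\<^esub> inv\<^bsub>M\<^esub> ?f"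
    using assms(3) by (simp add: conjugation_apply)
qed

lemma
  assumes "k_algebra K B" "J \<in> Units Sq.T" "X \<in> carrier (tensor_alg K H B)"
  shows twisted_comult_left_closed:
      "tensor_map K Sq.T B (comult (twisted_bialg K H J)) id X
        \<in> carrier (tensor_alg K Sq.T B)"
    and tlift_twisted_comult_left: "k_algebra K M \<Longrightarrow> u \<in> alg_hom K H M \<Longrightarrow> v \<in> alg_hom K H M \<Longrightarrow>
      w \<in> alg_hom K B M \<Longrightarrow> commuting H H M u v \<Longrightarrow> commuting H B M u w \<Longrightarrow> commuting H B M v w \<Longrightarrow>
      tlift K M Sq.T B (tlift K M H H u v) w
        (tensor_map K Sq.T B (comult (twisted_bialg K H J)) id X) =
      tlift K M H H u v J \<otimes>\<^bsub>M\<^esub> tlift K M H B (convolution K M H u v) w X \<otimes>\<^bsub>M\<^esub> inv\<^bsub>M\<^esub> (tlift K M H H u v J)"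
proof -
  note r = k_algebra_H assms(1) Sq.k_algebra_T assms(1) twisted_comult_hom[OF assms(2)] alg_hom_id[OF assms(1)]
    assms(3)
  show "tensor_map K Sq.T B (comult (twisted_bialg K H J)) id X
        \<in> carrier (tensor_alg K Sq.T B)"
    by (rule tensor_map_closed[OF r])
  assume *: "k_algebra K M" "u \<in> alg_hom K H M" "v \<in> alg_hom K H M" "w \<in> alg_hom K B M"
    "commuting H H M u v" "commuting H B M u w" "commuting H B M v w"
  let ?f = "tlift K M H H u v J"
  let ?c = "conjugation M ?f"
  note f = compose_twisted_comult[OF assms(2) *(1,2,3,5)]
  note uv = tlift_alg_hom[OF k_algebra_H k_algebra_H *(1,2,3,5)]
    commuting_tlift_left[OF k_algebra_H k_algebra_H *]
  note conv = convolution_alg_hom[OF *(1,2,3,5)] commuting_convolution_left[OF *]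
  have J: "J \<in> carrier Sq.T" by (rule monoid.Units_closed[OF k_algebra_monoid[OF Sq.k_algebra_T] assms(2)])
  have cw: "compose (carrier B) ?c w = w"
    by (rule compose_conjugation[OF *(1,4) f(2)]) (rule commuting_D[OF uv(2) J, symmetric])
  interpret uc: commuting_homs K H B M "convolution K M H u v" w
    by (intro commuting_homsI assms(1) k_algebra_H * conv)
  have "tlift K M Sq.T B (tlift K M H H u v) w
      (tensor_map K Sq.T B (comult (twisted_bialg K H J)) id X) =
      tlift K M H B (compose (carrier H) ?c (convolution K M H u v)) (compose (carrier B) ?c w) X"
    by (simp add: tlift_tensor_map[OF r *(1) uv(1) *(4) uv(2)] compose_id[OF *(4)] f(1) cw
      del: twisted_bialg_simps)
  also have "\<dots> = ?c (tlift K M H B (convolution K M H u v) w X)"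
    by (rule tlift_compose[OF k_algebra_H assms(1) *(1,1) conjugation_alg_hom[OF *(1) f(2)] conv(1) *(4) conv(2)
        assms(3), symmetric])
  finally show "tlift K M Sq.T B (tlift K M H H u v) w
      (tensor_map K Sq.T B (comult (twisted_bialg K H J)) id X) =
      ?f \<otimes>\<^bsub>M\<^esub> tlift K M H B (convolution K M H u v) w X \<otimes>\<^bsub>M\<^esub> inv\<^bsub>M\<^esub> ?f"
    using assms(3) by (simp add: conjugation_apply)
qed

end

context tensor_twist
begin

theorem weak_R_matrix_R: "weak_R_matrix K (twisted_bialg K H2 F2) (twisted_bialg K H1 F1) R"
  unfolding weak_R_matrix_twisted
proof (intro conjI R_Units)
  note R = R_closed
  let ?M = "tensor_alg K H2 (tensor_alg K H1 H1)"
  interpret T: twist_target K H1 H2 F ?M by (intro twist_target k_algebra_tensor alg)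
  note lr = legs_right_closed[OF alg(2,1) R]
  show "tensor_map K H2 (tensor_alg K H1 H1) id (comult (twisted_bialg K H1 F1)) R =
      leg13_right K H2 H1 R \<otimes>\<^bsub>?M\<^esub> leg12_right K H2 H1 R"
  proof (rule tensor3_eqI[OF alg(2,1,1) H1.twisted_comult_right_closed[OF alg(2) legs_Units(1) R] T.M.m_closed[OF lr(2,1)]])
    fix c a b assume *: "c \<in> alg_hom K H2 ?M" "a \<in> alg_hom K H1 ?M" "b \<in> alg_hom K H1 ?M"
      "commuting H2 H1 ?M c a" "commuting H2 H1 ?M c b" "commuting H1 H1 ?M a b"
    note [simp] = *(1,2,3,6) *(4,5)[THEN commuting_sym]
    note h = tlift_alg_hom[OF alg(2) H1.Sq.k_algebra_T T.alg_M *(1) tlift_alg_hom[OF alg(1,1) T.alg_M *(2,3,6)]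
      commuting_tlift_right[OF alg(1,1) T.alg_M *(2,3,1,6,4,5)]]
    show "tlift K ?M H2 (tensor_alg K H1 H1) c (tlift K ?M H1 H1 a b)
        (tensor_map K H2 (tensor_alg K H1 H1) id (comult (twisted_bialg K H1 F1)) R) =
      tlift K ?M H2 (tensor_alg K H1 H1) c (tlift K ?M H1 H1 a b)
        (leg13_right K H2 H1 R \<otimes>\<^bsub>?M\<^esub> leg12_right K H2 H1 R)"
      by (simp add: H1.tlift_twisted_comult_right[OF alg(2) legs_Units(1) R T.alg_M *]
        alg_hom_mult[OF h lr(2,1)] tlift_legs_right[OF alg(2,1) R T.alg_M *] T.tlift_R T.tlift_F1
        T.R_right_identity del: twisted_bialg_simps)
  qed
next
  note R = R_closed
  let ?M = "tensor_alg K (tensor_alg K H2 H2) H1"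
  interpret T: twist_target K H1 H2 F ?M by (intro twist_target k_algebra_tensor alg)
  note lr = legs_left_closed[OF alg(2,1) R]
  show "tensor_map K (tensor_alg K H2 H2) H1 (comult (twisted_bialg K H2 F2)) id R =
      leg13_left K H2 H1 R \<otimes>\<^bsub>?M\<^esub> leg23_left K H2 H1 R"
  proof (rule tensor3_left_eqI[OF alg(2,2,1) H2.twisted_comult_left_closed[OF alg(1) legs_Units(2) R] T.M.m_closed[OF lr]])
    fix c d a assume *: "c \<in> alg_hom K H2 ?M" "d \<in> alg_hom K H2 ?M" "a \<in> alg_hom K H1 ?M"
      "commuting H2 H2 ?M c d" "commuting H2 H1 ?M c a" "commuting H2 H1 ?M d a"
    note [simp] = *(1,2,3,4) *(5,6)[THEN commuting_sym]
    note h = tlift_alg_hom[OF H2.Sq.k_algebra_T alg(1) T.alg_M tlift_alg_hom[OF alg(2,2) T.alg_M *(1,2,4)]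
      *(3) commuting_tlift_left[OF alg(2,2) T.alg_M *]]
    show "tlift K ?M (tensor_alg K H2 H2) H1 (tlift K ?M H2 H2 c d) a
        (tensor_map K (tensor_alg K H2 H2) H1 (comult (twisted_bialg K H2 F2)) id R) =
      tlift K ?M (tensor_alg K H2 H2) H1 (tlift K ?M H2 H2 c d) a
        (leg13_left K H2 H1 R \<otimes>\<^bsub>?M\<^esub> leg23_left K H2 H1 R)"
      by (simp add: H2.tlift_twisted_comult_left[OF alg(1) legs_Units(2) R T.alg_M *]
        alg_hom_mult[OF h lr] tlift_legs_left[OF alg(2,1) R T.alg_M *] T.tlift_R T.tlift_F2
        T.R_left_identity del: twisted_bialg_simps)
  qed
qed

section \<open>The gauge transform by G\<close>

text \<open>The element \<open>(1 \<otimes> R\<^sup>-\<^sup>1 \<otimes> 1) \<cdot> (Id \<otimes> \<tau> \<otimes> Id)(F1 \<otimes> F2)\<close>.\<close>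

definition "F' = embed_middle K H1 H2 (inv\<^bsub>tensor_alg K H2 H1\<^esub> R)
  \<otimes>\<^bsub>tensor_alg K (tensor_alg K H1 H2) (tensor_alg K H1 H2)\<^esub>
  tensor_middle_flip K H1 H1 H2 H2 (pure_tensor K (tensor_alg K H1 H1) (tensor_alg K H2 H2) F1 F2)"

lemma G_Units_HH: "G \<in> Units HH"
  using legs_Units(3) by (simp add: Units_tensor_bialg)

text \<open>Both sides are compared on four commuting legs, where the claim is \<open>gauge_identity\<close>.\<close>

theorem gauge_G: "gauge K HH G F = F'"
proof -
  let ?M = "tensor_alg K H12 H12"
  interpret T: twist_target K H1 H2 F ?M by (intro twist_target k_algebra_tensor alg)
  interpret F12: algebra_pair K "tensor_alg K H1 H1" "tensor_alg K H2 H2"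
    by (intro algebra_pairI H1.Sq.k_algebra_T H2.Sq.k_algebra_T)
  have Ri: "inv\<^bsub>tensor_alg K H2 H1\<^esub> R \<in> carrier (tensor_alg K H2 H1)"
    by (rule monoid.Units_inv_closed[OF k_algebra_monoid[OF k_algebra_tensor[OF alg(2,1)]] R_Units])
  note F12c = F12.pure_closed[OF legs_closed(1,2)]
  note cl = embed_middle_closed[OF alg Ri] tensor_middle_flip_closed[OF alg(1,1,2,2) F12c]
  have F'c: "F' \<in> carrier ?M" unfolding F'_def by (rule T.M.m_closed[OF cl])
  have Gc: "G \<in> carrier H12" "inv\<^bsub>H12\<^esub> G \<in> carrier H12"
    using legs_closed(3) monoid.Units_inv_closed[OF k_algebra_monoid[OF H12.k_algebra_T] legs_Units(3)] by simp_all
  have gc: "gauge K HH G F \<in> carrier ?M"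
    unfolding tensor_alg_tensor_bialg[symmetric] gauge_def
    using F_closed Gc by (intro HH.Sq.T_mult_closed HH.comult_closed HH.Sq.pure_closed)
      (simp_all add: inv_tensor_bialg)
  show ?thesis
  proof (rule tensor4_eqI[OF alg alg gc F'c])
    fix a c b d assume *: "a \<in> alg_hom K H1 ?M" "c \<in> alg_hom K H2 ?M" "b \<in> alg_hom K H1 ?M"
      "d \<in> alg_hom K H2 ?M" "commuting H1 H2 ?M a c" "commuting H1 H1 ?M a b" "commuting H1 H2 ?M a d"
      "commuting H2 H1 ?M c b" "commuting H2 H2 ?M c d" "commuting H1 H2 ?M b d"
    note [simp] = *(1-7,9,10) *(8)[THEN commuting_sym]
    let ?u = "tlift K ?M H1 H2 a c" and ?v = "tlift K ?M H1 H2 b d"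
    have u: "?u \<in> alg_hom K HH ?M" and v: "?v \<in> alg_hom K HH ?M" and uv: "commuting HH HH ?M ?u ?v"
      by (rule T.tlift_HH_alg_hom T.tlift_HH_commuting; simp)+
    note uv' = u[unfolded alg_hom_tensor_bialg] v[unfolded alg_hom_tensor_bialg] uv[unfolded commuting_tensor_bialg]
    note h = tlift_alg_hom[OF H12.k_algebra_T H12.k_algebra_T T.alg_M uv']
    have ab: "tlift K ?M H1 H1 a b \<in> alg_hom K (tensor_alg K H1 H1) ?M"
      and cd: "tlift K ?M H2 H2 c d \<in> alg_hom K (tensor_alg K H2 H2) ?M"
      by (rule tlift_alg_hom; simp add: alg T.alg_M)+
    have abcd: "commuting (tensor_alg K H1 H1) (tensor_alg K H2 H2) ?M (tlift K ?M H1 H1 a b) (tlift K ?M H2 H2 c d)"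
      by (intro commuting_tlift_left[OF alg(1,1) T.alg_M] commuting_tlift_right[OF alg(2,2) T.alg_M] cd) simp_all
    let ?m = "\<lambda>x y. x \<otimes>\<^bsub>?M\<^esub> y"
    let ?E = "T.ev (T.conv1 a b) T.e2 T.e1 (T.conv2 c d)"
    have E: "?E \<in> Units ?M" "?E \<in> carrier ?M" "inv\<^bsub>?M\<^esub> ?E \<in> carrier ?M"
      by (simp_all add: T.M.Units_inv_closed)
    have P: "tlift K ?M H1 H2 (T.conv1 a b) (T.conv2 c d) \<in> alg_hom K H12 ?M"
      by (rule tlift_alg_hom[OF alg T.alg_M]) simp_all
    have "tlift K ?M HH HH ?u ?v (gauge K HH G F) =
      ?m (?m (?m (?u G) (?v G)) (T.ev a c b d)) (convolution K ?M HH ?u ?v (inv\<^bsub>HH\<^esub> G))"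
      unfolding T.ev_def by (rule HH.tlift_gauge[OF T.alg_M u v uv G_Units_HH F_closed])
    also have "convolution K ?M HH ?u ?v (inv\<^bsub>HH\<^esub> G) = inv\<^bsub>?M\<^esub> ?E"
      by (simp add: convolution_HH[OF T.alg_M] inv_tensor_bialg
        alg_hom_Units(2)[OF P H12.k_algebra_T T.alg_M legs_Units(3), symmetric] T.tlift_G)
    also have "?m (?m (?u G) (?v G)) (T.ev a c b d) =
        ?m (?m (inv\<^bsub>?M\<^esub> (T.Rv c b)) (?m (T.ev T.e1 c T.e1 d) (T.ev a T.e2 b T.e2))) ?E"
      using T.gauge_identity[of a b c d] by (simp add: T.tlift_G)
    also have "?m \<dots> (inv\<^bsub>?M\<^esub> ?E) =
        ?m (?m (inv\<^bsub>?M\<^esub> (T.Rv c b)) (?m (T.ev T.e1 c T.e1 d) (T.ev a T.e2 b T.e2))) (?m ?E (inv\<^bsub>?M\<^esub> ?E))"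
      using E by (intro T.M.m_assoc) simp_all
    also have "\<dots> = ?m (inv\<^bsub>?M\<^esub> (T.Rv c b)) (?m (T.ev T.e1 c T.e1 d) (T.ev a T.e2 b T.e2))"
      using E by simp
    also have "?m (T.ev T.e1 c T.e1 d) (T.ev a T.e2 b T.e2) = ?m (T.ev a T.e2 b T.e2) (T.ev T.e1 c T.e1 d)"
      using commuting_D[OF abcd legs_closed(1,2)] by (simp add: T.tlift_F1 T.tlift_F2)
    also have "\<dots> = tlift K ?M H12 H12 ?u ?v (tensor_middle_flip K H1 H1 H2 H2
        (pure_tensor K (tensor_alg K H1 H1) (tensor_alg K H2 H2) F1 F2))"
      by (simp add: tlift_tensor_middle_flip[OF alg(1,1,2,2) F12c T.alg_M]
        tlift_pure[OF H1.Sq.k_algebra_T H2.Sq.k_algebra_T T.alg_M ab cd abcd legs_closed(1,2)]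
        T.tlift_F1 T.tlift_F2)
    also have "inv\<^bsub>?M\<^esub> (T.Rv c b) = tlift K ?M H12 H12 ?u ?v (embed_middle K H1 H2 (inv\<^bsub>tensor_alg K H2 H1\<^esub> R))"
      by (simp add: tlift_embed_middle[OF alg Ri T.alg_M] uv' T.tlift_R)
    finally show "tlift K ?M H12 H12 ?u ?v (gauge K HH G F) = tlift K ?M H12 H12 ?u ?v F'"
      by (simp add: F'_def alg_hom_mult[OF h cl] tlift_HH)
  qed
qed

lemma counit_G: "counit HH G = \<one>\<^bsub>K\<^esub>"
proof -
  \<comment> \<open>With values in the ground field, \<open>counit_hom\<close> is the counit itself.\<close>
  interpret T: twist_target K H1 H2 F "ground_alg K" by (intro twist_target H1.k_algebra_ground_alg)
  have G: "G \<in> carrier HH" using legs_closed(3) by simp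
  have "counit HH G = counit_hom HH (ground_alg K) G"
    using HH.counit_closed[OF G] G by (simp add: counit_hom_def del: tensor_bialg_simps)
  also have "\<dots> = \<one>\<^bsub>K\<^esub>"
    by (simp add: counit_hom_HH[OF T.alg_M] T.tlift_G)
  finally show ?thesis .
qed

theorem cohomologous_F': "cohomologous K HH F F'"
  using HH.twist_gauge[OF twist_F G_Units_HH counit_G] G_Units_HH twist_F
  unfolding cohomologous_def gauge_G using gauge_G by blast

end

theorem theorem3p5:
  fixes K :: "('k, 'm) ring_scheme"
    and H1 :: "('k, 'a, 'p) bialgebra_scheme"
    and H2 :: "('k, 'b, 'q) bialgebra_scheme"
    and F :: "(('a, 'b) tensor, ('a, 'b) tensor) tensor"
  assumes "bialgebra K H1" and "bialgebra K H2"
    and "twist K (tensor_bialg K H1 H2) F"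
    and F1: "F1 = tensor_map K H1 H1 (counit_right H1 H2) (counit_right H1 H2) F"
    and F2: "F2 = tensor_map K H2 H2 (counit_left H1 H2) (counit_left H1 H2) F"
    and G: "G = tensor_map K H1 H2 (counit_right H1 H2) (counit_left H1 H2) F"
    and H: "H = tensor_map K H2 H1 (counit_left H1 H2) (counit_right H1 H2) F"
    and R: "R = tensor_flip K H1 H2 G \<otimes>\<^bsub>tensor_alg K H2 H1\<^esub> inv\<^bsub>tensor_alg K H2 H1\<^esub> H"
    and F': "F' = embed_middle K H1 H2 (inv\<^bsub>tensor_alg K H2 H1\<^esub> R)
        \<otimes>\<^bsub>tensor_alg K (tensor_alg K H1 H2) (tensor_alg K H1 H2)\<^esub>
      tensor_middle_flip K H1 H1 H2 H2
        (pure_tensor K (tensor_alg K H1 H1) (tensor_alg K H2 H2) F1 F2)"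
  shows "twist K H1 F1
    \<and> twist K H2 F2
    \<and> G \<in> Units (tensor_alg K H1 H2)
    \<and> H \<in> Units (tensor_alg K H2 H1)
    \<and> weak_R_matrix K (twisted_bialg K H2 F2) (twisted_bialg K H1 F1) R
    \<and> gauge K (tensor_bialg K H1 H2) G F = F'
    \<and> cohomologous K (tensor_bialg K H1 H2) F F'"
proof -
  interpret T: tensor_twist K H1 H2 F
    using assms(1-3) by (simp add: tensor_twist_def bialgebra_pair_def tensor_twist_axioms_def)
  note F1' = F1[folded T.F1_def] and F2' = F2[folded T.F2_def] and G' = G[folded T.G_def]
    and H' = H[folded T.H_def]
  note R' = R[unfolded G' H', folded T.R_def]
  note F'' = F'[unfolded R' F1' F2', folded T.F'_def]
  show ?thesis
    unfolding F1' F2' G' H' R' F''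
    using T.twist_F1 T.twist_F2 T.legs_Units(3,4) T.weak_R_matrix_R T.gauge_G T.cohomologous_F' by blast
qed

end
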